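(* Let $E,F$ be finite, essential, strongly connected graphs satisfying Condition (L), and let $R$ be a unital subring of $\mathbb C$ closed under complex conjugation. Assume every projection of $L_R(F)$ lies in $\mathcal D(L_R(F))$. If $L_R(E)$ is $*$-isomorphic to $L_R(F)$, then $\operatorname{sgn}(\det(I-A_E))=\operatorname{sgn}(\det(I-A_F))$.
   Context: A graph $E=(E^0,E^1,r,s)$ has vertices $E^0$, edges $E^1$, and range and source maps $r,s$. A path is a word $e_1\cdots e_n$ with $r(e_i)=s(e_{i+1})$; vertices are paths of length $0$; $E^*$ is the set of finite paths. The adjacency matrix $A_E$ is the $E^0\times E^0$ matrix with $A_E(v,w)=|s^{-1}(v)\cap r^{-1}(w)|$. $E$ is strongly connected if there is a path between any two vertices; essential if it has no sinks or sources; and satisfies Condition (L) if every cycle has an exit. The Leavitt path algebra $L_R(E)$ is the universal $R$-algebra generated by pairwise orthogonal idempotents $\{v\}_{v\in E^0}$ and $\{e,e^*\}_{e\in E^1}$ with: $e^*f=0$ for $e\ne f$; $e^*e=r(e)$; $s(e)e=e=er(e)$; $e^*s(e)=e^*=r(e)e^*$; and $v=\sum_{e\in s^{-1}(v)}ee^*$ whenever $s^{-1}(v)$ is finite and nonempty. For $\alpha=e_1\cdots e_n$ put $\alpha^*=e_n^*\cdots e_1^*$. $L_R(E)$ carries the conjugate-linear involution $(\lambda\alpha\beta^* )^*=\overline\lambda\beta\alpha^*$. A projection is an element $p$ with $p=p^2=p^*$. The diagonal is $\mathcal D(L_R(E))=\mathrm{span}_R\{\alpha\alpha^*\mid\alpha\in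 E^*\}$. *)

theory Defs
  imports Complex_Main "Graph_Theory.Graph_Theory" "HOL-Combinatorics.Permutations"
begin

text \<open>A graph E = (E0,E1,r,s) is a Graph_Theory pre_digraph with verts = E0, arcs = E1,
  tail = s (source), head = r (range). Multiple arcs and loops are allowed.\<close>

definition finite_graph :: "('v,'e) pre_digraph \<Rightarrow> bool" where
  "finite_graph G \<longleftrightarrow> fin_digraph G"

definition essential_graph :: "('v,'e) pre_digraph \<Rightarrow> bool" where
  "essential_graph G \<longleftrightarrow>
     (\<forall>v\<in>verts G. out_arcs G v \<noteq> {}) \<and> (\<forall>v\<in>verts G. in_arcs G v \<noteq> {})"

definition condition_L :: "('v,'e) pre_digraph \<Rightarrow> bool" where
  "condition_L G \<longleftrightarrow>
     (\<forall>p. pre_digraph.cycle G p \<longrightarrow>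
        (\<exists>e\<in>set p. \<exists>f\<in>arcs G. tail G f = tail G e \<and> f \<noteq> e))"

definition adj :: "('v,'e) pre_digraph \<Rightarrow> 'v \<Rightarrow> 'v \<Rightarrow> int" where
  "adj G v w = int (card {e\<in>arcs G. tail G e = v \<and> head G e = w})"

definition det_on :: "'v set \<Rightarrow> ('v \<Rightarrow> 'v \<Rightarrow> int) \<Rightarrow> int" where
  "det_on V M = (\<Sum>p\<in>{p. p permutes V}. sign p * (\<Prod>v\<in>V. M v (p v)))"

definition det_I_minus_A :: "('v,'e) pre_digraph \<Rightarrow> int" where
  "det_I_minus_A G = det_on (verts G) (\<lambda>v w. (if v = w then 1 else 0) - adj G v w)"

definition conj_closed_unital_subring :: "complex set \<Rightarrow> bool" where
  "conj_closed_unital_subring R \<longleftrightarrow>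
     0 \<in> R \<and> 1 \<in> R \<and> (\<forall>x\<in>R. \<forall>y\<in>R. x + y \<in> R \<and> x - y \<in> R \<and> x * y \<in> R)
     \<and> (\<forall>x\<in>R. cnj x \<in> R)"

datatype ('v,'e) gen = GV 'v | GE 'e | GS 'e

type_synonym ('v,'e) fa = "('v,'e) gen list \<Rightarrow> complex"

fun gen_star :: "('v,'e) gen \<Rightarrow> ('v,'e) gen" where
  "gen_star (GV v) = GV v"
| "gen_star (GE e) = GS e"
| "gen_star (GS e) = GE e"

definition gen_in :: "('v,'e) pre_digraph \<Rightarrow> ('v,'e) gen \<Rightarrow> bool" where
  "gen_in G g = (case g of GV v \<Rightarrow> v \<in> verts G | GE e \<Rightarrow> e \<in> arcs G | GS e \<Rightarrow> e \<in> arcs G)"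

text \<open>Elements: finitely supported R-linear combinations of nonempty words in the generators.\<close>
definition FA :: "complex set \<Rightarrow> ('v,'e) pre_digraph \<Rightarrow> ('v,'e) fa set" where
  "FA R G = {a. finite {w. a w \<noteq> 0} \<and> a [] = 0 \<and> (\<forall>w. a w \<in> R)
              \<and> (\<forall>w. a w \<noteq> 0 \<longrightarrow> (\<forall>g\<in>set w. gen_in G g))}"

definition fa_add :: "('v,'e) fa \<Rightarrow> ('v,'e) fa \<Rightarrow> ('v,'e) fa" where
  "fa_add a b = (\<lambda>w. a w + b w)"

definition fa_diff :: "('v,'e) fa \<Rightarrow> ('v,'e) fa \<Rightarrow> ('v,'e) fa" where
  "fa_diff a b = (\<lambda>w. a w - b w)"

definition fa_smult :: "complex \<Rightarrow> ('v,'e) fa \<Rightarrow> ('v,'e) fa" where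
  "fa_smult c a = (\<lambda>w. c * a w)"

definition fa_mult :: "('v,'e) fa \<Rightarrow> ('v,'e) fa \<Rightarrow> ('v,'e) fa" where
  "fa_mult a b = (\<lambda>w. \<Sum>i\<in>{0..length w}. a (take i w) * b (drop i w))"

definition fa_star :: "('v,'e) fa \<Rightarrow> ('v,'e) fa" where
  "fa_star a = (\<lambda>w. cnj (a (rev (map gen_star w))))"

definition mon :: "('v,'e) gen list \<Rightarrow> ('v,'e) fa" where
  "mon u = (\<lambda>w. if w = u then 1 else 0)"

definition LPA_rels :: "('v,'e) pre_digraph \<Rightarrow> ('v,'e) fa set" where
  "LPA_rels G =
      {fa_diff (mon [GV v, GV v]) (mon [GV v]) | v. v \<in> verts G}
    \<union> {mon [GV v, GV w] | v w. v \<in> verts G \<and> w \<in> verts G \<and> v \<noteq> w}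
    \<union> {mon [GS e, GE f] | e f. e \<in> arcs G \<and> f \<in> arcs G \<and> e \<noteq> f}
    \<union> {fa_diff (mon [GS e, GE e]) (mon [GV (head G e)]) | e. e \<in> arcs G}
    \<union> {fa_diff (mon [GV (tail G e), GE e]) (mon [GE e]) | e. e \<in> arcs G}
    \<union> {fa_diff (mon [GE e, GV (head G e)]) (mon [GE e]) | e. e \<in> arcs G}
    \<union> {fa_diff (mon [GS e, GV (tail G e)]) (mon [GS e]) | e. e \<in> arcs G}
    \<union> {fa_diff (mon [GV (head G e), GS e]) (mon [GS e]) | e. e \<in> arcs G}
    \<union> {fa_diff (mon [GV v]) (\<lambda>w. \<Sum>e\<in>out_arcs G v. mon [GE e, GS e] w) | v.
         v \<in> verts G \<and> finite (out_arcs G v) \<and> out_arcs G v \<noteq> {}}"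

inductive_set LPA_ideal :: "complex set \<Rightarrow> ('v,'e) pre_digraph \<Rightarrow> ('v,'e) fa set"
  for R :: "complex set" and G :: "('v,'e) pre_digraph" where
  rel: "x \<in> LPA_rels G \<Longrightarrow> x \<in> LPA_ideal R G"
| zero: "(\<lambda>w. 0) \<in> LPA_ideal R G"
| add: "x \<in> LPA_ideal R G \<Longrightarrow> y \<in> LPA_ideal R G \<Longrightarrow> fa_add x y \<in> LPA_ideal R G"
| smult: "x \<in> LPA_ideal R G \<Longrightarrow> c \<in> R \<Longrightarrow> fa_smult c x \<in> LPA_ideal R G"
| mult_left: "x \<in> LPA_ideal R G \<Longrightarrow> y \<in> FA R G \<Longrightarrow> fa_mult y x \<in> LPA_ideal R G"
| mult_right: "x \<in> LPA_ideal R G \<Longrightarrow> y \<in> FA R G \<Longrightarrow> fa_mult x y \<in> LPA_ideal R G"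

text \<open>L_R(G) is the quotient FA R G / LPA_ideal R G; a and b represent the same element
  of L_R(G) iff lpa_eq R G a b.\<close>
definition lpa_eq :: "complex set \<Rightarrow> ('v,'e) pre_digraph \<Rightarrow> ('v,'e) fa \<Rightarrow> ('v,'e) fa \<Rightarrow> bool" where
  "lpa_eq R G a b \<longleftrightarrow> fa_diff a b \<in> LPA_ideal R G"

text \<open>A *-isomorphism L_R(E) \<rightarrow> L_R(F) of *-algebras over R, given on representatives.\<close>
definition star_iso_on :: "complex set \<Rightarrow> ('v1,'e1) pre_digraph \<Rightarrow> ('v2,'e2) pre_digraph
      \<Rightarrow> (('v1,'e1) fa \<Rightarrow> ('v2,'e2) fa) \<Rightarrow> bool" where
  "star_iso_on R E F \<phi> \<longleftrightarrow>
     (\<forall>a\<in>FA R E. \<phi> a \<in> FA R F)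
   \<and> (\<forall>a\<in>FA R E. \<forall>b\<in>FA R E. lpa_eq R E a b \<longleftrightarrow> lpa_eq R F (\<phi> a) (\<phi> b))
   \<and> (\<forall>y\<in>FA R F. \<exists>a\<in>FA R E. lpa_eq R F (\<phi> a) y)
   \<and> (\<forall>a\<in>FA R E. \<forall>b\<in>FA R E. lpa_eq R F (\<phi> (fa_add a b)) (fa_add (\<phi> a) (\<phi> b)))
   \<and> (\<forall>a\<in>FA R E. \<forall>b\<in>FA R E. lpa_eq R F (\<phi> (fa_mult a b)) (fa_mult (\<phi> a) (\<phi> b)))
   \<and> (\<forall>c\<in>R. \<forall>a\<in>FA R E. lpa_eq R F (\<phi> (fa_smult c a)) (fa_smult c (\<phi> a)))
   \<and> (\<forall>a\<in>FA R E. lpa_eq R F (\<phi> (fa_star a)) (fa_star (\<phi> a)))"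

definition star_isomorphic :: "complex set \<Rightarrow> ('v1,'e1) pre_digraph \<Rightarrow> ('v2,'e2) pre_digraph \<Rightarrow> bool" where
  "star_isomorphic R E F \<longleftrightarrow> (\<exists>\<phi>. star_iso_on R E F \<phi>)"

definition is_projection :: "complex set \<Rightarrow> ('v,'e) pre_digraph \<Rightarrow> ('v,'e) fa \<Rightarrow> bool" where
  "is_projection R G p \<longleftrightarrow> p \<in> FA R G \<and> lpa_eq R G (fa_mult p p) p \<and> lpa_eq R G (fa_star p) p"

text \<open>Elements \<alpha>\<alpha>^* for \<alpha> \<in> E^*: vertices (paths of length 0) and nonempty paths.\<close>
definition diag_gens :: "('v,'e) pre_digraph \<Rightarrow> ('v,'e) fa set" where
  "diag_gens G = {mon [GV v] | v. v \<in> verts G}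
     \<union> {mon (map GE \<alpha> @ rev (map GS \<alpha>)) | \<alpha>. \<alpha> \<noteq> [] \<and> (\<exists>u v. pre_digraph.awalk G u \<alpha> v)}"

inductive_set diag_span :: "complex set \<Rightarrow> ('v,'e) pre_digraph \<Rightarrow> ('v,'e) fa set"
  for R :: "complex set" and G :: "('v,'e) pre_digraph" where
  zero: "(\<lambda>w. 0) \<in> diag_span R G"
| step: "x \<in> diag_span R G \<Longrightarrow> c \<in> R \<Longrightarrow> g \<in> diag_gens G \<Longrightarrow> fa_add (fa_smult c g) x \<in> diag_span R G"

definition in_diagonal :: "complex set \<Rightarrow> ('v,'e) pre_digraph \<Rightarrow> ('v,'e) fa \<Rightarrow> bool" where
  "in_diagonal R G p \<longleftrightarrow> (\<exists>d\<in>diag_span R G. lpa_eq R G p d)"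

end

theory Submission
  imports Defs "HOL-Library.Omega_Words_Fun" "HOL-Complex_Analysis.Complex_Analysis"
    "Jordan_Normal_Form.Schur_Decomposition"
begin

text \<open>
  In fact \<open>det (I - A_E) = det (I - A_F)\<close>. Both algebras act on functions on \<open>X \<times> \<int>\<close>, where \<open>X\<close> is the
  space of infinite paths, and condition (L) makes the elements acting diagonally exactly those
  commuting with the diagonal. By hypothesis the isomorphism carries the projections \<open>\<alpha>\<alpha>*\<close> of \<open>E\<close>
  to diagonal elements, so it identifies the diagonals and hence, by comparing characters, the path
  spaces \<open>X_E\<close> and \<open>X_F\<close>; this identification respects tail equivalence. The path length of \<open>E\<close>
  becomes a locally constant integer cocycle on \<open>X_F\<close> whose sum over a primitive cycle of \<open>F\<close> is the
  length of the corresponding primitive cycle of \<open>E\<close> (the sum is positive because going around a cycle is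
  an expanding germ). Consequently the zeta function of \<open>E\<close> equals that of \<open>F\<close> weighted by the
  cocycle, that is \<open>det (I - t A_E) = det (I - B(t))\<close> for small \<open>t > 0\<close>, with \<open>B(t)\<close> a weighted
  adjacency matrix of a higher block graph of \<open>F\<close>. Both sides are Laurent polynomials in \<open>t\<close>, and at
  \<open>t = 1\<close> the right-hand side is \<open>det (I - A_F)\<close>.
\<close>

text \<open>The obstacle is that the isomorphism need not respect the grading by path length, and
  that a periodic path may correspond to one that is only eventually periodic. Periodic points
  therefore cannot be matched one by one; they are compared by tail classes. What survives is
  isotropy: the lags of a path with itself form a subgroup of the integers, and computing its
  generator on both sides fixes a cycle sum of the cocycle up to sign. The integer coordinate lets
  one matrix row at one path determine an element near that path, even if the path is periodic.
  Local questions are thus settled by single rows, and the path space is never given a topology. The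
  zeta series of \<open>E\<close> is controlled only for small \<open>t\<close>, while the cocycle
  disappears only at \<open>t = 1\<close>. The passage between the two is possible because
  determinants, unlike the series, make sense for every \<open>t > 0\<close>. The block graph
  appears because the cocycle looks at several edges at once; with weights 1 it is compared with
  \<open>F\<close> by counting periodic points.\<close>

hide_const (open) Group.mon
hide_fact (open) Group.mon_def


section \<open>Linear functionals on the free algebra\<close>

text \<open>Rows, germ coefficients and the action on functions are all of this form; their
  linearity, and the multiplicativity of the action, come from here.\<close>

definition lin_ext :: "('w \<Rightarrow> complex) \<Rightarrow> ('w \<Rightarrow> complex) \<Rightarrow> complex" where
  "lin_ext a f = (\<Sum>w | a w \<noteq> 0. a w * f w)"

lemma lin_ext_superset:
  assumes "finite S" "{w. a w \<noteq> 0} \<subseteq> S"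
  shows "lin_ext a f = (\<Sum>w\<in>S. a w * f w)"
  unfolding lin_ext_def by (rule sum.mono_neutral_left) (use assms in auto)

lemma lin_ext_add:
  assumes "finite {w. a w \<noteq> 0}" "finite {w. b w \<noteq> 0}"
  shows "lin_ext (fa_add a b) f = lin_ext a f + lin_ext b f"
proof -
  let ?S = "{w. a w \<noteq> 0} \<union> {w. b w \<noteq> 0}"
  have "lin_ext (fa_add a b) f = (\<Sum>w\<in>?S. fa_add a b w * f w)"
    by (rule lin_ext_superset) (use assms in \<open>auto simp: fa_add_def\<close>)
  also have "\<dots> = (\<Sum>w\<in>?S. a w * f w) + (\<Sum>w\<in>?S. b w * f w)"
    by (simp add: fa_add_def distrib_right sum.distrib)
  also have "\<dots> = lin_ext a f + lin_ext b f"
    by (subst (1 2) lin_ext_superset[where S="?S"]) (use assms in auto)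
  finally show ?thesis .
qed

lemma lin_ext_smult: "lin_ext (fa_smult c a) f = c * lin_ext a f"
proof (cases "c = 0")
  case True
  then show ?thesis by (simp add: lin_ext_def fa_smult_def)
next
  case False
  then show ?thesis by (simp add: lin_ext_def fa_smult_def sum_distrib_left mult.assoc)
qed

lemma fa_diff_conv: "fa_diff a b = fa_add a (fa_smult (-1) b)"
  by (auto simp: fa_diff_def fa_add_def fa_smult_def)

lemma lin_ext_diff:
  assumes "finite {w. a w \<noteq> 0}" "finite {w. b w \<noteq> 0}"
  shows "lin_ext (fa_diff a b) f = lin_ext a f - lin_ext b f"
proof -
  have "finite {w. fa_smult (-1) b w \<noteq> 0}"
    using assms(2) by (simp add: fa_smult_def)
  then show ?thesis
    using assms(1) by (simp add: fa_diff_conv lin_ext_add lin_ext_smult)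
qed

lemma lin_ext_zero [simp]: "lin_ext (\<lambda>w. 0) f = 0"
  by (simp add: lin_ext_def)

lemma lin_ext_mon [simp]: "lin_ext (mon u) f = f u"
proof -
  have "lin_ext (mon u) f = (\<Sum>w\<in>{u}. mon u w * f w)"
    by (rule lin_ext_superset) (auto simp: mon_def)
  then show ?thesis by (simp add: mon_def)
qed

lemma finite_supp_sum:
  assumes "finite I" "\<And>i. i \<in> I \<Longrightarrow> finite {w. (x i) w \<noteq> (0::complex)}"
  shows "finite {w. (\<Sum>i\<in>I. x i w) \<noteq> 0}"
proof (rule finite_subset)
  show "{w. (\<Sum>i\<in>I. x i w) \<noteq> 0} \<subseteq> (\<Union>i\<in>I. {w. x i w \<noteq> 0})"
    using sum.not_neutral_contains_not_neutral by fastforce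
qed (use assms in auto)

lemma lin_ext_sum:
  assumes "finite I" "\<And>i. i \<in> I \<Longrightarrow> finite {w. (x i :: (_,_) fa) w \<noteq> 0}"
  shows "lin_ext (\<lambda>w. \<Sum>i\<in>I. x i w) f = (\<Sum>i\<in>I. lin_ext (x i) f)"
  using assms
proof (induction I rule: finite_induct)
  case (insert j I)
  have "lin_ext (\<lambda>w. \<Sum>i\<in>insert j I. x i w) f = lin_ext (fa_add (x j) (\<lambda>w. \<Sum>i\<in>I. x i w)) f"
    using insert by (simp add: fa_add_def)
  also have "\<dots> = lin_ext (x j) f + lin_ext (\<lambda>w. \<Sum>i\<in>I. x i w) f"
    by (rule lin_ext_add) (use insert in \<open>auto intro: finite_supp_sum\<close>)
  finally show ?case using insert by simp
qed auto

lemma fa_mult_supp: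
  "{w. fa_mult a b w \<noteq> 0} \<subseteq> (\<lambda>(u,v). u @ v) ` ({w. a w \<noteq> 0} \<times> {w. b w \<noteq> 0})"
proof
  fix w assume "w \<in> {w. fa_mult a b w \<noteq> 0}"
  then obtain i where "a (take i w) * b (drop i w) \<noteq> 0"
    unfolding fa_mult_def using sum.not_neutral_contains_not_neutral by force
  then show "w \<in> (\<lambda>(u,v). u @ v) ` ({w. a w \<noteq> 0} \<times> {w. b w \<noteq> 0})"
    by (intro image_eqI[of _ _ "(take i w, drop i w)"]) auto
qed

lemma fa_mult_pairs:
  assumes "finite {w. a w \<noteq> 0}" "finite {w. b w \<noteq> 0}"
  shows "fa_mult a b w = (\<Sum>(u,v)\<in>{p \<in> {w. a w \<noteq> 0} \<times> {w. b w \<noteq> 0}. fst p @ snd p = w}. a u * b v)"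
proof -
  have inj: "inj_on (\<lambda>i. (take i w, drop i w)) {0..length w}"
    by (intro inj_onI) (auto dest: arg_cong[where f=length])
  have "fa_mult a b w = (\<Sum>(u,v)\<in>(\<lambda>i. (take i w, drop i w)) ` {0..length w}. a u * b v)"
    by (simp add: fa_mult_def sum.reindex[OF inj])
  also have "\<dots> = (\<Sum>(u,v)\<in>{p \<in> {w. a w \<noteq> 0} \<times> {w. b w \<noteq> 0}. fst p @ snd p = w}. a u * b v)"
  proof (rule sum.mono_neutral_right)
    show "{p \<in> {w. a w \<noteq> 0} \<times> {w. b w \<noteq> 0}. fst p @ snd p = w} \<subseteq> (\<lambda>i. (take i w, drop i w)) ` {0..length w}"
    proof safe
      fix u v assume "w = fst (u, v) @ snd (u, v)"
      then show "(u, v) \<in> (\<lambda>i. (take i (fst (u, v) @ snd (u, v)), drop i (fst (u, v) @ snd (u, v)))) ` {0..length (fst (u, v) @ snd (u, v))}"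
        by (intro image_eqI[of _ _ "length u"]) auto
    qed
  qed (auto simp: image_iff)
  finally show ?thesis .
qed

text \<open>Pairs of words are grouped by their concatenation. The nested form on the right becomes
  a composition of operators once \<open>f\<close> comes from an action of words.\<close>

lemma lin_ext_mult:
  assumes A: "finite {w. a w \<noteq> 0}" and B: "finite {w. b w \<noteq> 0}"
  shows "lin_ext (fa_mult a b) f = lin_ext a (\<lambda>u. lin_ext b (\<lambda>v. f (u @ v)))"
proof -
  let ?P = "{w. a w \<noteq> 0} \<times> {w. b w \<noteq> 0}"
  let ?S = "(\<lambda>(u,v). u @ v) ` ?P"
  have fin: "finite ?P" using A B by simp
  have "lin_ext (fa_mult a b) f = (\<Sum>w\<in>?S. fa_mult a b w * f w)"
    by (rule lin_ext_superset[OF _ fa_mult_supp]) (use fin in auto)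
  also have "\<dots> = (\<Sum>w\<in>?S. \<Sum>(u,v)\<in>{p \<in> ?P. fst p @ snd p = w}. a u * b v * f (u @ v))"
    by (auto simp: fa_mult_pairs[OF A B] sum_distrib_right intro!: sum.cong)
  also have "\<dots> = (\<Sum>(u,v)\<in>?P. a u * b v * f (u @ v))"
    by (rule sum.group) (use fin in auto)
  also have "\<dots> = lin_ext a (\<lambda>u. lin_ext b (\<lambda>v. f (u @ v)))"
    by (simp add: lin_ext_def sum.cartesian_product[symmetric] sum_distrib_left mult.assoc)
  finally show ?thesis .
qed

lemma lin_ext_cong: "(\<And>w. a w \<noteq> 0 \<Longrightarrow> f w = g w) \<Longrightarrow> lin_ext a f = lin_ext a g"
  unfolding lin_ext_def by (rule sum.cong) auto

lemma lin_ext_sum_right: "lin_ext a (\<lambda>w. \<Sum>i\<in>I. f i w) = (\<Sum>i\<in>I. lin_ext a (f i))"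
  unfolding lin_ext_def by (simp add: sum_distrib_left sum.swap[of _ _ I])

lemma gen_star_gen_star [simp]: "gen_star (gen_star g) = g"
  by (cases g) auto

definition word_star :: "('v,'e) gen list \<Rightarrow> ('v,'e) gen list" where
  "word_star w = rev (map gen_star w)"

lemma word_star_word_star [simp]: "word_star (word_star w) = w"
  by (simp add: word_star_def rev_map comp_def)

lemma lin_ext_star: "lin_ext (fa_star a) f = cnj (lin_ext a (\<lambda>w. cnj (f (word_star w))))"
proof -
  have "lin_ext (fa_star a) f = (\<Sum>w\<in>word_star ` {w. a w \<noteq> 0}. fa_star a w * f w)"
    unfolding lin_ext_def
    by (intro sum.cong refl) (auto simp: fa_star_def word_star_def[symmetric] image_iff
        intro!: exI[of _ "word_star _"])
  also have "\<dots> = (\<Sum>w\<in>{w. a w \<noteq> 0}. fa_star a (word_star w) * f (word_star w))"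
    by (rule sum.reindex_cong[of word_star]) (auto intro: inj_on_inverseI[of _ word_star])
  also have "\<dots> = cnj (lin_ext a (\<lambda>w. cnj (f (word_star w))))"
    by (simp add: lin_ext_def fa_star_def word_star_def[symmetric])
  finally show ?thesis .
qed

lemma fa_mult_mon_mon: "fa_mult (mon u) (mon v) = mon (u @ v)"
proof
  fix w
  have "fa_mult (mon u) (mon v) w = lin_ext (fa_mult (mon u) (mon v)) (\<lambda>z. if z = w then 1 else 0)"
  proof -
    have "finite {w. fa_mult (mon u) (mon v :: ('a,'b) fa) w \<noteq> 0}"
      by (rule finite_subset[OF fa_mult_supp]) (auto simp: mon_def)
    then show ?thesis by (simp add: lin_ext_def if_distrib sum.delta cong: if_cong)
  qed
  also have "\<dots> = mon (u @ v) w"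
    by (subst lin_ext_mult) (auto simp: mon_def lin_ext_mon[unfolded mon_def])
  finally show "fa_mult (mon u) (mon v) w = mon (u @ v) w" .
qed

lemma lin_ext_at:
  assumes "finite {w. a w \<noteq> 0}"
  shows "lin_ext a (\<lambda>z. if z = w then 1 else 0) = a w"
  using assms by (simp add: lin_ext_def if_distrib sum.delta cong: if_cong)

lemma finite_supp_mon [simp]: "finite {w. mon u w \<noteq> 0}"
  by (simp add: mon_def)

lemma finite_supp_mult:
  assumes "finite {w. a w \<noteq> 0}" "finite {w. b w \<noteq> 0}"
  shows "finite {w. fa_mult a b w \<noteq> 0}"
  by (rule finite_subset[OF fa_mult_supp]) (use assms in auto)

lemma fa_eqI:
  assumes "finite {w. a w \<noteq> 0}" "finite {w. b w \<noteq> 0}" "\<And>f. lin_ext a f = lin_ext b f"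
  shows "a = b"
proof
  fix w show "a w = b w" using lin_ext_at[OF assms(1), of w] lin_ext_at[OF assms(2), of w] assms(3) by simp
qed


section \<open>The representation on infinite paths\<close>

text \<open>The only solution is the word repeating \<open>\<gamma>\<close> for ever. This gives the
  injectivity of prefixes on points of a given period, and later the contradiction with condition
  (L).\<close>

lemma conc_fixpoint_unique:
  assumes "\<gamma> \<noteq> []" "\<gamma> \<frown> z = z" "\<gamma> \<frown> z' = z'"
  shows "z = z'"
proof
  fix n show "z n = z' n"
  proof (induction n rule: less_induct)
    case (less n)
    show ?case
    proof (cases "n < length \<gamma>")
      case True
      then show ?thesis using assms(2,3) conc_fst by metis
    next
      case False
      then have "z n = z (n - length \<gamma>)" "z' n = z' (n - length \<gamma>)"
        using assms(2,3) conc_snd by metis+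
      moreover have "0 < length \<gamma>" using assms(1) by simp
      then have "n - length \<gamma> < n" using False by linarith
      ultimately show ?thesis using less[of "n - length \<gamma>"] by simp
    qed
  qed
qed

section \<open>Infinite paths and their periodic points\<close>

context fin_digraph
begin

definition X :: "(nat \<Rightarrow> 'b) set" where
  "X = {x. \<forall>n. x n \<in> arcs G \<and> head G (x n) = tail G (x (Suc n))}"

text \<open>These encode closed walks of length \<open>m\<close> with a base point. The least period
  may be smaller, and \<open>m = 0\<close> gives all of \<open>X\<close>.\<close>

definition closed_seq :: "nat \<Rightarrow> (nat \<Rightarrow> 'b) set" where
  "closed_seq m = {x\<in>X. suffix m x = x}"

lemma awalk_prefix:
  assumes "x \<in> X"
  shows "awalk (tail G (x 0)) (prefix m x) (tail G (x m))"
proof (induction m)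
  case 0
  then show ?case using assms by (auto simp: awalk_Nil_iff X_def)
next
  case (Suc m)
  then show ?case using assms by (auto simp: X_def awalk_append_iff awalk_Cons_iff awalk_Nil_iff)
qed

lemma inj_on_prefix_closed: assumes "m > 0" shows "inj_on (prefix m) (closed_seq m)"
proof (rule inj_onI)
  fix x y assume xy: "x \<in> closed_seq m" "y \<in> closed_seq m" "prefix m x = prefix m y"
  have "prefix m z \<frown> z = z" if "z \<in> closed_seq m" for z
  proof -
    have "suffix m z = z" using that by (simp add: closed_seq_def)
    from prefix_suffix[of z m, symmetric, unfolded this] show ?thesis .
  qed
  note fp = this[OF xy(1), unfolded xy(3)] this[OF xy(2)]
  have "prefix m y \<noteq> []" using assms by simp
  from conc_fixpoint_unique[OF this fp] show "x = y" .
qed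

lemma prefix_closed: "prefix m ` closed_seq m \<subseteq> {\<alpha>. set \<alpha> \<subseteq> arcs G \<and> length \<alpha> = m}"
  by (auto simp: closed_seq_def X_def)

lemma finite_closed: "m > 0 \<Longrightarrow> finite (closed_seq m)"
  by (rule finite_imageD[OF finite_subset[OF prefix_closed] inj_on_prefix_closed])
     (simp_all add: finite_lists_length_eq)

lemma card_closed: assumes "m > 0" shows "card (closed_seq m) \<le> card (arcs G) ^ m"
  using card_inj_on_le[OF inj_on_prefix_closed[OF assms] prefix_closed]
  by (simp add: finite_lists_length_eq card_lists_length_eq)

end

section \<open>Coefficients, free algebra and path representation of one graph\<close>

locale lpa = fin_digraph G for G :: "('v,'e) pre_digraph" +
  fixes R :: "complex set"
  assumes subring: "conj_closed_unital_subring R"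
    and no_sinks: "v \<in> verts G \<Longrightarrow> out_arcs G v \<noteq> {}"
    and cond_L: "condition_L G"
begin

lemma R_zero [simp]: "0 \<in> R" and R_one [simp]: "1 \<in> R"
  and R_add: "x \<in> R \<Longrightarrow> y \<in> R \<Longrightarrow> x + y \<in> R"
  and R_diff: "x \<in> R \<Longrightarrow> y \<in> R \<Longrightarrow> x - y \<in> R"
  and R_mult: "x \<in> R \<Longrightarrow> y \<in> R \<Longrightarrow> x * y \<in> R"
  and R_cnj: "x \<in> R \<Longrightarrow> cnj x \<in> R"
  using subring by (auto simp: conj_closed_unital_subring_def)

lemma R_minus_one [simp]: "-1 \<in> R"
  using R_diff[of 0 1] by simp

lemma R_sum: "(\<And>i. i \<in> I \<Longrightarrow> f i \<in> R) \<Longrightarrow> sum f I \<in> R"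
  by (induction I rule: infinite_finite_induct) (auto intro: R_add)

abbreviation gens :: "('v,'e) gen list \<Rightarrow> bool" where
  "gens w \<equiv> \<forall>g\<in>set w. gen_in G g"

abbreviation LFA where "LFA \<equiv> FA R G"
abbreviation I where "I \<equiv> LPA_ideal R G"

lemma FA_fin: "a \<in> LFA \<Longrightarrow> finite {w. a w \<noteq> 0}"
  and FA_gens: "a \<in> LFA \<Longrightarrow> a w \<noteq> 0 \<Longrightarrow> gens w"
  and FA_R: "a \<in> LFA \<Longrightarrow> a w \<in> R"
  and FA_Nil: "a \<in> LFA \<Longrightarrow> a [] = 0"
  by (auto simp: FA_def)

lemma FA_zero [simp]: "(\<lambda>w. 0) \<in> LFA"
  by (simp add: FA_def)

lemma FA_mon: "gens w \<Longrightarrow> w \<noteq> [] \<Longrightarrow> mon w \<in> LFA"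
  by (auto simp: FA_def mon_def)

lemma FA_add: assumes "a \<in> LFA" "b \<in> LFA" shows "fa_add a b \<in> LFA"
proof -
  have "finite {w. a w + b w \<noteq> 0}"
    by (rule finite_subset[of _ "{w. a w \<noteq> 0} \<union> {w. b w \<noteq> 0}"]) (use assms in \<open>auto simp: FA_def\<close>)
  then show ?thesis
    using assms unfolding FA_def fa_add_def by (auto intro: R_add) (metis add.right_neutral)
qed

lemma FA_smult: assumes "a \<in> LFA" "c \<in> R" shows "fa_smult c a \<in> LFA"
proof -
  have "finite {w. c * a w \<noteq> 0}"
    by (rule finite_subset[of _ "{w. a w \<noteq> 0}"]) (use assms in \<open>auto simp: FA_def\<close>)
  then show ?thesis
    using assms unfolding FA_def fa_smult_def by (auto intro: R_mult)
qed

lemma FA_diff: "a \<in> LFA \<Longrightarrow> b \<in> LFA \<Longrightarrow> fa_diff a b \<in> LFA"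
  unfolding fa_diff_conv by (intro FA_add FA_smult) auto

lemma FA_mult: assumes a: "a \<in> LFA" and b: "b \<in> LFA" shows "fa_mult a b \<in> LFA"
proof -
  have "finite {w. fa_mult a b w \<noteq> 0}"
    using assms by (intro finite_supp_mult FA_fin)
  moreover have "fa_mult a b [] = 0"
    using assms by (simp add: fa_mult_def FA_Nil)
  moreover have "fa_mult a b w \<in> R" for w
    unfolding fa_mult_def by (intro R_sum R_mult FA_R assms)
  moreover have "gens w" if "fa_mult a b w \<noteq> 0" for w
  proof -
    from that obtain u v where "w = u @ v" "a u \<noteq> 0" "b v \<noteq> 0"
      using subsetD[OF fa_mult_supp, of w a b] by auto
    then show ?thesis using FA_gens[OF a] FA_gens[OF b] by auto
  qed
  ultimately show ?thesis by (auto simp: FA_def)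
qed

lemma gen_in_star [simp]: "gen_in G (gen_star g) = gen_in G g"
  by (cases g) (auto simp: gen_in_def)

lemma gens_star [simp]: "gens (word_star w) = gens w"
  by (auto simp: word_star_def)

lemma FA_star: assumes a: "a \<in> LFA" shows "fa_star a \<in> LFA"
proof -
  have "{w. fa_star a w \<noteq> 0} = word_star ` {w. a w \<noteq> 0}"
    by (auto simp: fa_star_def word_star_def[symmetric] image_iff intro!: exI[of _ "word_star _"])
  moreover have "gens w" if "fa_star a w \<noteq> 0" for w
    using FA_gens[OF a, of "word_star w"] that by (simp add: fa_star_def word_star_def[symmetric])
  ultimately show ?thesis
    using a by (auto simp: FA_def fa_star_def word_star_def[symmetric] intro: R_cnj)
      (auto simp: word_star_def)
qed

lemma FA_sum:
  assumes "\<And>i. i \<in> S \<Longrightarrow> x i \<in> LFA"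
  shows "(\<lambda>w. \<Sum>i\<in>S. x i w) \<in> LFA"
  using assms
proof (induction S rule: infinite_finite_induct)
  case (insert j S)
  have "fa_add (x j) (\<lambda>w. \<Sum>i\<in>S. x i w) \<in> LFA"
    using insert by (intro FA_add) auto
  then show ?case using insert by (simp add: fa_add_def)
qed auto

lemma gen_in_simps [simp]:
  "gen_in G (GV v) = (v \<in> verts G)" "gen_in G (GE e) = (e \<in> arcs G)" "gen_in G (GS e) = (e \<in> arcs G)"
  by (auto simp: gen_in_def)

lemma rels_FA: assumes "x \<in> LPA_rels G" shows "x \<in> LFA"
proof -
  have ck: "fa_diff (mon [GV v]) (\<lambda>w. \<Sum>e\<in>out_arcs G v. mon [GE e, GS e] w) \<in> LFA" if "v \<in> verts G" for v
    by (intro FA_diff FA_sum FA_mon) (use that in \<open>auto simp: out_arcs_def\<close>)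
  then show ?thesis
    using assms unfolding LPA_rels_def
    by (elim UnE) ((auto intro!: FA_diff FA_mon; fail) | (use ck in blast))+
qed

lemma ideal_FA: "x \<in> I \<Longrightarrow> x \<in> LFA"
  by (induction rule: LPA_ideal.induct) (auto intro: rels_FA FA_add FA_smult FA_mult)

text \<open>Words act on the right, through the partial inverses of the usual left action on paths; the
  integer coordinate records the degree. An operator then has finitely supported rows.\<close>
primrec ract1 :: "('v,'e) gen \<Rightarrow> (nat \<Rightarrow> 'e) \<times> int \<Rightarrow> ((nat \<Rightarrow> 'e) \<times> int) option" where
  "ract1 (GV v) p = (if tail G (fst p 0) = v then Some p else None)"
| "ract1 (GE e) p = (if fst p 0 = e then Some (suffix 1 (fst p), snd p - 1) else None)"
| "ract1 (GS e) p = (if head G e = tail G (fst p 0) then Some (e ## fst p, snd p + 1) else None)"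

primrec ract :: "('v,'e) gen list \<Rightarrow> (nat \<Rightarrow> 'e) \<times> int \<Rightarrow> ((nat \<Rightarrow> 'e) \<times> int) option" where
  "ract [] p = Some p"
| "ract (g # w) p = Option.bind (ract1 g p) (ract w)"

lemma ract_append: "ract (u @ w) p = Option.bind (ract u p) (ract w)"
  by (induction u arbitrary: p) (auto split: bind_splits)

lemma X_suffix: "x \<in> X \<Longrightarrow> suffix k x \<in> X"
  by (auto simp: X_def)

lemma X_build: "e ## x \<in> X \<longleftrightarrow> e \<in> arcs G \<and> head G e = tail G (x 0) \<and> x \<in> X"
proof
  assume "e ## x \<in> X"
  then have *: "(e ## x) n \<in> arcs G \<and> head G ((e ## x) n) = tail G ((e ## x) (Suc n))" for n
    unfolding X_def by blast
  show "e \<in> arcs G \<and> head G e = tail G (x 0) \<and> x \<in> X"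
    using *[of 0] *[of "Suc _"] by (auto simp: X_def)
next
  assume *: "e \<in> arcs G \<and> head G e = tail G (x 0) \<and> x \<in> X"
  have "(e ## x) n \<in> arcs G \<and> head G ((e ## x) n) = tail G ((e ## x) (Suc n))" for n
    using * by (cases n) (auto simp: X_def)
  then show "e ## x \<in> X" by (auto simp: X_def)
qed

lemma X_ract1: "ract1 g p = Some q \<Longrightarrow> gen_in G g \<Longrightarrow> fst p \<in> X \<Longrightarrow> fst q \<in> X"
  by (cases g) (auto split: if_splits simp: X_suffix X_build)

lemma X_ract: "ract w p = Some q \<Longrightarrow> gens w \<Longrightarrow> fst p \<in> X \<Longrightarrow> fst q \<in> X"
proof (induction w arbitrary: p)
  case (Cons g w)
  then show ?case by (auto simp: bind_eq_Some_conv dest: X_ract1)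
qed auto

lemma suffix_build [simp]: "suffix (Suc 0) (e ## x) = x"
  by (auto simp: fun_eq_iff)

lemma ract1_star:
  assumes "fst p \<in> X" "ract1 g p = Some q"
  shows "ract1 (gen_star g) q = Some p"
proof (cases p)
  case (Pair x k)
  have *: "head G (x 0) = tail G (x (Suc 0))" using assms(1) Pair by (auto simp: X_def)
  have b: "x 0 ## suffix (Suc 0) x = x" by (rule build_first)
  show ?thesis
  proof (cases g)
    case (GE e)
    then have "x 0 = e" "q = (suffix (Suc 0) x, k - 1)"
      using assms(2) Pair by (simp_all split: if_splits)
    then show ?thesis using GE Pair * b by simp
  next
    case (GS e)
    then have "q = (e ## x, k + 1)"
      using assms(2) Pair by (simp split: if_splits)
    then show ?thesis using GS Pair by simp
  next
    case (GV v)
    then show ?thesis using assms(2) by (simp split: if_splits)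
  qed
qed

lemma ract_star_imp:
  "fst p \<in> X \<Longrightarrow> gens w \<Longrightarrow> ract w p = Some q \<Longrightarrow> ract (word_star w) q = Some p"
proof (induction w arbitrary: p)
  case Nil
  then show ?case by (simp add: word_star_def)
next
  case (Cons g w)
  then obtain r where r: "ract1 g p = Some r" "ract w r = Some q"
    by (auto simp: bind_eq_Some_conv)
  then have "ract (word_star w) q = Some r" using Cons X_ract1 by auto
  moreover have "word_star (g # w) = word_star w @ [gen_star g]" by (simp add: word_star_def)
  ultimately show ?case using ract1_star[OF Cons.prems(1) r(1)] by (simp add: ract_append)
qed

lemma ract_star:
  assumes "fst p \<in> X" "fst q \<in> X" "gens w"
  shows "ract w p = Some q \<longleftrightarrow> ract (word_star w) q = Some p"
  using ract_star_imp[of p w q] ract_star_imp[of q "word_star w" p] assms by auto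

text \<open>All operators commute with translations of the integer coordinate, so the rows based at
  \<open>(x, 0)\<close> carry all the information.\<close>

lemma ract_shift: "ract w (x, k + j) = map_option (\<lambda>(y,l). (y, l + j)) (ract w (x,k))"
proof (induction w arbitrary: x k)
  case (Cons g w)
  have *: "k + j - 1 = (k - 1) + j" "k + j + 1 = (k + 1) + j" by auto
  show ?case by (cases g) (simp_all add: * Cons suffix_def)
qed auto

text \<open>Points are moved from the right and functions are pulled back, so the order of factors
  is preserved in \<open>act_mult\<close>.\<close>

definition act :: "('v,'e) fa \<Rightarrow> ((nat \<Rightarrow> 'e) \<times> int \<Rightarrow> complex) \<Rightarrow> (nat \<Rightarrow> 'e) \<times> int \<Rightarrow> complex" where
  "act a \<xi> p = lin_ext a (\<lambda>w. case ract w p of None \<Rightarrow> 0 | Some q \<Rightarrow> \<xi> q)"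

definition row :: "('v,'e) fa \<Rightarrow> (nat \<Rightarrow> 'e) \<times> int \<Rightarrow> (nat \<Rightarrow> 'e) \<times> int \<Rightarrow> complex" where
  "row a p q = lin_ext a (\<lambda>w. if ract w p = Some q then 1 else 0)"

lemma act_mult:
  assumes "a \<in> LFA" "b \<in> LFA"
  shows "act (fa_mult a b) \<xi> p = act a (act b \<xi>) p"
  unfolding act_def lin_ext_mult[OF FA_fin[OF assms(1)] FA_fin[OF assms(2)]]
  by (rule lin_ext_cong) (auto simp: ract_append lin_ext_def split: option.splits)

lemma act_add: "a \<in> LFA \<Longrightarrow> b \<in> LFA \<Longrightarrow> act (fa_add a b) \<xi> p = act a \<xi> p + act b \<xi> p"
  and act_diff: "a \<in> LFA \<Longrightarrow> b \<in> LFA \<Longrightarrow> act (fa_diff a b) \<xi> p = act a \<xi> p - act b \<xi> p"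
  and act_smult: "act (fa_smult c a) \<xi> p = c * act a \<xi> p"
  and act_mon [simp]: "act (mon w) \<xi> p = (case ract w p of None \<Rightarrow> 0 | Some q \<Rightarrow> \<xi> q)"
  by (simp_all add: act_def lin_ext_add lin_ext_diff lin_ext_smult FA_fin)

lemma row_add: "a \<in> LFA \<Longrightarrow> b \<in> LFA \<Longrightarrow> row (fa_add a b) p q = row a p q + row b p q"
  and row_diff: "a \<in> LFA \<Longrightarrow> b \<in> LFA \<Longrightarrow> row (fa_diff a b) p q = row a p q - row b p q"
  and row_smult: "row (fa_smult c a) p q = c * row a p q"
  and row_mon [simp]: "row (mon w) p q = (if ract w p = Some q then 1 else 0)"
  by (simp_all add: row_def lin_ext_add lin_ext_diff lin_ext_smult FA_fin)

lemma row_sum: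
  assumes "finite S" "\<And>i. i \<in> S \<Longrightarrow> x i \<in> LFA"
  shows "row (\<lambda>w. \<Sum>i\<in>S. x i w) p q = (\<Sum>i\<in>S. row (x i) p q)"
  unfolding row_def by (rule lin_ext_sum) (use assms FA_fin in auto)

lemma act_sum:
  assumes "finite S" "\<And>i. i \<in> S \<Longrightarrow> x i \<in> LFA"
  shows "act (\<lambda>w. \<Sum>i\<in>S. x i w) \<xi> p = (\<Sum>i\<in>S. act (x i) \<xi> p)"
  unfolding act_def by (rule lin_ext_sum) (use assms FA_fin in auto)

lemma act_cong_X:
  assumes "a \<in> LFA" "fst p \<in> X" "\<And>q. fst q \<in> X \<Longrightarrow> \<xi> q = \<eta> q"
  shows "act a \<xi> p = act a \<eta> p"
  unfolding act_def
  by (rule lin_ext_cong) (use assms FA_gens X_ract in \<open>auto split: option.splits\<close>)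

lemma row_conv_act: "row a p q = act a (\<lambda>r. if r = q then 1 else 0) p"
  unfolding row_def act_def by (rule lin_ext_cong) (auto split: option.splits)

lemma row_neq_zero:
  assumes "row a p q \<noteq> 0"
  shows "\<exists>w. a w \<noteq> 0 \<and> ract w p = Some q"
proof (rule ccontr)
  assume "\<not> ?thesis"
  then have "row a p q = 0" unfolding row_def lin_ext_def by (intro sum.neutral) auto
  with assms show False by simp
qed

lemma act_row:
  assumes "finite T" "{q. row a p q \<noteq> 0} \<subseteq> T" "a \<in> LFA"
  shows "act a \<xi> p = (\<Sum>q\<in>T. row a p q * \<xi> q)"
proof -
  \<comment> \<open>\<open>?S\<close> collects the points reached by some word of \<open>a\<close>.
    The row may vanish at some of them by cancellation, so the sum passes from \<open>?S\<close> to
    \<open>?S \<inter> T\<close> and from there to \<open>T\<close>.\<close>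
  let ?S = "{q. \<exists>w. a w \<noteq> 0 \<and> ract w p = Some q}"
  have fS: "finite ?S"
  proof (rule finite_subset)
    show "?S \<subseteq> the ` (\<lambda>w. ract w p) ` {w. a w \<noteq> 0}" by force
  qed (use assms FA_fin in auto)
  have S: "{q. row a p q \<noteq> 0} \<subseteq> ?S"
    using row_neq_zero by blast
  have "act a \<xi> p = lin_ext a (\<lambda>w. \<Sum>q\<in>?S. (if ract w p = Some q then 1 else 0) * \<xi> q)"
    unfolding act_def
  proof (rule lin_ext_cong)
    fix w assume w: "a w \<noteq> 0"
    show "(case ract w p of None \<Rightarrow> 0 | Some q \<Rightarrow> \<xi> q) = (\<Sum>q\<in>?S. (if ract w p = Some q then 1 else 0) * \<xi> q)"
    proof (cases "ract w p")
      case (Some r)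
      then have "r \<in> ?S" using w by auto
      then show ?thesis using Some fS by (simp add: if_distrib[of "\<lambda>c. c * _"] sum.delta cong: if_cong)
    qed auto
  qed
  also have "\<dots> = (\<Sum>q\<in>?S. row a p q * \<xi> q)"
    unfolding lin_ext_sum_right row_def
    by (rule sum.cong) (simp_all add: lin_ext_def sum_distrib_right mult.assoc)
  also have "\<dots> = (\<Sum>q\<in>?S \<inter> T. row a p q * \<xi> q)"
    by (rule sum.mono_neutral_right) (use fS assms(2) in auto)
  also have "\<dots> = (\<Sum>q\<in>T. row a p q * \<xi> q)"
    by (rule sum.mono_neutral_left) (use assms(1) S in auto)
  finally show ?thesis .
qed

lemma finite_row: assumes "a \<in> LFA" shows "finite {q. row a p q \<noteq> 0}"
proof (rule finite_subset)
  show "{q. row a p q \<noteq> 0} \<subseteq> (\<lambda>w. the (ract w p)) ` {w. a w \<noteq> 0}"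
  proof
    fix q assume "q \<in> {q. row a p q \<noteq> 0}"
    then obtain w where "a w \<noteq> 0" "ract w p = Some q" using row_neq_zero by blast
    then show "q \<in> (\<lambda>w. the (ract w p)) ` {w. a w \<noteq> 0}"
      by (intro image_eqI[of _ _ w]) auto
  qed
qed (use FA_fin[OF assms] in auto)

lemma row_mult: 
  assumes "finite T" "{q. row a p q \<noteq> 0} \<subseteq> T" "a \<in> LFA" "b \<in> LFA"
  shows "row (fa_mult a b) p r = (\<Sum>q\<in>T. row a p q * row b q r)"
  using act_row[OF assms(1-3)] act_mult[OF assms(3,4)] unfolding row_conv_act[of "fa_mult a b"]
  by (simp add: row_conv_act[of b])

lemma row_in_X:
  assumes "a \<in> LFA" "fst p \<in> X" "row a p q \<noteq> 0"
  shows "fst q \<in> X"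
proof -
  obtain w where "a w \<noteq> 0" "ract w p = Some q"
    using row_neq_zero[OF assms(3)] by blast
  then show ?thesis using assms FA_gens X_ract by blast
qed

lemma row_R: "a \<in> LFA \<Longrightarrow> row a p q \<in> R"
  unfolding row_def lin_ext_def by (intro R_sum R_mult FA_R) auto

lemma row_star:
  assumes "a \<in> LFA" "fst p \<in> X" "fst q \<in> X"
  shows "row (fa_star a) p q = cnj (row a q p)"
proof -
  have "row (fa_star a) p q = cnj (lin_ext a (\<lambda>w. cnj (if ract (word_star w) p = Some q then 1 else 0)))"
    unfolding row_def lin_ext_star ..
  also have "lin_ext a (\<lambda>w. cnj (if ract (word_star w) p = Some q then 1 else 0)) = row a q p"
    unfolding row_def
    by (rule lin_ext_cong) (use assms ract_star[of q p] FA_gens in auto)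
  finally show ?thesis .
qed

lemma row_shift: "row a (x, k + j) (y, l + j) = row a (x, k) (y, l)"
  unfolding row_def
proof (rule lin_ext_cong)
  fix w
  show "(if ract w (x, k + j) = Some (y, l + j) then 1 else 0) = (if ract w (x, k) = Some (y, l) then 1 else (0::complex))"
    unfolding ract_shift by (cases "ract w (x,k)") auto
qed

lemma row_base: "row a (x, k) (y, l) = row a (x, 0) (y, l - k)"
  using row_shift[of a x 0 k y "l - k"] by simp

lemma rels_act:
  assumes "x \<in> LPA_rels G" "fst p \<in> X"
  shows "act x \<xi> p = 0"
proof -
  obtain y k where p: "p = (y, k)" by (cases p)
  have y: "y n \<in> arcs G" "head G (y n) = tail G (y (Suc n))" for n
    using assms p by (auto simp: X_def)
  \<comment> \<open>Among the edges leaving \<open>v\<close> only the first edge of \<open>y\<close>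
    can be removed from \<open>y\<close>. The sum therefore has one nonzero term at most, and it has
    one exactly when \<open>y\<close> starts at \<open>v\<close>.\<close>
  have ck: "act (fa_diff (mon [GV v]) (\<lambda>w. \<Sum>e\<in>out_arcs G v. mon [GE e, GS e] w)) \<xi> p = 0" if v: "v \<in> verts G" for v
  proof -
    have fin: "finite (out_arcs G v)" by blast
    have mem: "mon [GE e, GS e] \<in> LFA" if "e \<in> out_arcs G v" for e
      using that by (intro FA_mon) (auto simp: out_arcs_def)
    have s: "act (\<lambda>w. \<Sum>e\<in>out_arcs G v. mon [GE e, GS e] w) \<xi> p = (\<Sum>e\<in>out_arcs G v. act (mon [GE e, GS e]) \<xi> p)"
      by (rule act_sum[OF fin mem])
    have "act (fa_diff (mon [GV v]) (\<lambda>w. \<Sum>e\<in>out_arcs G v. mon [GE e, GS e] w)) \<xi> p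
        = act (mon [GV v]) \<xi> p - (\<Sum>e\<in>out_arcs G v. act (mon [GE e, GS e]) \<xi> p)"
      unfolding s[symmetric] by (rule act_diff) (use v mem in \<open>auto intro!: FA_mon FA_sum\<close>)
    also have "(\<Sum>e\<in>out_arcs G v. act (mon [GE e, GS e]) \<xi> p) = (\<Sum>e\<in>out_arcs G v. if e = y 0 then \<xi> p else 0)"
      using y by (intro sum.cong) (auto simp: p)
    also have "\<dots> = act (mon [GV v]) \<xi> p"
      using fin y by (auto simp: p sum.delta out_arcs_def)
    finally show ?thesis by simp
  qed
  show ?thesis
    using assms(1) unfolding LPA_rels_def using y ck
    by (elim UnE) (auto simp: act_diff FA_mon p split: if_splits)
qed

text \<open>The induction needs all \<open>\<xi>\<close> and \<open>p\<close> at once: a factor on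
  the right changes the function, a factor on the left changes the point.\<close>

lemma ideal_act:
  assumes "x \<in> I" "fst p \<in> X"
  shows "act x \<xi> p = 0"
  using assms
proof (induction arbitrary: \<xi> p rule: LPA_ideal.induct)
  case (mult_left x y)
  have "act (fa_mult y x) \<xi> p = act y (act x \<xi>) p"
    by (rule act_mult) (use mult_left ideal_FA in auto)
  also have "\<dots> = act y (\<lambda>_. 0) p"
    by (rule act_cong_X) (use mult_left in auto)
  also have "\<dots> = 0" by (auto simp: act_def lin_ext_def intro!: sum.neutral split: option.splits)
  finally show ?case .
qed (auto simp: rels_act act_add act_smult act_mult ideal_FA, auto simp: act_def)

lemma ideal_row: "x \<in> I \<Longrightarrow> fst p \<in> X \<Longrightarrow> row x p q = 0"
  by (simp add: row_conv_act ideal_act)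

end


section \<open>Germs and faithfulness\<close>

lemma fa_mult_diff_left: "fa_mult (fa_diff a b) c = fa_diff (fa_mult a c) (fa_mult b c)"
  and fa_mult_diff_right: "fa_mult c (fa_diff a b) = fa_diff (fa_mult c a) (fa_mult c b)"
  by (auto simp: fa_mult_def fa_diff_def fun_eq_iff left_diff_distrib right_diff_distrib sum_subtractf)

lemma fa_expand:
  assumes "finite {w. a w \<noteq> 0}"
  shows "(\<Sum>w | a w \<noteq> 0. a w * mon w y) = a y"
proof -
  have "(\<Sum>w | a w \<noteq> 0. a w * mon w y) = lin_ext a (\<lambda>z. if z = y then 1 else 0)"
    unfolding lin_ext_def mon_def by (rule sum.cong) auto
  then show ?thesis using lin_ext_at[OF assms] by simp
qed

lemma fa_mult_expand:
  assumes "finite {w. a w \<noteq> 0}"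
  shows "fa_mult u a = (\<lambda>z. \<Sum>w | a w \<noteq> 0. a w * fa_mult u (mon w) z)"
proof
  fix z
  have "fa_mult u a z = (\<Sum>i\<in>{0..length z}. u (take i z) * (\<Sum>w | a w \<noteq> 0. a w * mon w (drop i z)))"
    unfolding fa_mult_def fa_expand[OF assms] ..
  also have "\<dots> = (\<Sum>w | a w \<noteq> 0. a w * fa_mult u (mon w) z)"
    unfolding fa_mult_def sum_distrib_left by (subst sum.swap) (simp add: mult.left_commute)
  finally show "fa_mult u a z = (\<Sum>w | a w \<noteq> 0. a w * fa_mult u (mon w) z)" .
qed

lemma fa_mult_sum_left:
  "fa_mult (\<lambda>z. \<Sum>i\<in>S. x i z) b = (\<lambda>z. \<Sum>i\<in>S. fa_mult (x i) b z)"
  unfolding fa_mult_def sum_distrib_right by (subst sum.swap) simp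

section \<open>Congruence modulo the ideal and the relations in monomial form\<close>

context lpa
begin

definition eqv :: "('v,'e) fa \<Rightarrow> ('v,'e) fa \<Rightarrow> bool" (infix "\<approx>\<^sub>L" 50) where
  "a \<approx>\<^sub>L b \<longleftrightarrow> fa_diff a b \<in> I"

lemma I_zero: "(\<lambda>w. 0) \<in> I"
  by (rule LPA_ideal.zero)

lemma eqv_refl [simp]: "a \<approx>\<^sub>L a"
  using I_zero by (simp add: eqv_def fa_diff_def)

lemma eqv_sym: "a \<approx>\<^sub>L b \<Longrightarrow> b \<approx>\<^sub>L a"
  unfolding eqv_def using LPA_ideal.smult[of "fa_diff a b" R G "-1"]
  by (simp add: fa_diff_def fa_smult_def)

lemma eqv_trans [trans]: "a \<approx>\<^sub>L b \<Longrightarrow> b \<approx>\<^sub>L c \<Longrightarrow> a \<approx>\<^sub>L c"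
  unfolding eqv_def using LPA_ideal.add[of "fa_diff a b" R G "fa_diff b c"]
  by (simp add: fa_diff_def fa_add_def)

lemma eq_eqv_trans [trans]: "a = b \<Longrightarrow> b \<approx>\<^sub>L c \<Longrightarrow> a \<approx>\<^sub>L c"
  and eqv_eq_trans [trans]: "a \<approx>\<^sub>L b \<Longrightarrow> b = c \<Longrightarrow> a \<approx>\<^sub>L c"
  by simp_all

lemma eqv_zero: "a \<approx>\<^sub>L (\<lambda>w. 0) \<longleftrightarrow> a \<in> I"
  by (simp add: eqv_def fa_diff_def)

lemma eqv_ideal: "a \<approx>\<^sub>L b \<Longrightarrow> a \<in> I \<longleftrightarrow> b \<in> I"
  using eqv_trans eqv_sym eqv_zero by blast

lemma eqv_add: "a \<approx>\<^sub>L a' \<Longrightarrow> b \<approx>\<^sub>L b' \<Longrightarrow> fa_add a b \<approx>\<^sub>L fa_add a' b'"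
  unfolding eqv_def using LPA_ideal.add[of "fa_diff a a'" R G "fa_diff b b'"]
  by (simp add: fa_diff_def fa_add_def add_diff_add)

lemma eqv_smult: "a \<approx>\<^sub>L a' \<Longrightarrow> c \<in> R \<Longrightarrow> fa_smult c a \<approx>\<^sub>L fa_smult c a'"
  unfolding eqv_def using LPA_ideal.smult[of "fa_diff a a'" R G c]
  by (simp add: fa_diff_def fa_smult_def right_diff_distrib)

lemma eqv_mult_left: "a \<approx>\<^sub>L a' \<Longrightarrow> b \<in> LFA \<Longrightarrow> fa_mult b a \<approx>\<^sub>L fa_mult b a'"
  unfolding eqv_def fa_mult_diff_right[symmetric] by (rule LPA_ideal.mult_left)

lemma eqv_mult_right: "a \<approx>\<^sub>L a' \<Longrightarrow> b \<in> LFA \<Longrightarrow> fa_mult a b \<approx>\<^sub>L fa_mult a' b"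
  unfolding eqv_def fa_mult_diff_left[symmetric] by (rule LPA_ideal.mult_right)

lemma eqv_mult: "a \<approx>\<^sub>L a' \<Longrightarrow> b \<approx>\<^sub>L b' \<Longrightarrow> a' \<in> LFA \<Longrightarrow> b \<in> LFA \<Longrightarrow> fa_mult a b \<approx>\<^sub>L fa_mult a' b'"
  using eqv_mult_left eqv_mult_right eqv_trans by blast

lemma eqv_row:
  assumes "a \<approx>\<^sub>L b" "a \<in> LFA" "b \<in> LFA" "fst p \<in> X"
  shows "row a p q = row b p q"
  using ideal_row[of "fa_diff a b" p q] assms by (simp add: eqv_def row_diff)

lemma eqv_sum:
  assumes "\<And>i. i \<in> S \<Longrightarrow> x i \<approx>\<^sub>L y i" "\<And>i. i \<in> S \<Longrightarrow> c i \<in> R"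
  shows "(\<lambda>z. \<Sum>i\<in>S. c i * x i z) \<approx>\<^sub>L (\<lambda>z. \<Sum>i\<in>S. c i * y i z)"
  using assms
proof (induction S rule: infinite_finite_induct)
  case (insert j S)
  have "fa_add (fa_smult (c j) (x j)) (\<lambda>z. \<Sum>i\<in>S. c i * x i z) \<approx>\<^sub>L
        fa_add (fa_smult (c j) (y j)) (\<lambda>z. \<Sum>i\<in>S. c i * y i z)"
    by (intro eqv_add eqv_smult) (use insert in auto)
  then show ?case using insert by (simp add: fa_add_def fa_smult_def)
qed auto

lemma eqv_sum1:
  assumes "\<And>i. i \<in> S \<Longrightarrow> x i \<approx>\<^sub>L y i"
  shows "(\<lambda>z. \<Sum>i\<in>S. x i z) \<approx>\<^sub>L (\<lambda>z. \<Sum>i\<in>S. y i z)"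
  using eqv_sum[of S x y "\<lambda>_. 1"] assms by simp

lemma mon_ctx:
  assumes "mon a \<approx>\<^sub>L mon b" "gens u" "gens w"
  shows "mon (u @ a @ w) \<approx>\<^sub>L mon (u @ b @ w)"
proof -
  have 1: "mon (a @ w) \<approx>\<^sub>L mon (b @ w)"
  proof (cases "w = []")
    case False
    then show ?thesis using eqv_mult_right[OF assms(1) FA_mon[of w]] assms by (simp add: fa_mult_mon_mon)
  qed (use assms in auto)
  show ?thesis
  proof (cases "u = []")
    case False
    then show ?thesis using eqv_mult_left[OF 1 FA_mon[of u]] assms by (simp add: fa_mult_mon_mon)
  qed (use 1 in auto)
qed

lemma mon_ctx_I:
  assumes "mon a \<in> I" "gens u" "gens w"
  shows "mon (u @ a @ w) \<in> I"
proof -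
  have 1: "mon (a @ w) \<in> I"
  proof (cases "w = []")
    case False
    then show ?thesis using LPA_ideal.mult_right[OF assms(1) FA_mon[of w]] assms by (simp add: fa_mult_mon_mon)
  qed (use assms in auto)
  show ?thesis
  proof (cases "u = []")
    case False
    then show ?thesis using LPA_ideal.mult_left[OF 1 FA_mon[of u]] assms by (simp add: fa_mult_mon_mon)
  qed (use 1 in auto)
qed

lemma rel_vv: "v \<in> verts G \<Longrightarrow> mon [GV v, GV v] \<approx>\<^sub>L mon [GV v]"
  unfolding eqv_def by (rule LPA_ideal.rel, unfold LPA_rels_def, rule UnI1, rule UnI1, rule UnI1, rule UnI1, rule UnI1, rule UnI1, rule UnI1, rule UnI1, blast)

lemma rel_vw: "v \<in> verts G \<Longrightarrow> w \<in> verts G \<Longrightarrow> v \<noteq> w \<Longrightarrow> mon [GV v, GV w] \<in> I"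
  by (rule LPA_ideal.rel, unfold LPA_rels_def, rule UnI1, rule UnI1, rule UnI1, rule UnI1, rule UnI1, rule UnI1, rule UnI1, rule UnI2, blast)

lemma rel_ef: "e \<in> arcs G \<Longrightarrow> f \<in> arcs G \<Longrightarrow> e \<noteq> f \<Longrightarrow> mon [GS e, GE f] \<in> I"
  by (rule LPA_ideal.rel, unfold LPA_rels_def, rule UnI1, rule UnI1, rule UnI1, rule UnI1, rule UnI1, rule UnI1, rule UnI2, blast)

lemma rel_ee: "e \<in> arcs G \<Longrightarrow> mon [GS e, GE e] \<approx>\<^sub>L mon [GV (head G e)]"
  unfolding eqv_def by (rule LPA_ideal.rel, unfold LPA_rels_def, rule UnI1, rule UnI1, rule UnI1, rule UnI1, rule UnI1, rule UnI2, blast)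

lemma rel_te: "e \<in> arcs G \<Longrightarrow> mon [GV (tail G e), GE e] \<approx>\<^sub>L mon [GE e]"
  unfolding eqv_def by (rule LPA_ideal.rel, unfold LPA_rels_def, rule UnI1, rule UnI1, rule UnI1, rule UnI1, rule UnI2, blast)

lemma rel_eh: "e \<in> arcs G \<Longrightarrow> mon [GE e, GV (head G e)] \<approx>\<^sub>L mon [GE e]"
  unfolding eqv_def by (rule LPA_ideal.rel, unfold LPA_rels_def, rule UnI1, rule UnI1, rule UnI1, rule UnI2, blast)

lemma rel_st: "e \<in> arcs G \<Longrightarrow> mon [GS e, GV (tail G e)] \<approx>\<^sub>L mon [GS e]"
  unfolding eqv_def by (rule LPA_ideal.rel, unfold LPA_rels_def, rule UnI1, rule UnI1, rule UnI2, blast)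

lemma rel_hs: "e \<in> arcs G \<Longrightarrow> mon [GV (head G e), GS e] \<approx>\<^sub>L mon [GS e]"
  unfolding eqv_def by (rule LPA_ideal.rel, unfold LPA_rels_def, rule UnI1, rule UnI2, blast)

lemma rel_ck: "v \<in> verts G \<Longrightarrow> mon [GV v] \<approx>\<^sub>L (\<lambda>w. \<Sum>e\<in>out_arcs G v. mon [GE e, GS e] w)"
  unfolding eqv_def using no_sinks[of v] finite_out_arcs[of v]
  by (intro LPA_ideal.rel, unfold LPA_rels_def, intro UnI2) blast

section \<open>Reduction of words standing behind a starred path\<close>

definition pth :: "'e list \<Rightarrow> bool" where
  "pth \<alpha> \<longleftrightarrow> set \<alpha> \<subseteq> arcs G \<and> successively (\<lambda>e f. head G e = tail G f) \<alpha>"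

abbreviation ge :: "'e list \<Rightarrow> ('v,'e) gen list" where "ge \<alpha> \<equiv> map GE \<alpha>"
abbreviation gs :: "'e list \<Rightarrow> ('v,'e) gen list" where "gs \<alpha> \<equiv> rev (map GS \<alpha>)"

lemma pth_Cons: "pth (e # \<alpha>) \<longleftrightarrow> e \<in> arcs G \<and> pth \<alpha> \<and> (\<alpha> = [] \<or> head G e = tail G (hd \<alpha>))"
  by (auto simp: pth_def successively_Cons)

lemma pth_append: "pth (\<alpha> @ \<beta>) \<longleftrightarrow> pth \<alpha> \<and> pth \<beta> \<and> (\<alpha> = [] \<or> \<beta> = [] \<or> head G (last \<alpha>) = tail G (hd \<beta>))"
  by (auto simp: pth_def successively_append_iff)

lemma pth_Nil [simp]: "pth []"
  by (simp add: pth_def)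

lemma gens_pth: "pth \<alpha> \<Longrightarrow> gens (ge \<alpha>)" "pth \<alpha> \<Longrightarrow> gens (gs \<alpha>)"
  by (auto simp: pth_def)

text \<open>For a path \<open>\<alpha>\<close> of at least two edges,
  \<open>gs \<alpha> @ [g]\<close> is congruent to \<open>gs \<beta>\<close> if the result is
  \<open>Some \<beta>\<close>, and to zero if it is \<open>None\<close>. Since \<open>gs\<close>
  reverses, \<open>g\<close> meets the star of the first edge.\<close>

primrec red1 :: "('v,'e) gen \<Rightarrow> 'e list \<Rightarrow> 'e list option" where
  "red1 (GV v) \<alpha> = (if tail G (hd \<alpha>) = v then Some \<alpha> else None)"
| "red1 (GE e) \<alpha> = (if hd \<alpha> = e then Some (tl \<alpha>) else None)"
| "red1 (GS e) \<alpha> = (if head G e = tail G (hd \<alpha>) then Some (e # \<alpha>) else None)"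

primrec red :: "('v,'e) gen list \<Rightarrow> 'e list \<Rightarrow> 'e list option" where
  "red [] \<alpha> = Some \<alpha>"
| "red (g # w) \<alpha> = Option.bind (red1 g \<alpha>) (red w)"

text \<open>Two edges are required because cancelling \<open>GS e\<close> against
  \<open>GE e\<close> leaves the vertex \<open>head G e\<close>, which must be absorbed by a further
  starred edge on its left. A letter shortens the path by at most one, which tells how long a path
  must be for a whole word.\<close>

lemma red1_Some:
  assumes "pth \<alpha>" "length \<alpha> \<ge> 2" "gen_in G g" "red1 g \<alpha> = Some \<beta>"
  shows "pth \<beta>" "length \<beta> + 1 \<ge> length \<alpha>" "mon (gs \<alpha> @ [g]) \<approx>\<^sub>L mon (gs \<beta>)"
proof -
  obtain e f \<alpha>' where \<alpha>: "\<alpha> = e # f # \<alpha>'"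
    using assms(2) by (cases \<alpha>; cases "tl \<alpha>") auto
  have e: "e \<in> arcs G" "f \<in> arcs G" "head G e = tail G f" "pth (f # \<alpha>')" "pth \<alpha>'"
    using assms(1) by (auto simp: \<alpha> pth_Cons)
  note g = gens_pth[OF e(4)] gens_pth[OF e(5)]
  have "pth \<beta> \<and> length \<beta> + 1 \<ge> length \<alpha> \<and> mon (gs \<alpha> @ [g]) \<approx>\<^sub>L mon (gs \<beta>)"
  proof (cases g)
    case (GV v)
    then have "\<beta> = \<alpha>" "v = tail G e" using assms(4) \<alpha> by (auto split: if_splits)
    moreover have "mon (gs (f # \<alpha>') @ [GS e, GV (tail G e)] @ []) \<approx>\<^sub>L mon (gs (f # \<alpha>') @ [GS e] @ [])"
      by (rule mon_ctx[OF rel_st]) (use e g in auto)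
    ultimately show ?thesis using GV assms(1) by (simp add: \<alpha>)
  next
    case (GE e')
    then have *: "\<beta> = f # \<alpha>'" "e' = e" using assms(4) \<alpha> by (auto split: if_splits)
    have "mon (gs (f # \<alpha>') @ [GS e, GE e] @ []) \<approx>\<^sub>L mon (gs (f # \<alpha>') @ [GV (head G e)] @ [])"
      by (rule mon_ctx[OF rel_ee]) (use e g in auto)
    also have "gs (f # \<alpha>') @ [GV (head G e)] @ [] = gs \<alpha>' @ [GS f, GV (tail G f)] @ []"
      using e by simp
    also have "mon (gs \<alpha>' @ [GS f, GV (tail G f)] @ []) \<approx>\<^sub>L mon (gs \<alpha>' @ [GS f] @ [])"
      by (rule mon_ctx[OF rel_st]) (use e g in auto)
    finally show ?thesis using e GE * by (simp add: \<alpha>)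
  next
    case (GS e')
    then have "\<beta> = e' # \<alpha>" "head G e' = tail G e" "e' \<in> arcs G" using assms(3,4) \<alpha> by (auto split: if_splits)
    then show ?thesis using GS assms(1) \<alpha> by (simp add: pth_Cons)
  qed
  then show "pth \<beta>" "length \<beta> + 1 \<ge> length \<alpha>" "mon (gs \<alpha> @ [g]) \<approx>\<^sub>L mon (gs \<beta>)" by auto
qed

lemma red1_None:
  assumes "pth \<alpha>" "length \<alpha> \<ge> 2" "gen_in G g" "red1 g \<alpha> = None"
  shows "mon (gs \<alpha> @ [g]) \<in> I"
proof -
  obtain e \<alpha>' where \<alpha>: "\<alpha> = e # \<alpha>'"
    using assms(2) by (cases \<alpha>) auto
  have e: "e \<in> arcs G" "pth \<alpha>'"
    using assms(1) by (auto simp: \<alpha> pth_Cons)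
  note g = gens_pth[OF e(2)]
  \<comment> \<open>Inserting the source vertex after \<open>GS e\<close> turns a mismatch of
    endpoints into a product of two distinct vertices.\<close>
  have st: "mon ([GS e] @ [g]) \<approx>\<^sub>L mon ([GS e, GV (tail G e)] @ [g])"
    using mon_ctx[OF eqv_sym[OF rel_st[OF e(1)]], of "[]" "[g]"] assms(3) by simp
  have "mon [GS e, g] \<in> I"
  proof (cases g)
    case (GV v)
    then have "v \<noteq> tail G e" "v \<in> verts G" using assms \<alpha> by auto
    then have "mon ([GS e] @ [GV (tail G e), GV v] @ []) \<in> I"
      using e by (intro mon_ctx_I[OF rel_vw]) auto
    then show ?thesis using eqv_ideal[OF st] GV by simp
  next
    case (GE e')
    then have "e' \<noteq> e" "e' \<in> arcs G" using assms \<alpha> by auto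
    then show ?thesis using GE rel_ef e by simp
  next
    case (GS e')
    then have "head G e' \<noteq> tail G e" and e': "e' \<in> arcs G" using assms \<alpha> by auto
    then have 0: "mon ([GS e] @ [GV (tail G e), GV (head G e')] @ [GS e']) \<in> I"
      using e by (intro mon_ctx_I[OF rel_vw]) auto
    have "mon ([GS e, GV (tail G e)] @ [GV (head G e'), GS e'] @ []) \<approx>\<^sub>L mon ([GS e, GV (tail G e)] @ [GS e'] @ [])"
      by (rule mon_ctx[OF rel_hs]) (use e e' in auto)
    then have "mon ([GS e, GV (tail G e)] @ [GS e']) \<in> I"
      using eqv_ideal 0 by simp
    then show ?thesis using eqv_ideal[OF st] GS by simp
  qed
  then have "mon (gs \<alpha>' @ [GS e, g] @ []) \<in> I"
    by (rule mon_ctx_I) (use g in auto)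
  then show ?thesis by (simp add: \<alpha>)
qed

lemma red_Some:
  assumes "pth \<alpha>" "length w < length \<alpha>" "gens w" "red w \<alpha> = Some \<beta>"
  shows "pth \<beta>" "\<beta> \<noteq> []" "mon (gs \<alpha> @ w) \<approx>\<^sub>L mon (gs \<beta>)"
proof -
  have "pth \<beta> \<and> \<beta> \<noteq> [] \<and> mon (gs \<alpha> @ w) \<approx>\<^sub>L mon (gs \<beta>)"
    using assms
  proof (induction w arbitrary: \<alpha>)
    case (Cons g w)
    then obtain \<gamma> where \<gamma>: "red1 g \<alpha> = Some \<gamma>" "red w \<gamma> = Some \<beta>"
      by (auto simp: bind_eq_Some_conv)
    have *: "pth \<gamma>" "length \<gamma> + 1 \<ge> length \<alpha>" "mon (gs \<alpha> @ [g]) \<approx>\<^sub>L mon (gs \<gamma>)"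
      by (rule red1_Some[OF _ _ _ \<gamma>(1)]; use Cons in auto)+
    have IH: "pth \<beta> \<and> \<beta> \<noteq> [] \<and> mon (gs \<gamma> @ w) \<approx>\<^sub>L mon (gs \<beta>)"
      by (rule Cons.IH) (use Cons.prems \<gamma> * in auto)
    have "mon ([] @ (gs \<alpha> @ [g]) @ w) \<approx>\<^sub>L mon ([] @ gs \<gamma> @ w)"
      by (rule mon_ctx) (use * Cons.prems in auto)
    then show ?case using IH eqv_trans by auto
  qed auto
  then show "pth \<beta>" "\<beta> \<noteq> []" "mon (gs \<alpha> @ w) \<approx>\<^sub>L mon (gs \<beta>)" by auto
qed

lemma red_None:
  assumes "pth \<alpha>" "length w < length \<alpha>" "gens w" "red w \<alpha> = None"
  shows "mon (gs \<alpha> @ w) \<in> I"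
  using assms
proof (induction w arbitrary: \<alpha>)
  case (Cons g w)
  show ?case
  proof (cases "red1 g \<alpha>")
    case None
    then have "mon (gs \<alpha> @ [g]) \<in> I"
      by (intro red1_None) (use Cons.prems in auto)
    then have "mon ([] @ (gs \<alpha> @ [g]) @ w) \<in> I"
      by (rule mon_ctx_I) (use Cons.prems in auto)
    then show ?thesis by simp
  next
    case (Some \<gamma>)
    have *: "pth \<gamma>" "length \<gamma> + 1 \<ge> length \<alpha>" "mon (gs \<alpha> @ [g]) \<approx>\<^sub>L mon (gs \<gamma>)"
      by (rule red1_Some[OF _ _ _ Some]; use Cons in auto)+
    have IH: "mon (gs \<gamma> @ w) \<in> I"
      by (rule Cons.IH) (use Cons.prems Some * in auto)
    have "mon ([] @ (gs \<alpha> @ [g]) @ w) \<approx>\<^sub>L mon ([] @ gs \<gamma> @ w)"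
      by (rule mon_ctx) (use * Cons.prems in auto)
    then show ?thesis using IH eqv_ideal by auto
  qed
qed auto

lemma ract1_conc:
  assumes "\<alpha> \<noteq> []"
  shows "ract1 g (\<alpha> \<frown> z, k) = map_option (\<lambda>\<beta>. (\<beta> \<frown> z, k + int (length \<beta>) - int (length \<alpha>))) (red1 g \<alpha>)"
proof -
  obtain e \<alpha>' where \<alpha>: "\<alpha> = e # \<alpha>'"
    using assms by (cases \<alpha>) auto
  show ?thesis by (cases g) (auto simp: \<alpha>)
qed

text \<open>A word shorter than \<open>\<alpha>\<close> never looks at \<open>z\<close>. Hence
  reduction in the algebra and action on paths are the same computation, which is the source of
  faithfulness.\<close>

lemma ract_conc:
  assumes "length w < length \<alpha>"
  shows "ract w (\<alpha> \<frown> z, k) = map_option (\<lambda>\<beta>. (\<beta> \<frown> z, k + int (length \<beta>) - int (length \<alpha>))) (red w \<alpha>)"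
  using assms
proof (induction w arbitrary: \<alpha> k)
  case (Cons g w)
  show ?case
  proof (cases "red1 g \<alpha>")
    case None
    have "\<alpha> \<noteq> []" using Cons.prems by auto
    then show ?thesis using None by (simp add: ract1_conc)
  next
    case (Some \<gamma>)
    have "\<alpha> \<noteq> []" using Cons.prems by auto
    then have "length w < length \<gamma>" using Some Cons.prems by (cases g) (auto split: if_splits)
    then show ?thesis using \<open>\<alpha> \<noteq> []\<close> Some Cons.IH[of \<gamma> "k + int (length \<gamma>) - int (length \<alpha>)"]
      by (simp add: ract1_conc add_diff_eq)
  qed
qed auto

text \<open>If \<open>\<alpha>\<close> is long enough, this is the coefficient of
  \<open>gs \<beta>\<close> in the reduction of \<open>gs \<alpha>\<close> times \<open>a\<close>;
  no continuation of the path enters.\<close>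

definition germ_coeff :: "('v,'e) fa \<Rightarrow> 'e list \<Rightarrow> 'e list \<Rightarrow> complex" where
  "germ_coeff a \<alpha> \<beta> = lin_ext a (\<lambda>w. if red w \<alpha> = Some \<beta> then 1 else 0)"

text \<open>\<open>insert 0\<close> keeps the maximum defined when the support is empty, and
  \<open>Suc\<close> makes every word strictly shorter, as \<open>ract_conc\<close> demands.\<close>

definition word_bound :: "('v,'e) fa \<Rightarrow> nat" where
  "word_bound a = Suc (Max (insert 0 (length ` {w. a w \<noteq> 0})))"

lemma word_bound: assumes "a \<in> LFA" "a w \<noteq> 0" shows "length w < word_bound a"
proof -
  have "length w \<le> Max (insert 0 (length ` {w. a w \<noteq> 0}))"
    by (rule Max_ge) (use FA_fin[OF assms(1)] assms(2) in auto)
  then show ?thesis by (simp add: word_bound_def)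
qed

lemma word_bound_pos [simp]: "word_bound a > 0"
  by (simp add: word_bound_def)

text \<open>The degree recovers the length of \<open>\<beta>\<close>, and then the path recovers
  \<open>\<beta>\<close> itself; so different \<open>\<beta>\<close> give different points even if
  \<open>z\<close> is periodic. Since \<open>z\<close> does not occur on the right, rows are locally
  constant.\<close>

lemma row_germ_coeff:
  assumes "a \<in> LFA" "word_bound a \<le> length \<alpha>"
  shows "row a (\<alpha> \<frown> z, k) (\<beta> \<frown> z, k + int (length \<beta>) - int (length \<alpha>)) = germ_coeff a \<alpha> \<beta>"
  unfolding row_def germ_coeff_def
proof (rule lin_ext_cong)
  fix w assume "a w \<noteq> 0"
  then have "length w < length \<alpha>" using word_bound[OF assms(1), of w] assms(2) by simp
  then show "(if ract w (\<alpha> \<frown> z, k) = Some (\<beta> \<frown> z, k + int (length \<beta>) - int (length \<alpha>)) then 1 else 0)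
      = (if red w \<alpha> = Some \<beta> then 1 else (0::complex))"
    by (cases "red w \<alpha>") (auto simp: ract_conc)
qed

lemma row_germ_coeff_supp:
  assumes "a \<in> LFA" "word_bound a \<le> length \<alpha>" "row a (\<alpha> \<frown> z, k) q \<noteq> 0"
  obtains \<beta> where "q = (\<beta> \<frown> z, k + int (length \<beta>) - int (length \<alpha>))" "germ_coeff a \<alpha> \<beta> \<noteq> 0"
proof -
  obtain w where w: "a w \<noteq> 0" "ract w (\<alpha> \<frown> z, k) = Some q"
    using row_neq_zero[OF assms(3)] by blast
  then have "length w < length \<alpha>" using word_bound[OF assms(1), of w] assms(2) by simp
  then obtain \<beta> where \<beta>: "q = (\<beta> \<frown> z, k + int (length \<beta>) - int (length \<alpha>))"
    using w(2) by (auto simp: ract_conc)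
  moreover have "germ_coeff a \<alpha> \<beta> \<noteq> 0" using assms(3) row_germ_coeff[OF assms(1,2)] \<beta> by simp
  ultimately show thesis by (rule that)
qed

definition proj_word :: "'e list \<Rightarrow> ('v,'e) gen list" where
  "proj_word \<alpha> = ge \<alpha> @ gs \<alpha>"

lemma gens_proj_word: "pth \<alpha> \<Longrightarrow> gens (proj_word \<alpha>)"
  by (auto simp: proj_word_def pth_def)

lemma FA_proj_word: "pth \<alpha> \<Longrightarrow> \<alpha> \<noteq> [] \<Longrightarrow> mon (proj_word \<alpha>) \<in> LFA"
  using gens_proj_word by (intro FA_mon) (auto simp: proj_word_def)

text \<open>If \<open>\<alpha>\<close> is longer than \<open>w\<close>, then \<open>\<alpha>* w\<close> is zero or some \<open>\<beta>*\<close>; hence \<open>\<alpha>\<alpha>* a\<close> is determined by the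
  rows of \<open>a\<close> at paths starting with \<open>\<alpha>\<close>.\<close>
lemma germ_ideal:
  assumes a: "a \<in> LFA" and \<alpha>: "pth \<alpha>" "word_bound a \<le> length \<alpha>" and germ_coeff: "\<And>\<beta>. germ_coeff a \<alpha> \<beta> = 0"
  shows "fa_mult (mon (proj_word \<alpha>)) a \<in> I"
proof -
  define m where "m w = (case red w \<alpha> of None \<Rightarrow> \<lambda>_. 0 | Some \<beta> \<Rightarrow> mon (ge \<alpha> @ gs \<beta>))" for w
  have len: "length w < length \<alpha>" if "a w \<noteq> 0" for w
    using word_bound[OF a that] \<alpha>(2) by simp
  have *: "mon (proj_word \<alpha> @ w) \<approx>\<^sub>L m w" if w: "a w \<noteq> 0" for w
  proof (cases "red w \<alpha>")
    case None
    have "mon (ge \<alpha> @ (gs \<alpha> @ w) @ []) \<in> I"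
      by (rule mon_ctx_I[OF red_None]) (use FA_gens[OF a w] None len[OF w] \<alpha> gens_pth in auto)
    then show ?thesis using None by (simp add: m_def eqv_zero proj_word_def)
  next
    case (Some \<beta>)
    have "mon (ge \<alpha> @ (gs \<alpha> @ w) @ []) \<approx>\<^sub>L mon (ge \<alpha> @ gs \<beta> @ [])"
      by (rule mon_ctx[OF red_Some(3)]) (use FA_gens[OF a w] Some len[OF w] \<alpha> gens_pth in auto)
    then show ?thesis using Some by (simp add: m_def proj_word_def)
  qed
  have "fa_mult (mon (proj_word \<alpha>)) a = (\<lambda>z. \<Sum>w | a w \<noteq> 0. a w * mon (proj_word \<alpha> @ w) z)"
    by (subst fa_mult_expand) (simp_all add: FA_fin[OF a] fa_mult_mon_mon)
  also have "\<dots> \<approx>\<^sub>L (\<lambda>z. \<Sum>w | a w \<noteq> 0. a w * m w z)"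
    by (rule eqv_sum) (use * FA_R[OF a] in auto)
  \<comment> \<open>Words with the same reduction \<open>\<beta>\<close> contribute to the same
    monomial, and their coefficients add up to \<open>germ_coeff a \<alpha> \<beta>\<close>.\<close>
  also have "(\<lambda>z. \<Sum>w | a w \<noteq> 0. a w * m w z) = (\<lambda>z. 0)"
  proof
    fix z
    have "(\<Sum>w | a w \<noteq> 0. a w * m w z) = lin_ext a (\<lambda>w. m w z)" by (simp add: lin_ext_def)
    also have "\<dots> = 0"
    proof (cases "\<exists>\<beta>. z = ge \<alpha> @ gs \<beta>")
      case True
      then obtain \<beta> where z: "z = ge \<alpha> @ gs \<beta>" by blast
      have inj: "map GS \<beta> = map GS \<beta>' \<longleftrightarrow> \<beta> = \<beta>'" for \<beta>' :: "'e list"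
        by (rule inj_map_eq_map) (auto intro: injI)
      have "lin_ext a (\<lambda>w. m w z) = germ_coeff a \<alpha> \<beta>"
        unfolding germ_coeff_def
        by (rule lin_ext_cong) (auto simp: m_def z mon_def inj split: option.splits)
      then show ?thesis using germ_coeff by simp
    next
      case False
      have "lin_ext a (\<lambda>w. m w z) = lin_ext a (\<lambda>w. 0)"
        by (rule lin_ext_cong) (use False in \<open>auto simp: m_def mon_def split: option.splits\<close>)
      then show ?thesis by (simp add: lin_ext_def)
    qed
    finally show "(\<Sum>w | a w \<noteq> 0. a w * m w z) = 0" .
  qed
  finally show ?thesis by (simp add: eqv_zero)
qed

lemma X_prefix: "x \<in> X \<Longrightarrow> pth (prefix n x)"
proof (induction n)
  case (Suc n)
  have "prefix (Suc n) x = prefix n x @ [x n]" by simp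
  moreover have "prefix n x = [] \<or> head G (last (prefix n x)) = tail G (x n)"
    using Suc.prems by (cases n) (auto simp: X_def)
  ultimately show ?case using Suc by (auto simp: pth_append pth_Cons X_def)
qed simp

text \<open>One vanishing row at \<open>x\<close> makes all germ coefficients of the prefix vanish,
  hence kills \<open>a\<close> on a whole cylinder around \<open>x\<close>. This is the local
  argument behind all later transfers between the two algebras.\<close>

lemma germ:
  assumes "x \<in> X" "a \<in> LFA" "word_bound a \<le> n" "\<And>q. row a (x, 0) q = 0"
  shows "fa_mult (mon (proj_word (prefix n x))) a \<in> I"
proof (rule germ_ideal)
  show "germ_coeff a (prefix n x) \<beta> = 0" for \<beta>
    using row_germ_coeff[OF assms(2), of "prefix n x" "suffix n x" 0 \<beta>] assms(3,4) by simp
qed (use assms X_prefix in auto)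

lemma X_conc: "pth \<alpha> \<Longrightarrow> z \<in> X \<Longrightarrow> \<alpha> = [] \<or> head G (last \<alpha>) = tail G (z 0) \<Longrightarrow> \<alpha> \<frown> z \<in> X"
proof (induction \<alpha>)
  case (Cons e \<alpha>)
  then have "\<alpha> \<frown> z \<in> X" by (auto simp: pth_Cons split: if_splits)
  moreover have "head G e = tail G ((\<alpha> \<frown> z) 0)"
    using Cons.prems by (cases \<alpha>) (auto simp: pth_Cons)
  ultimately show ?case using Cons.prems by (simp add: X_build pth_Cons)
qed simp

section \<open>Continuations of finite paths, condition (L) and diagonal elements\<close>

lemma path_from: assumes "v \<in> verts G" shows "\<exists>z\<in>X. tail G (z 0) = v"
proof -
  define out where "out v = (SOME e. e \<in> arcs G \<and> tail G e = v)" for v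
  have out: "out v \<in> arcs G" "tail G (out v) = v" if "v \<in> verts G" for v
    using no_sinks[OF that] someI_ex[of "\<lambda>e. e \<in> arcs G \<and> tail G e = v"]
    by (auto simp: out_def out_arcs_def)
  define z where "z = rec_nat (out v) (\<lambda>_ e. out (head G e))"
  have z: "z 0 = out v" "z (Suc n) = out (head G (z n))" for n
    by (simp_all add: z_def)
  have arc: "z n \<in> arcs G" for n
    by (induction n) (use out assms in \<open>auto simp: z\<close>)
  then have "z \<in> X" using out by (auto simp: X_def z)
  moreover have "tail G (z 0) = v" using out(2)[OF assms] z(1) by simp
  ultimately show ?thesis by blast
qed

lemma head_last_verts: "pth \<alpha> \<Longrightarrow> \<alpha> \<noteq> [] \<Longrightarrow> head G (last \<alpha>) \<in> verts G"
  by (meson head_in_verts last_in_set pth_def subsetD)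

lemma path_extend: assumes "pth \<alpha>" "\<alpha> \<noteq> []" shows "\<exists>z. \<alpha> \<frown> z \<in> X"
proof -
  have "head G (last \<alpha>) \<in> verts G" using assms by (intro head_last_verts)
  then show ?thesis using path_from X_conc assms by metis
qed

text \<open>If \<open>z\<close> were the only path from \<open>v\<close>, no vertex on it would have
  a second outgoing edge. By finiteness \<open>z\<close> revisits a vertex, and the part up to the
  first revisit is a cycle without exit.\<close>

lemma two_paths:
  assumes v: "v \<in> verts G"
  shows "\<exists>z\<in>X. \<exists>z'\<in>X. z \<noteq> z' \<and> tail G (z 0) = v \<and> tail G (z' 0) = v"
proof (rule ccontr)
  assume "\<not> ?thesis"
  then have uniq: "z = z'" if "z \<in> X" "z' \<in> X" "tail G (z 0) = v" "tail G (z' 0) = v" for z z'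
    using that by blast
  obtain z where z: "z \<in> X" "tail G (z 0) = v" using path_from[OF v] by blast
  have only: "e = z n" if e: "e \<in> arcs G" "tail G e = tail G (z n)" for e n
  proof -
    have "pth (prefix n z @ [e])"
      using X_prefix[OF z(1), of "Suc n"] e by (auto simp: pth_append pth_Cons)
    then obtain y where y: "(prefix n z @ [e]) \<frown> y \<in> X" using path_extend by blast
    have "tail G (((prefix n z @ [e]) \<frown> y) 0) = v"
      using e z(2) by (cases n) (simp_all add: nth_append del: build_append subseq_to_Suc)
    then have "(prefix n z @ [e]) \<frown> y = z" using uniq y z by blast
    then have "((prefix n z @ [e]) \<frown> y) n = z n" by simp
    then show ?thesis by (simp add: nth_append)
  qed
  have "\<not> inj (\<lambda>n. tail G (z n))"
  proof
    assume "inj (\<lambda>n. tail G (z n))"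
    moreover have "range (\<lambda>n. tail G (z n)) \<subseteq> verts G" using z by (auto simp: X_def)
    ultimately show False using finite_verts finite_subset range_inj_infinite by blast
  qed
  then obtain a b where ab: "a \<noteq> b" "tail G (z a) = tail G (z b)"
    unfolding inj_def by blast
  define Q where "Q j \<longleftrightarrow> (\<exists>i<j. tail G (z i) = tail G (z j))" for j
  have "Q a \<or> Q b"
    using ab unfolding Q_def by (cases "a < b") (auto, metis linorder_neqE_nat)
  then have ex: "\<exists>j. Q j" by blast
  \<comment> \<open>\<open>j\<close> is the first time at which a vertex is repeated. Minimality
    makes the vertices before it distinct, as \<open>cycle\<close> demands.\<close>
  define j where "j = (LEAST j. Q j)"
  have "Q j" unfolding j_def by (rule LeastI_ex[OF ex])
  then obtain i where i: "i < j" "tail G (z i) = tail G (z j)" unfolding Q_def by blast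
  have min: "\<not> Q k" if "k < j" for k
    using not_less_Least that unfolding j_def by blast
  define p where "p = map z [i..<j]"
  have inj: "inj_on (\<lambda>n. tail G (z n)) {..<j}"
  proof (rule inj_onI)
    fix k l assume kl: "k \<in> {..<j}" "l \<in> {..<j}" "tail G (z k) = tail G (z l)"
    have "\<not> k < l" using kl min[of l] unfolding Q_def by auto
    moreover have "\<not> l < k" using kl min[of k] unfolding Q_def by auto
    ultimately show "k = l" by simp
  qed
  have aw: "awalk (tail G (z i)) (map z [i..<i + k]) (tail G (z (i + k)))" for k
    using awalk_prefix[OF X_suffix[OF z(1)], of i k] by (simp add: subsequence_def[of z])
  have "awalk (tail G (z i)) p (tail G (z i))"
    using aw[of "j - i"] i by (simp add: p_def)
  moreover have "distinct (tl (awalk_verts (tail G (z i)) p))"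
  proof -
    have av: "awalk_verts u (map z [i..<i + k]) = (if k = 0 then [u] else map (\<lambda>n. tail G (z n)) [i..<Suc (i + k)])" for u k
    proof (induction k arbitrary: u)
      case (Suc k)
      have "head G (z (i + k)) = tail G (z (Suc (i + k)))" using z by (auto simp: X_def)
      then show ?case using Suc by (auto simp: awalk_verts_conv)
    qed simp
    have "awalk_verts (tail G (z i)) p = map (\<lambda>n. tail G (z n)) [i..<Suc j]"
      using av[of _ "j - i"] i by (simp add: p_def)
    then have "tl (awalk_verts (tail G (z i)) p) = map (\<lambda>n. tail G (z n)) ([Suc i..<j] @ [j])"
    proof -
      have "[i..<Suc j] = i # ([Suc i..<j] @ [j])" using i by (simp add: upt_conv_Cons)
      then show ?thesis using \<open>awalk_verts (tail G (z i)) p = _\<close> by simp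
    qed
    moreover have "tail G (z j) \<notin> (\<lambda>n. tail G (z n)) ` {Suc i..<j}"
    proof
      assume "tail G (z j) \<in> (\<lambda>n. tail G (z n)) ` {Suc i..<j}"
      then obtain n where "Suc i \<le> n" "n < j" "tail G (z n) = tail G (z i)" using i by auto
      then show False using inj_onD[OF inj, of n i] by auto
    qed
    moreover have "distinct (map (\<lambda>n. tail G (z n)) [Suc i..<j])"
      by (auto simp: distinct_map intro: inj_on_subset[OF inj])
    ultimately show ?thesis by simp
  qed
  moreover have "p \<noteq> []" using i by (simp add: p_def)
  ultimately have "cycle p" unfolding cycle_def by blast
  then obtain e f where "e \<in> set p" "f \<in> arcs G" "tail G f = tail G e" "f \<noteq> e"
    using cond_L unfolding condition_L_def by blast
  then show False using only by (auto simp: p_def)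
qed

lemma two_extensions:
  assumes "pth \<alpha>" "\<alpha> \<noteq> []"
  obtains z z' where "z \<noteq> z'" "\<alpha> \<frown> z \<in> X" "\<alpha> \<frown> z' \<in> X"
proof -
  have "head G (last \<alpha>) \<in> verts G" using assms by (intro head_last_verts)
  then show ?thesis using two_paths X_conc assms that by metis
qed

text \<open>Degree 0 is part of the requirement, because a periodic path also returns to itself with
  nonzero lag.\<close>

definition is_diag :: "('v,'e) fa \<Rightarrow> bool" where
  "is_diag a \<longleftrightarrow> (\<forall>x\<in>X. \<forall>q. row a (x, 0) q \<noteq> 0 \<longrightarrow> q = (x, 0))"

definition dval :: "('v,'e) fa \<Rightarrow> (nat \<Rightarrow> 'e) \<Rightarrow> complex" where
  "dval a x = row a (x, 0) (x, 0)"

text \<open>A lag \<open>l \<noteq> 0\<close> in the support would force all continuations of a fixed path to be the same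
  periodic path, which condition (L) excludes.\<close>
lemma is_diagI:
  assumes a: "a \<in> LFA" and supp: "\<And>x q. x \<in> X \<Longrightarrow> row a (x, 0) q \<noteq> 0 \<Longrightarrow> fst q = x"
  shows "is_diag a"
  unfolding is_diag_def
proof (intro ballI allI impI)
  fix x q assume x: "x \<in> X" and q: "row a (x, 0) q \<noteq> 0"
  define \<alpha> where "\<alpha> = prefix (word_bound a) x"
  have \<alpha>: "pth \<alpha>" "\<alpha> \<noteq> []" "length \<alpha> = word_bound a" "x = \<alpha> \<frown> suffix (word_bound a) x"
    using X_prefix[OF x] word_bound_pos[of a] by (auto simp: \<alpha>_def)
  have wl: "word_bound a \<le> length \<alpha>" by (simp add: \<alpha>(3))
  obtain \<beta> where \<beta>: "q = (\<beta> \<frown> suffix (word_bound a) x, int (length \<beta>) - int (length \<alpha>))" "germ_coeff a \<alpha> \<beta> \<noteq> 0"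
    using row_germ_coeff_supp[OF a wl, of "suffix (word_bound a) x" 0 q] q \<alpha>(4) by auto
  have eq: "\<beta> \<frown> z = \<alpha> \<frown> z" if "\<alpha> \<frown> z \<in> X" for z
  proof -
    have "row a (\<alpha> \<frown> z, 0) (\<beta> \<frown> z, 0 + int (length \<beta>) - int (length \<alpha>)) \<noteq> 0"
      using row_germ_coeff[OF a wl, of z 0 \<beta>] \<beta>(2) by simp
    from supp[OF that this] show ?thesis by simp
  qed
  obtain z z' where z: "z \<noteq> z'" "\<alpha> \<frown> z \<in> X" "\<alpha> \<frown> z' \<in> X"
    using two_extensions[OF \<alpha>(1,2)] by blast
  have "length \<beta> = length \<alpha>"
  proof (rule ccontr)
    assume ne: "length \<beta> \<noteq> length \<alpha>"
    \<comment> \<open>Cancelling the shorter of \<open>\<alpha>\<close> and \<open>\<beta>\<close>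
      leaves a nonempty \<open>\<gamma>\<close> that fixes every continuation \<open>z\<close>, and
      only one sequence is fixed by \<open>\<gamma>\<close>.\<close>
    have "\<exists>\<gamma>. \<gamma> \<noteq> [] \<and> (\<forall>z. \<beta> \<frown> z = \<alpha> \<frown> z \<longrightarrow> \<gamma> \<frown> z = z)"
    proof (cases "length \<beta> < length \<alpha>")
      case True
      have "drop (length \<beta>) \<alpha> \<frown> z = z" if "\<beta> \<frown> z = \<alpha> \<frown> z" for z
        using arg_cong[OF that, of "suffix (length \<beta>)"] True by simp
      then show ?thesis using True by (intro exI[of _ "drop (length \<beta>) \<alpha>"]) auto
    next
      case False
      have "drop (length \<alpha>) \<beta> \<frown> z = z" if "\<beta> \<frown> z = \<alpha> \<frown> z" for z
        using arg_cong[OF that, of "suffix (length \<alpha>)"] False by simp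
      then show ?thesis using False ne by (intro exI[of _ "drop (length \<alpha>) \<beta>"]) auto
    qed
    then show False using conc_fixpoint_unique eq z by metis
  qed
  then show "q = (x, 0)" using \<beta>(1) supp[OF x q] by simp
qed

section \<open>Sums of cylinder projections as left units, and faithfulness\<close>

definition paths :: "nat \<Rightarrow> 'e list set" where
  "paths n = {\<alpha>. pth \<alpha> \<and> length \<alpha> = n}"

lemma finite_paths [simp]: "finite (paths n)"
proof (rule finite_subset)
  show "paths n \<subseteq> {\<alpha>. set \<alpha> \<subseteq> arcs G \<and> length \<alpha> = n}" by (auto simp: paths_def pth_def)
qed (simp add: finite_lists_length_eq)

text \<open>Elements of \<open>LFA\<close> have no constant term, so the unit of the algebra is
  written as a sum of projections. For \<open>n = 0\<close> the sum would be the empty word, which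
  lies outside \<open>LFA\<close>.\<close>

definition cyl_sum :: "nat \<Rightarrow> ('v,'e) fa" where
  "cyl_sum n = (\<lambda>z. \<Sum>\<alpha>\<in>paths n. mon (proj_word \<alpha>) z)"

lemma FA_cyl_sum: "n > 0 \<Longrightarrow> cyl_sum n \<in> LFA"
  unfolding cyl_sum_def by (intro FA_sum FA_proj_word) (auto simp: paths_def)

lemma sum_mon_ctx:
  assumes "gens u" "gens w" "v \<in> verts G"
  shows "(\<lambda>z. \<Sum>e\<in>out_arcs G v. mon (u @ [GE e, GS e] @ w) z) \<approx>\<^sub>L mon (u @ [GV v] @ w)"
proof -
  have "mon ([GV v] @ w) \<approx>\<^sub>L (\<lambda>z. \<Sum>e\<in>out_arcs G v. mon ([GE e, GS e] @ w) z)"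
  proof (cases "w = []")
    case False
    then show ?thesis
      using eqv_mult_right[OF rel_ck[OF assms(3)] FA_mon[of w]] assms
      by (simp add: fa_mult_mon_mon fa_mult_sum_left)
  qed (use rel_ck assms in auto)
  note 1 = this
  have fin: "finite (out_arcs G v)" by blast
  have "mon (u @ [GV v] @ w) \<approx>\<^sub>L (\<lambda>z. \<Sum>e\<in>out_arcs G v. mon (u @ [GE e, GS e] @ w) z)"
  proof (cases "u = []")
    case False
    have "fa_mult (mon u) (\<lambda>z. \<Sum>e\<in>out_arcs G v. mon ([GE e, GS e] @ w) z) =
       (\<lambda>z. \<Sum>e\<in>out_arcs G v. mon (u @ [GE e, GS e] @ w) z)"
    proof -
      have "fa_mult (mon u) (\<lambda>z. \<Sum>e\<in>out_arcs G v. mon ([GE e, GS e] @ w) z) =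
        (\<lambda>z. \<Sum>e\<in>out_arcs G v. fa_mult (mon u) (mon ([GE e, GS e] @ w)) z)"
        unfolding fa_mult_def sum_distrib_left by (subst sum.swap) simp
      then show ?thesis by (simp add: fa_mult_mon_mon)
    qed
    then show ?thesis using eqv_mult_left[OF 1 FA_mon[of u]] False assms
      by (simp add: fa_mult_mon_mon)
  qed (use 1 in auto)
  then show ?thesis by (rule eqv_sym)
qed

text \<open>Each path is split by its next edge: the summation relation at the vertex
  \<open>head G (last \<alpha>)\<close>, inserted between \<open>ge \<alpha>\<close> and
  \<open>gs \<alpha>\<close>, refines the projection.\<close>

lemma cyl_sum_Suc: assumes "n > 0" shows "cyl_sum (Suc n) \<approx>\<^sub>L cyl_sum n"
proof -
  have "cyl_sum (Suc n) = (\<lambda>z. \<Sum>\<alpha>\<in>paths n. \<Sum>e\<in>out_arcs G (head G (last \<alpha>)). mon (ge \<alpha> @ [GE e, GS e] @ gs \<alpha>) z)"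
  proof
    fix z
    have "bij_betw (\<lambda>(\<alpha>, e). \<alpha> @ [e]) (SIGMA \<alpha>:paths n. out_arcs G (head G (last \<alpha>))) (paths (Suc n))"
    proof (rule bij_betwI')
      fix \<beta> assume "\<beta> \<in> paths (Suc n)"
      then have \<beta>: "pth \<beta>" "length \<beta> = Suc n" by (auto simp: paths_def)
      then have "\<beta> = butlast \<beta> @ [last \<beta>]" by (cases \<beta>) auto
      then have "pth (butlast \<beta> @ [last \<beta>])" using \<beta> by simp
      then have "(butlast \<beta>, last \<beta>) \<in> (SIGMA \<alpha>:paths n. out_arcs G (head G (last \<alpha>)))"
        using assms \<beta>(2) by (auto simp: paths_def pth_append pth_Cons out_arcs_def dest: arg_cong[where f=length])
      then show "\<exists>p\<in>SIGMA \<alpha>:paths n. out_arcs G (head G (last \<alpha>)). \<beta> = (case p of (\<alpha>, e) \<Rightarrow> \<alpha> @ [e])"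
        using \<open>\<beta> = butlast \<beta> @ [last \<beta>]\<close> by (intro bexI[of _ "(butlast \<beta>, last \<beta>)"]) auto
    qed (use assms in \<open>auto simp: paths_def pth_append pth_Cons out_arcs_def\<close>)
    then have "cyl_sum (Suc n) z = (\<Sum>p\<in>(SIGMA \<alpha>:paths n. out_arcs G (head G (last \<alpha>))). mon (proj_word (case p of (\<alpha>, e) \<Rightarrow> \<alpha> @ [e])) z)"
      unfolding cyl_sum_def by (rule sum.reindex_bij_betw[symmetric])
    also have "\<dots> = (\<Sum>(\<alpha>,e)\<in>(SIGMA \<alpha>:paths n. out_arcs G (head G (last \<alpha>))). mon (ge \<alpha> @ [GE e, GS e] @ gs \<alpha>) z)"
      by (rule sum.cong) (auto simp: proj_word_def)
    also have "\<dots> = (\<Sum>\<alpha>\<in>paths n. \<Sum>e\<in>out_arcs G (head G (last \<alpha>)). mon (ge \<alpha> @ [GE e, GS e] @ gs \<alpha>) z)"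
      by (rule sum.Sigma[symmetric]) auto
    finally show "cyl_sum (Suc n) z = (\<Sum>\<alpha>\<in>paths n. \<Sum>e\<in>out_arcs G (head G (last \<alpha>)). mon (ge \<alpha> @ [GE e, GS e] @ gs \<alpha>) z)" .
  qed
  also have "\<dots> \<approx>\<^sub>L (\<lambda>z. \<Sum>\<alpha>\<in>paths n. mon (proj_word \<alpha>) z)"
  proof (rule eqv_sum1)
    fix \<alpha> assume "\<alpha> \<in> paths n"
    then have \<alpha>: "pth \<alpha>" "\<alpha> \<noteq> []" using assms by (auto simp: paths_def)
    then have l: "last \<alpha> \<in> arcs G" "pth (butlast \<alpha>)" "\<alpha> = butlast \<alpha> @ [last \<alpha>]"
      by (auto simp: pth_def successively_append_iff) (metis append_butlast_last_id in_set_butlastD subsetD, metis append_butlast_last_id successively_append_iff)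
    have "(\<lambda>z. \<Sum>e\<in>out_arcs G (head G (last \<alpha>)). mon (ge \<alpha> @ [GE e, GS e] @ gs \<alpha>) z) \<approx>\<^sub>L
      mon (ge \<alpha> @ [GV (head G (last \<alpha>))] @ gs \<alpha>)"
      by (rule sum_mon_ctx) (use gens_pth[OF \<alpha>(1)] l in auto)
    also have "ge \<alpha> @ [GV (head G (last \<alpha>))] @ gs \<alpha> = ge (butlast \<alpha>) @ [GE (last \<alpha>), GV (head G (last \<alpha>))] @ gs \<alpha>"
      by (subst l(3)) (simp del: append_butlast_last_id)
    also have "mon \<dots> \<approx>\<^sub>L mon (ge (butlast \<alpha>) @ [GE (last \<alpha>)] @ gs \<alpha>)"
      by (rule mon_ctx[OF rel_eh]) (use gens_pth[OF l(2)] gens_pth[OF \<alpha>(1)] l(1) in auto)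
    also have "ge (butlast \<alpha>) @ [GE (last \<alpha>)] @ gs \<alpha> = proj_word \<alpha>"
      unfolding proj_word_def by (subst (3) l(3)) (simp del: append_butlast_last_id)
    finally show "(\<lambda>z. \<Sum>e\<in>out_arcs G (head G (last \<alpha>)). mon (ge \<alpha> @ [GE e, GS e] @ gs \<alpha>) z) \<approx>\<^sub>L mon (proj_word \<alpha>)" .
  qed
  finally show ?thesis by (simp add: cyl_sum_def)
qed

lemma mon_left_vertex:
  assumes "gens (g # w)" 
  shows "\<exists>u\<in>verts G. mon (GV u # g # w) \<approx>\<^sub>L mon (g # w) \<and> (\<forall>v\<in>verts G. v \<noteq> u \<longrightarrow> mon (GV v # g # w) \<in> I)"
proof -
  define u where "u = (case g of GV v \<Rightarrow> v | GE e \<Rightarrow> tail G e | GS e \<Rightarrow> head G e)"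
  have u: "u \<in> verts G" using assms by (cases g) (auto simp: u_def)
  have *: "mon [GV u, g] \<approx>\<^sub>L mon [g]"
    using assms by (cases g) (auto simp: u_def rel_vv rel_te rel_hs)
  have 1: "mon (GV u # g # w) \<approx>\<^sub>L mon (g # w)"
    using mon_ctx[OF *, of "[]" w] assms by simp
  have "mon (GV v # g # w) \<in> I" if "v \<in> verts G" "v \<noteq> u" for v
  proof -
    have "mon ([GV v] @ [GV u, g] @ w) \<approx>\<^sub>L mon ([GV v] @ [g] @ w)"
      by (rule mon_ctx[OF *]) (use assms that in auto)
    moreover have "mon ([] @ [GV v, GV u] @ (g # w)) \<in> I"
      by (rule mon_ctx_I[OF rel_vw]) (use assms that u in auto)
    ultimately show ?thesis using eqv_ideal by auto
  qed
  then show ?thesis using u 1 by blast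
qed

text \<open>The edge projections add up to the sum of all vertices. Exactly one vertex fixes the
  word from the left, the others annihilate it.\<close>

lemma cyl_sum_1_mon:
  assumes "gens w" "w \<noteq> []"
  shows "fa_mult (cyl_sum 1) (mon w) \<approx>\<^sub>L mon w"
proof -
  obtain g w' where w: "w = g # w'" using assms(2) by (cases w) auto
  obtain u where u: "u \<in> verts G" "mon (GV u # w) \<approx>\<^sub>L mon w"
      "\<And>v. v \<in> verts G \<Longrightarrow> v \<noteq> u \<Longrightarrow> mon (GV v # w) \<in> I"
    using mon_left_vertex assms(1) unfolding w by blast
  have "fa_mult (cyl_sum 1) (mon w) = (\<lambda>z. \<Sum>\<alpha>\<in>paths 1. mon (proj_word \<alpha> @ w) z)"
    by (simp add: cyl_sum_def fa_mult_sum_left fa_mult_mon_mon)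
  also have "\<dots> = (\<lambda>z. \<Sum>v\<in>verts G. \<Sum>e\<in>out_arcs G v. mon ([] @ [GE e, GS e] @ w) z)"
  proof
    fix z
    have "bij_betw (\<lambda>(v,e). [e]) (SIGMA v:verts G. out_arcs G v) (paths 1)"
      by (rule bij_betwI') (auto simp: paths_def pth_Cons out_arcs_def length_Suc_conv)
    then have "(\<Sum>\<alpha>\<in>paths 1. mon (proj_word \<alpha> @ w) z) = (\<Sum>p\<in>(SIGMA v:verts G. out_arcs G v). mon (proj_word (case p of (v,e) \<Rightarrow> [e]) @ w) z)"
      by (rule sum.reindex_bij_betw[symmetric])
    also have "\<dots> = (\<Sum>(v,e)\<in>(SIGMA v:verts G. out_arcs G v). mon ([] @ [GE e, GS e] @ w) z)"
      by (rule sum.cong) (auto simp: proj_word_def)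
    also have "\<dots> = (\<Sum>v\<in>verts G. \<Sum>e\<in>out_arcs G v. mon ([] @ [GE e, GS e] @ w) z)"
      by (rule sum.Sigma[symmetric]) auto
    finally show "(\<Sum>\<alpha>\<in>paths 1. mon (proj_word \<alpha> @ w) z) = (\<Sum>v\<in>verts G. \<Sum>e\<in>out_arcs G v. mon ([] @ [GE e, GS e] @ w) z)" .
  qed
  also have "\<dots> \<approx>\<^sub>L (\<lambda>z. \<Sum>v\<in>verts G. (if v = u then mon w else (\<lambda>_. 0)) z)"
  proof (rule eqv_sum1)
    fix v assume v: "v \<in> verts G"
    have "(\<lambda>z. \<Sum>e\<in>out_arcs G v. mon ([] @ [GE e, GS e] @ w) z) \<approx>\<^sub>L mon ([] @ [GV v] @ w)"
      by (rule sum_mon_ctx) (use assms v in auto)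
    moreover have "mon ([] @ [GV v] @ w) \<approx>\<^sub>L (if v = u then mon w else (\<lambda>_. 0))"
      using u v by (auto simp: eqv_zero)
    ultimately show "(\<lambda>z. \<Sum>e\<in>out_arcs G v. mon ([] @ [GE e, GS e] @ w) z) \<approx>\<^sub>L (if v = u then mon w else (\<lambda>_. 0))"
      by (rule eqv_trans)
  qed
  also have "(\<lambda>z. \<Sum>v\<in>verts G. (if v = u then mon w else (\<lambda>_. 0)) z) = mon w"
    using u(1) by (simp add: if_distrib[of "\<lambda>f. f _"] sum.delta cong: if_cong)
  finally show ?thesis .
qed

lemma cyl_sum_mult:
  assumes "n > 0" "a \<in> LFA"
  shows "fa_mult (cyl_sum n) a \<approx>\<^sub>L a"
proof -
  have "cyl_sum n \<approx>\<^sub>L cyl_sum 1" using assms(1)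
  proof (induction n)
    case (Suc n)
    then show ?case using cyl_sum_Suc[of n] eqv_trans by (cases "n = 0") auto
  qed simp
  then have "fa_mult (cyl_sum n) a \<approx>\<^sub>L fa_mult (cyl_sum 1) a" using assms by (intro eqv_mult_right)
  also have "fa_mult (cyl_sum 1) a = (\<lambda>z. \<Sum>w | a w \<noteq> 0. a w * fa_mult (cyl_sum 1) (mon w) z)"
    by (rule fa_mult_expand[OF FA_fin[OF assms(2)]])
  also have "\<dots> \<approx>\<^sub>L (\<lambda>z. \<Sum>w | a w \<noteq> 0. a w * mon w z)"
    by (rule eqv_sum; use cyl_sum_1_mon FA_gens[OF assms(2)] FA_Nil[OF assms(2)] FA_R[OF assms(2)] in \<open>metis (mono_tags, lifting) mem_Collect_eq\<close>)
  also have "\<dots> = a"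
    using fa_expand[OF FA_fin[OF assms(2)]] by (rule ext)
  finally show ?thesis .
qed

text \<open>The projections of cylinders of length \<open>word_bound a\<close> add up to a unit, so
  it suffices to kill \<open>a\<close> on each cylinder, and \<open>germ\<close> does this from a
  single row in it.\<close>

lemma faithful:
  assumes a: "a \<in> LFA" and row: "\<And>x q. x \<in> X \<Longrightarrow> row a (x, 0) q = 0"
  shows "a \<in> I"
proof -
  have "fa_mult (cyl_sum (word_bound a)) a = (\<lambda>z. \<Sum>\<alpha>\<in>paths (word_bound a). fa_mult (mon (proj_word \<alpha>)) a z)"
    unfolding cyl_sum_def by (rule fa_mult_sum_left)
  also have "\<dots> \<approx>\<^sub>L (\<lambda>z. \<Sum>\<alpha>\<in>paths (word_bound a). (\<lambda>_. 0) z)"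
  proof (rule eqv_sum1)
    fix \<alpha> assume "\<alpha> \<in> paths (word_bound a)"
    then have \<alpha>: "pth \<alpha>" "length \<alpha> = word_bound a" by (auto simp: paths_def)
    then have "\<alpha> \<noteq> []" by (metis length_0_conv less_irrefl word_bound_pos)
    then obtain z where z: "\<alpha> \<frown> z \<in> X" using path_extend \<alpha> by blast
    have "prefix (word_bound a) (\<alpha> \<frown> z) = \<alpha>" using \<alpha>(2) by simp
    then show "fa_mult (mon (proj_word \<alpha>)) a \<approx>\<^sub>L (\<lambda>_. 0)"
      using germ[OF z a order_refl] row[OF z] by (simp add: eqv_zero)
  qed
  finally have "fa_mult (cyl_sum (word_bound a)) a \<in> I" by (simp add: eqv_zero)
  moreover have "fa_mult (cyl_sum (word_bound a)) a \<approx>\<^sub>L a" by (rule cyl_sum_mult) (use a in auto)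
  ultimately show ?thesis using eqv_ideal by blast
qed

end


section \<open>Isomorphisms matching the diagonals\<close>

text \<open>Then \<open>(y, k)\<close> can be reached from \<open>(x, 0)\<close> by removing
  \<open>i\<close> edges and adding \<open>j\<close>. For eventually periodic paths \<open>k\<close>
  is not unique, so the lag is a relation and not a function of the two paths.\<close>

definition tail_lag :: "(nat \<Rightarrow> 'e) \<Rightarrow> (nat \<Rightarrow> 'e) \<Rightarrow> int \<Rightarrow> bool" where
  "tail_lag x y k \<longleftrightarrow> (\<exists>i j. suffix i x = suffix j y \<and> k = int j - int i)"

lemma tail_lag_refl: "tail_lag x x 0"
  unfolding tail_lag_def by (intro exI[of _ 0]) simp

lemma tail_lag_sym: "tail_lag x y k \<Longrightarrow> tail_lag y x (-k)"
  unfolding tail_lag_def by (metis minus_diff_eq)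

lemma tail_lag_trans:
  assumes "tail_lag x y k" "tail_lag y z l"
  shows "tail_lag x z (k + l)"
proof -
  obtain i j i' j' where *: "suffix i x = suffix j y" "k = int j - int i"
      "suffix i' y = suffix j' z" "l = int j' - int i'"
    using assms unfolding tail_lag_def by blast
  have "suffix (i + i') x = suffix (j + i') y"
    using arg_cong[OF *(1), of "suffix i'"] by simp
  also have "\<dots> = suffix (j' + j) z"
    using arg_cong[OF *(3), of "suffix j"] by (simp add: add.commute)
  finally show ?thesis
    unfolding tail_lag_def by (intro exI conjI, assumption) (use * in auto)
qed

lemma tail_lag_suffix: "tail_lag x (suffix k x) (- int k)"
  unfolding tail_lag_def by (intro exI[of _ k] exI[of _ 0]) simp

lemma fa_star_mon: "fa_star (mon w) = mon (word_star w)"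
proof
  fix z
  have "rev (map gen_star z) = w \<longleftrightarrow> z = word_star w"
    using word_star_word_star unfolding word_star_def by metis
  then show "fa_star (mon w) z = mon (word_star w) z"
    by (simp add: fa_star_def mon_def)
qed

lemma word_eq_iff_prefix: "(\<And>n. n > 0 \<Longrightarrow> prefix n x = prefix n y) \<Longrightarrow> x = y"
proof
  fix n assume *: "\<And>n. n > 0 \<Longrightarrow> prefix n x = prefix n y"
  have "prefix (Suc n) x ! n = prefix (Suc n) y ! n" using *[of "Suc n"] by simp
  then show "x n = y n" by (simp del: subseq_to_Suc)
qed

lemma prefix_mono_eq: "prefix n x = prefix n y \<Longrightarrow> m \<le> n \<Longrightarrow> prefix m x = prefix m y"
  by (drule arg_cong[of _ _ "take m"]) (simp add: min_absorb1)

lemma separating_prefix: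
  assumes "finite S" "z \<notin> S"
  shows "\<exists>n>0. \<forall>y\<in>S. prefix n y \<noteq> prefix n z"
  using assms
proof (induction S rule: finite_induct)
  case (insert y S)
  then obtain n where n: "n > 0" "\<And>y. y \<in> S \<Longrightarrow> prefix n y \<noteq> prefix n z" by auto
  have "y \<noteq> z" using insert by auto
  then obtain k where k: "prefix k y \<noteq> prefix k z" using word_eq_iff_prefix[of y z] by blast
  have "\<forall>y'\<in>insert y S. prefix (max n k) y' \<noteq> prefix (max n k) z"
    using n k prefix_mono_eq[where n="max n k" and m=n] prefix_mono_eq[where n="max n k" and m=k] by (metis insert_iff max.cobounded1 max.cobounded2)
  then show ?case using n(1) by (intro exI[of _ "max n k"]) auto
qed auto

section \<open>Matrix rows of projections, diagonal elements and monomials\<close>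

context lpa
begin

lemma ract_ge: "ract (ge \<alpha>) (x, k) =
    (if prefix (length \<alpha>) x = \<alpha> then Some (suffix (length \<alpha>) x, k - int (length \<alpha>)) else None)"
proof (induction \<alpha> arbitrary: x k)
  case (Cons e \<alpha>)
  have *: "prefix (Suc (length \<alpha>)) x = x 0 # prefix (length \<alpha>) (suffix 1 x)"
    by (rule nth_equalityI) (auto simp: nth_Cons nth_append less_Suc_eq split: nat.splits simp del: subseq_to_Suc subsequence_shift)
  show ?case
    by (simp add: Cons * suffix_def del: subseq_to_Suc subsequence_shift)
qed simp

lemma ract_gs: "\<alpha> \<frown> z \<in> X \<Longrightarrow> ract (gs \<alpha>) (z, k) = Some (\<alpha> \<frown> z, k + int (length \<alpha>))"
  by (induction \<alpha>) (auto simp: ract_append X_build)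

lemma ract_proj_word:
  assumes "x \<in> X"
  shows "ract (proj_word \<alpha>) (x, k) = (if prefix (length \<alpha>) x = \<alpha> then Some (x, k) else None)"
proof (cases "prefix (length \<alpha>) x = \<alpha>")
  case True
  then have "x = \<alpha> \<frown> suffix (length \<alpha>) x" by (metis prefix_suffix)
  then have "ract (gs \<alpha>) (suffix (length \<alpha>) x, k - int (length \<alpha>)) = Some (x, k)"
    using ract_gs[of \<alpha> "suffix (length \<alpha>) x"] assms by simp
  then show ?thesis using True by (simp add: proj_word_def ract_append ract_ge)
qed (simp add: proj_word_def ract_append ract_ge)

lemma is_diag_proj_word: "is_diag (mon (proj_word \<alpha>))"
  unfolding is_diag_def by (auto simp: ract_proj_word)

lemma dval_proj_word: "x \<in> X \<Longrightarrow> dval (mon (proj_word \<alpha>)) x = (if prefix (length \<alpha>) x = \<alpha> then 1 else 0)"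
  by (simp add: dval_def ract_proj_word)

lemma row_diag: "is_diag d \<Longrightarrow> x \<in> X \<Longrightarrow> row d (x, 0) q = (if q = (x, 0) then dval d x else 0)"
  unfolding is_diag_def dval_def by (cases q) auto

lemma row_diag_shift:
  assumes "is_diag d" "x \<in> X"
  shows "row d (x, k) q = (if q = (x, k) then dval d x else 0)"
  using row_base[of d x k "fst q" "snd q"] row_diag[OF assms, of "(fst q, snd q - k)"]
  by (cases q) auto

lemma row_mult_diag_left:
  assumes "is_diag d" "d \<in> LFA" "a \<in> LFA" "x \<in> X"
  shows "row (fa_mult d a) (x, 0) q = dval d x * row a (x, 0) q"
  by (subst row_mult[where T="{(x,0)}"]) (use assms in \<open>auto simp: row_diag split: if_splits\<close>)

lemma row_mult_diag_right:
  assumes "is_diag d" "d \<in> LFA" "a \<in> LFA" "x \<in> X"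
  shows "row (fa_mult a d) (x, 0) q = row a (x, 0) q * dval d (fst q)"
proof -
  let ?T = "{q. row a (x, 0) q \<noteq> 0}"
  have "row (fa_mult a d) (x, 0) q = (\<Sum>r\<in>?T. row a (x, 0) r * row d r q)"
    by (rule row_mult) (use assms finite_row in auto)
  also have "\<dots> = (\<Sum>r\<in>?T. if r = q then row a (x, 0) q * dval d (fst q) else 0)"
  proof (rule sum.cong)
    fix r assume "r \<in> ?T"
    then have "fst r \<in> X" using row_in_X[OF assms(3), of "(x,0)" r] assms(4) by simp
    then show "row a (x, 0) r * row d r q = (if r = q then row a (x, 0) q * dval d (fst q) else 0)"
      using row_diag_shift[OF assms(1), of "fst r" "snd r" q] by auto
  qed simp
  also have "\<dots> = row a (x, 0) q * dval d (fst q)"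
    using finite_row[OF assms(3)] by (auto simp: sum.delta)
  finally show ?thesis .
qed

lemma row_mult_single:
  assumes "a \<in> LFA" "b \<in> LFA" "\<And>q. row a p q = (if q = q0 then c else 0)"
  shows "row (fa_mult a b) p r = c * row b q0 r"
  by (subst row_mult[where T="{q0}"]) (use assms in \<open>auto split: if_splits\<close>)

lemma ract1_tail_lag: "ract1 g p = Some q \<Longrightarrow> tail_lag (fst p) (fst q) (snd q - snd p)"
proof (cases g)
  case (GS e)
  assume "ract1 g p = Some q"
  then have "q = (e ## fst p, snd p + 1)" using GS by (auto split: if_splits)
  then show ?thesis
    unfolding tail_lag_def by (intro exI[of _ 0] exI[of _ 1]) simp
next
  case (GE e)
  assume "ract1 g p = Some q"
  then have "q = (suffix 1 (fst p), snd p - 1)" using GE by (auto split: if_splits)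
  then show ?thesis using tail_lag_suffix[of "fst p" 1] by simp
qed (auto simp: tail_lag_refl split: if_splits)

lemma ract_tail_lag: "ract w p = Some q \<Longrightarrow> tail_lag (fst p) (fst q) (snd q - snd p)"
proof (induction w arbitrary: p)
  case (Cons g w)
  then obtain r where r: "ract1 g p = Some r" "ract w r = Some q" by (auto simp: bind_eq_Some_conv)
  show ?case using tail_lag_trans[OF ract1_tail_lag[OF r(1)] Cons.IH[OF r(2)]] by simp
qed (simp add: tail_lag_refl)

lemma row_tail_lag: "row a (x, 0) (y, k) \<noteq> 0 \<Longrightarrow> tail_lag x y k"
  using row_neq_zero ract_tail_lag by fastforce

lemma tail_lag_word:
  assumes "x \<in> X" "y \<in> X" "suffix i x = suffix j y" "i > 0"
  defines "w \<equiv> ge (prefix i x) @ gs (prefix j y)"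
  shows "gens w" "w \<noteq> []" "ract w (x, 0) = Some (y, int j - int i)"
proof -
  show "gens w" using X_prefix[OF assms(1), of i] X_prefix[OF assms(2), of j]
    unfolding w_def by (auto simp: pth_def)
  show "w \<noteq> []" using assms(4) by (simp add: w_def)
  have "ract (gs (prefix j y)) (suffix i x, - int i) = Some (y, int j - int i)"
    using ract_gs[of "prefix j y" "suffix j y" "- int i"] assms(2,3) by simp
  then show "ract w (x, 0) = Some (y, int j - int i)"
    by (simp add: w_def ract_append ract_ge)
qed

lemma tail_lag_mon:
  assumes "x \<in> X" "y \<in> X" "tail_lag x y k"
  obtains w where "mon w \<in> LFA" "\<And>q. row (mon w) (x, 0) q = (if q = (y, k) then 1 else 0)"
proof -
  obtain i j where ij: "suffix i x = suffix j y" "k = int j - int i"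
    using assms(3) unfolding tail_lag_def by blast
  \<comment> \<open>One further shift on both sides makes \<open>i\<close> positive, so that the
    word is not empty.\<close>
  have "suffix (Suc i) x = suffix (Suc j) y"
    using arg_cong[OF ij(1), of "suffix 1"] by simp
  note w = tail_lag_word[OF assms(1,2) this]
  show thesis
    by (rule that[OF FA_mon[OF w(1,2)]]) (use w(3) ij in auto)
qed

lemma X_iff_prefix: "x \<in> X" if "\<And>n. n > 0 \<Longrightarrow> pth (prefix n x)"
  unfolding X_def
proof (intro CollectI allI)
  fix n
  have "pth (prefix n x @ [x n] @ [x (Suc n)])" using that[of "Suc (Suc n)"] by simp
  then show "x n \<in> arcs G \<and> head G (x n) = tail G (x (Suc n))"
    by (auto simp: pth_append pth_Cons)
qed

end

text \<open>An isomorphism is kept as the relation between representatives that it induces, which makes the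
  situation symmetric in \<open>E\<close> and \<open>F\<close>.\<close>
locale lpa_pair = A: lpa E R + B: lpa F R
  for E :: "('v1,'e1) pre_digraph" and F :: "('v2,'e2) pre_digraph" and R +
  fixes P :: "('v1,'e1) fa \<Rightarrow> ('v2,'e2) fa \<Rightarrow> bool"
  assumes P_dom: "P a b \<Longrightarrow> a \<in> FA R E \<and> b \<in> FA R F"
    and P_ex: "a \<in> FA R E \<Longrightarrow> \<exists>b. P a b"
    and P_ex': "b \<in> FA R F \<Longrightarrow> \<exists>a. P a b"
    and P_add: "P a b \<Longrightarrow> P a' b' \<Longrightarrow> P (fa_add a a') (fa_add b b')"
    and P_mult: "P a b \<Longrightarrow> P a' b' \<Longrightarrow> P (fa_mult a a') (fa_mult b b')"
    and P_smult: "P a b \<Longrightarrow> c \<in> R \<Longrightarrow> P (fa_smult c a) (fa_smult c b)"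
    and P_star: "P a b \<Longrightarrow> P (fa_star a) (fa_star b)"
    and P_ideal: "P a b \<Longrightarrow> a \<in> LPA_ideal R E \<longleftrightarrow> b \<in> LPA_ideal R F"
    and P_zero: "P (\<lambda>w. 0) (\<lambda>w. 0)"
    and P_diag: "A.pth \<alpha> \<Longrightarrow> \<alpha> \<noteq> [] \<Longrightarrow> P (mon (A.proj_word \<alpha>)) b \<Longrightarrow> B.is_diag b"
    and P_diag': "B.pth \<mu> \<Longrightarrow> \<mu> \<noteq> [] \<Longrightarrow> P a (mon (B.proj_word \<mu>)) \<Longrightarrow> A.is_diag a"
begin

lemma swap: "lpa_pair F E R (\<lambda>b a. P a b)"
proof unfold_locales
  show "b \<in> FA R F \<and> a \<in> FA R E" if "P a b" for b a using P_dom[OF that] by simp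
  show "\<exists>a. P a b" if "b \<in> FA R F" for b using P_ex'[OF that] .
  show "\<exists>b. P a b" if "a \<in> FA R E" for a using P_ex[OF that] .
  show "P (fa_add a a') (fa_add b b')" if "P a b" "P a' b'" for b a b' a' using P_add[OF that] .
  show "P (fa_mult a a') (fa_mult b b')" if "P a b" "P a' b'" for b a b' a' using P_mult[OF that] .
  show "P (fa_smult c a) (fa_smult c b)" if "P a b" "c \<in> R" for b a c using P_smult[OF that] .
  show "P (fa_star a) (fa_star b)" if "P a b" for b a using P_star[OF that] .
  show "b \<in> LPA_ideal R F \<longleftrightarrow> a \<in> LPA_ideal R E" if "P a b" for b a using P_ideal[OF that] by simp
  show "P (\<lambda>w. 0) (\<lambda>w. 0)" by (rule P_zero)
  show "A.is_diag a" if "B.pth \<mu>" "\<mu> \<noteq> []" "P a (mon (B.proj_word \<mu>))" for \<mu> a using P_diag'[OF that] .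
  show "B.is_diag b" if "A.pth \<alpha>" "\<alpha> \<noteq> []" "P (mon (A.proj_word \<alpha>)) b" for \<alpha> b using P_diag[OF that] .
qed

lemma P_A: "P a b \<Longrightarrow> a \<in> FA R E" and P_B: "P a b \<Longrightarrow> b \<in> FA R F"
  using P_dom by auto

lemma P_diff: "P a b \<Longrightarrow> P a' b' \<Longrightarrow> P (fa_diff a a') (fa_diff b b')"
  unfolding fa_diff_conv by (intro P_add P_smult) auto

lemma P_sum:
  assumes "\<And>i. i \<in> S \<Longrightarrow> P (x i) (y i)"
  shows "P (\<lambda>w. \<Sum>i\<in>S. x i w) (\<lambda>w. \<Sum>i\<in>S. y i w)"
  using assms
proof (induction S rule: infinite_finite_induct)
  case (insert j S)
  have "P (fa_add (x j) (\<lambda>w. \<Sum>i\<in>S. x i w)) (fa_add (y j) (\<lambda>w. \<Sum>i\<in>S. y i w))"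
    using insert by (intro P_add) auto
  then show ?case using insert by (simp add: fa_add_def)
qed (auto simp: P_zero)

text \<open>Equal rows over \<open>E\<close> put the difference into the ideal, and \<open>P\<close>
  preserves ideals. Identities cross over in this way before any points of the two path spaces have
  been matched.\<close>

lemma transfer_rows:
  assumes "P a b" "P a' b'" "\<And>y q. y \<in> A.X \<Longrightarrow> A.row a (y, 0) q = A.row a' (y, 0) q" "x \<in> B.X"
  shows "B.row b (x, 0) q = B.row b' (x, 0) q"
proof -
  have "fa_diff a a' \<in> LPA_ideal R E"
    by (rule A.faithful) (use assms P_A in \<open>auto intro!: A.FA_diff simp: A.row_diff\<close>)
  then have "fa_diff b b' \<in> LPA_ideal R F" using P_ideal[OF P_diff[OF assms(1,2)]] by simp
  then show ?thesis using B.ideal_row[of "fa_diff b b'" "(x,0)" q] assms P_B by (simp add: B.row_diff)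
qed

text \<open>Points correspond if they define the same character on the identified diagonals.\<close>
definition H :: "(nat \<Rightarrow> 'e1) \<Rightarrow> (nat \<Rightarrow> 'e2) \<Rightarrow> bool" where
  "H y x \<longleftrightarrow> y \<in> A.X \<and> x \<in> B.X \<and>
     (\<forall>a b. P a b \<longrightarrow> A.is_diag a \<longrightarrow> B.is_diag b \<longrightarrow> A.dval a y = B.dval b x)"

lemma H_X: "H y x \<Longrightarrow> y \<in> A.X" "H y x \<Longrightarrow> x \<in> B.X"
  and H_dval: "H y x \<Longrightarrow> P a b \<Longrightarrow> A.is_diag a \<Longrightarrow> B.is_diag b \<Longrightarrow> A.dval a y = B.dval b x"
  by (auto simp: H_def)

lemma H_unique: assumes "H y x" "H y' x" shows "y = y'"
proof (rule word_eq_iff_prefix)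
  fix n :: nat assume n: "n > 0"
  let ?\<alpha> = "prefix n y"
  have y: "y \<in> A.X" "y' \<in> A.X" using assms H_X by auto
  have \<alpha>: "A.pth ?\<alpha>" "?\<alpha> \<noteq> []" using A.X_prefix y n by auto
  obtain b where b: "P (mon (A.proj_word ?\<alpha>)) b" using P_ex A.FA_proj_word[OF \<alpha>] by blast
  have "A.dval (mon (A.proj_word ?\<alpha>)) y = A.dval (mon (A.proj_word ?\<alpha>)) y'"
    using H_dval[OF assms(1) b] H_dval[OF assms(2) b] P_diag[OF \<alpha> b] A.is_diag_proj_word by simp
  then show "prefix n y = prefix n y'" using y by (auto simp: A.dval_proj_word split: if_splits)
qed

text \<open>Evaluation at \<open>x\<close> gives a character: its values \<open>u\<close> on the
  cylinder projections of \<open>E\<close> are multiplicative and add up to 1 in each length. So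
  some path of each length has value 1, these paths extend one another, and their limit is
  \<open>y\<close>.\<close>

lemma ex_H: assumes x: "x \<in> B.X" shows "\<exists>y. H y x"
proof -
  define bb where "bb \<alpha> = (SOME b. P (mon (A.proj_word \<alpha>)) b)" for \<alpha>
  have bb: "P (mon (A.proj_word \<alpha>)) (bb \<alpha>)" if "A.pth \<alpha>" "\<alpha> \<noteq> []" for \<alpha>
    unfolding bb_def using P_ex[OF A.FA_proj_word[OF that]] by (rule someI_ex)
  have bF: "bb \<alpha> \<in> FA R F" "B.is_diag (bb \<alpha>)" if "A.pth \<alpha>" "\<alpha> \<noteq> []" for \<alpha>
    using P_B[OF bb[OF that]] P_diag[OF that bb[OF that]] by auto
  define u where "u \<alpha> = B.dval (bb \<alpha>) x" for \<alpha>
  have prod: "u \<alpha> * u \<beta> = (if take (length \<alpha>) \<beta> = \<alpha> then u \<beta> else 0)"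
    if \<alpha>: "A.pth \<alpha>" "\<alpha> \<noteq> []" and \<beta>: "A.pth \<beta>" "\<beta> \<noteq> []" and le: "length \<alpha> \<le> length \<beta>" for \<alpha> \<beta>
  proof -
    have eq: "A.row (fa_mult (mon (A.proj_word \<alpha>)) (mon (A.proj_word \<beta>))) (y, 0) q =
      A.row (fa_smult (if take (length \<alpha>) \<beta> = \<alpha> then 1 else 0) (mon (A.proj_word \<beta>))) (y, 0) q" if y: "y \<in> A.X" for y q
    proof -
      have "prefix (length \<alpha>) y = take (length \<alpha>) \<beta>" if "prefix (length \<beta>) y = \<beta>"
        using arg_cong[OF that, of "take (length \<alpha>)"] le by (simp add: min_absorb1)
      then show ?thesis
        using y \<alpha> \<beta> A.FA_proj_word
        by (auto simp: A.row_mult_diag_left A.is_diag_proj_word A.dval_proj_word A.row_smult A.ract_proj_word simp del: A.row_mon)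
           (auto simp: A.ract_proj_word)
    qed
    have "B.row (fa_mult (bb \<alpha>) (bb \<beta>)) (x, 0) (x, 0) =
      B.row (fa_smult (if take (length \<alpha>) \<beta> = \<alpha> then 1 else 0) (bb \<beta>)) (x, 0) (x, 0)"
      by (rule transfer_rows[OF P_mult[OF bb[OF \<alpha>] bb[OF \<beta>]] P_smult[OF bb[OF \<beta>]] eq x]) auto
    then show ?thesis
      using bF[OF \<alpha>] bF[OF \<beta>] x by (auto simp: B.row_mult_diag_left B.row_smult u_def B.dval_def)
  qed
  have sum1: "(\<Sum>\<alpha>\<in>A.paths n. u \<alpha>) = 1" if n: "n > 0" for n
  proof -
    have \<alpha>: "A.pth \<alpha>" "\<alpha> \<noteq> []" if "\<alpha> \<in> A.paths n" for \<alpha>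
      using that n by (auto simp: A.paths_def)
    \<comment> \<open>The unit property of \<open>cyl_sum\<close> is tested on the vertex at which
      \<open>x\<close> starts, since this vertex acts as 1 at \<open>x\<close>.\<close>
    define v where "v = tail F (x 0)"
    have w: "mon [GV v] \<in> FA R F"
      using x by (intro B.FA_mon) (auto simp: v_def B.X_def)
    obtain a where a: "P a (mon [GV v])" using P_ex'[OF w] by blast
    have "P (A.cyl_sum n) (\<lambda>w. \<Sum>\<alpha>\<in>A.paths n. bb \<alpha> w)"
      unfolding A.cyl_sum_def by (rule P_sum) (use bb \<alpha> in auto)
    from P_diff[OF P_mult[OF this a] a]
    have "fa_diff (fa_mult (\<lambda>w. \<Sum>\<alpha>\<in>A.paths n. bb \<alpha> w) (mon [GV v])) (mon [GV v]) \<in> LPA_ideal R F"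
      using P_ideal A.cyl_sum_mult[OF n P_A[OF a]] unfolding A.eqv_def by blast
    then have "B.row (fa_mult (\<lambda>w. \<Sum>\<alpha>\<in>A.paths n. bb \<alpha> w) (mon [GV v])) (x,0) (x,0) = B.row (mon [GV v]) (x,0) (x,0)"
      using x w \<alpha> bF by (intro B.eqv_row) (auto simp: B.eqv_def intro!: B.FA_mult B.FA_sum)
    also have "\<dots> = 1" by (simp add: v_def)
    also have "B.row (fa_mult (\<lambda>w. \<Sum>\<alpha>\<in>A.paths n. bb \<alpha> w) (mon [GV v])) (x,0) (x,0)
       = (\<Sum>\<alpha>\<in>A.paths n. B.row (fa_mult (bb \<alpha>) (mon [GV v])) (x,0) (x,0))"
      unfolding fa_mult_sum_left by (rule B.row_sum) (use \<alpha> bF w in \<open>auto intro!: B.FA_mult\<close>)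
    also have "\<dots> = (\<Sum>\<alpha>\<in>A.paths n. u \<alpha>)"
      by (rule sum.cong) (use \<alpha> bF w x in \<open>auto simp: B.row_mult_diag_left u_def v_def\<close>)
    finally show ?thesis by simp
  qed
  have "\<exists>\<alpha>\<in>A.paths n. u \<alpha> = 1" if n: "n > 0" for n
  proof -
    have "\<exists>\<alpha>\<in>A.paths n. u \<alpha> \<noteq> 0"
    proof (rule ccontr)
      assume "\<not> ?thesis"
      then have "sum u (A.paths n) = 0" by (intro sum.neutral) auto
      with sum1[OF n] show False by simp
    qed
    then obtain \<alpha> where \<alpha>: "\<alpha> \<in> A.paths n" "u \<alpha> \<noteq> 0" by blast
    then have "A.pth \<alpha>" "\<alpha> \<noteq> []" using n by (auto simp: A.paths_def)
    then have "u \<alpha> * u \<alpha> = u \<alpha>" using prod[of \<alpha> \<alpha>] by simp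
    then show ?thesis using \<alpha> by auto
  qed
  then obtain al where al: "\<And>n. n > 0 \<Longrightarrow> al n \<in> A.paths n" "\<And>n. n > 0 \<Longrightarrow> u (al n) = 1" by metis
  have al': "A.pth (al n)" "al n \<noteq> []" "length (al n) = n" if "n > 0" for n
    using al(1)[OF that] that by (auto simp: A.paths_def)
  have al_take: "take n (al m) = al n" if "n > 0" "n \<le> m" for n m
  proof -
    have "u (al n) * u (al m) = (if take (length (al n)) (al m) = al n then u (al m) else 0)"
      using that al' by (intro prod) auto
    then show ?thesis using al(2)[of n] al(2)[of m] that al'(3) by (auto split: if_splits)
  qed
  define y where "y i = al (Suc i) ! i" for i
  have pre: "prefix n y = al n" if n: "n > 0" for n
  proof (rule nth_equalityI)
    fix i assume "i < length (prefix n y)"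
    then have i: "i < n" by simp
    then have "al (Suc i) ! i = al n ! i" using al_take[of "Suc i" n] by (metis Suc_leI lessI nth_take zero_less_Suc)
    then show "prefix n y ! i = al n ! i" using i by (simp add: y_def)
  qed (use al' n in simp)
  have y: "y \<in> A.X" by (rule A.X_iff_prefix) (use pre al' in auto)
  have "H y x" unfolding H_def
  proof (intro conjI allI impI y x)
    fix a b assume ab: "P a b" "A.is_diag a" "B.is_diag b"
    define c where "c = A.dval a y"
    define \<alpha> where "\<alpha> = prefix 1 y"
    have \<alpha>: "A.pth \<alpha>" "\<alpha> \<noteq> []" "u \<alpha> = 1" using al'[of 1] al[of 1] pre[of 1] by (auto simp: \<alpha>_def)
    have cR: "c \<in> R" unfolding c_def A.dval_def by (rule A.row_R[OF P_A[OF ab(1)]])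
    have aF: "a \<in> FA R E" "b \<in> FA R F" using P_dom[OF ab(1)] by auto
    \<comment> \<open>The projection of \<open>\<alpha>\<close> has value 1 at \<open>y\<close> and
      its partner has value 1 at \<open>x\<close>. Hence \<open>d\<close> has a zero row at
      \<open>y\<close>, and \<open>germ\<close> supplies a longer prefix whose projection
      annihilates it; the partner of that projection still has value 1 at \<open>x\<close>.\<close>
    define d where "d = fa_diff a (fa_smult c (mon (A.proj_word \<alpha>)))"
    define d' where "d' = fa_diff b (fa_smult c (bb \<alpha>))"
    have dd: "P d d'" unfolding d_def d'_def by (intro P_diff ab P_smult bb \<alpha> cR)
    have "A.row d (y, 0) q = 0" for q
    proof -
      have "prefix (length \<alpha>) y = \<alpha>" by (simp add: \<alpha>_def)
      then show ?thesis
      unfolding d_def using aF A.FA_proj_word[OF \<alpha>(1,2)] cR y ab(2)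
      by (simp add: A.row_diff A.FA_smult A.row_smult A.row_diag c_def A.ract_proj_word)
    qed
    then have "fa_mult (mon (A.proj_word (prefix (A.word_bound d) y))) d \<in> LPA_ideal R E"
      by (intro A.germ[OF y]) (use P_A[OF dd] in auto)
    then have I: "fa_mult (bb (prefix (A.word_bound d) y)) d' \<in> LPA_ideal R F"
      using P_ideal[OF P_mult[OF bb dd]] pre[of "A.word_bound d"] al'[of "A.word_bound d"] by auto
    let ?\<beta> = "prefix (A.word_bound d) y"
    have \<beta>: "A.pth ?\<beta>" "?\<beta> \<noteq> []" "u ?\<beta> = 1" using pre[of "A.word_bound d"] al'[of "A.word_bound d"] al[of "A.word_bound d"] by auto
    have "0 = B.row (fa_mult (bb ?\<beta>) d') (x,0) (x,0)" using B.ideal_row[OF I] x by simp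
    also have "\<dots> = u ?\<beta> * B.row d' (x,0) (x,0)"
      using bF[OF \<beta>(1,2)] P_B[OF dd] x by (simp add: B.row_mult_diag_left u_def)
    also have "\<dots> = B.dval b x - c"
      unfolding d'_def using aF bF[OF \<alpha>(1,2)] \<alpha>(3) \<beta>(3) cR
      by (simp add: B.row_diff B.FA_smult B.row_smult u_def B.dval_def)
    finally show "A.dval a y = B.dval b x" by (simp add: c_def)
  qed
  then show ?thesis by blast
qed

text \<open>By \<open>germ\<close> some cylinder projection around \<open>y\<close> annihilates
  \<open>a\<close> from the left. Its partner \<open>d\<close> has value 1 at \<open>x\<close>, so
  the row of \<open>b\<close> at \<open>x\<close> is unchanged by \<open>d\<close> and yet
  zero.\<close>

lemma row_zero:
  assumes "H y x" "P a b" "\<And>q. A.row a (y, 0) q = 0"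
  shows "B.row b (x, 0) q = 0"
proof -
  let ?\<alpha> = "prefix (A.word_bound a) y"
  have y: "y \<in> A.X" "x \<in> B.X" using assms H_X by auto
  have \<alpha>: "A.pth ?\<alpha>" "?\<alpha> \<noteq> []" using A.X_prefix[OF y(1)] by auto
  obtain d where d: "P (mon (A.proj_word ?\<alpha>)) d" using P_ex A.FA_proj_word[OF \<alpha>] by blast
  have diag: "B.is_diag d" using P_diag \<alpha> d by blast
  have dv: "B.dval d x = 1" using H_dval[OF assms(1) d A.is_diag_proj_word diag] y by (simp add: A.dval_proj_word)
  have "fa_mult (mon (A.proj_word ?\<alpha>)) a \<in> LPA_ideal R E"
    by (rule A.germ[OF y(1) P_A[OF assms(2)]]) (use assms in auto)
  then have "fa_mult d b \<in> LPA_ideal R F" using P_ideal[OF P_mult[OF d assms(2)]] by simp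
  then have "0 = B.row (fa_mult d b) (x, 0) q" using B.ideal_row y by simp
  also have "\<dots> = B.row b (x, 0) q"
    using diag dv P_B[OF d] P_B[OF assms(2)] y by (simp add: B.row_mult_diag_left)
  finally show ?thesis by simp
qed

end

context lpa_pair
begin

interpretation S: lpa_pair F E R "\<lambda>b a. P a b" by (rule swap)

lemma S_H: "S.H x y \<longleftrightarrow> H y x"
  unfolding S.H_def H_def by auto

lemma ex_H': "y \<in> A.X \<Longrightarrow> \<exists>x. H y x"
  using S.ex_H unfolding S_H by blast

lemma H_unique': "H y x \<Longrightarrow> H y x' \<Longrightarrow> x = x'"
  using S.H_unique unfolding S_H by blast

lemma row_zero': "H y x \<Longrightarrow> P a b \<Longrightarrow> (\<And>q. B.row b (x, 0) q = 0) \<Longrightarrow> A.row a (y, 0) q = 0"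
  using S.row_zero unfolding S_H by blast

text \<open>Otherwise a cylinder around \<open>z\<close> avoids the partners of the finitely many
  points in the row of \<open>b\<close>. Right multiplication by its projection would kill this row
  but keep the entry of \<open>a\<close> at \<open>z\<close>.\<close>

lemma row_support:
  assumes "H y x" "P a b" "A.row a (y, 0) (z, k) \<noteq> 0"
  shows "\<exists>x' k'. H z x' \<and> B.row b (x, 0) (x', k') \<noteq> 0"
proof -
  have yx: "y \<in> A.X" "x \<in> B.X" using assms H_X by auto
  have ab: "a \<in> FA R E" "b \<in> FA R F" using P_dom[OF assms(2)] by auto
  have z: "z \<in> A.X" using A.row_in_X[OF ab(1) _ assms(3)] yx by simp
  obtain x' where x': "H z x'" using ex_H'[OF z] by blast
  show ?thesis
  proof (rule ccontr)
    assume no: "\<not> ?thesis"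
    let ?S = "fst ` {q. B.row b (x, 0) q \<noteq> 0}"
    have inX: "x'' \<in> B.X" "x'' \<noteq> x'" if "x'' \<in> ?S" for x''
      using that no x' B.row_in_X[OF ab(2), of "(x,0)"] yx by auto
    define g where "g x'' = (SOME y. H y x'')" for x''
    have g: "H (g x'') x''" if "x'' \<in> ?S" for x''
      unfolding g_def using ex_H[OF inX(1)[OF that]] by (rule someI_ex)
    have "z \<notin> g ` ?S"
    proof
      assume "z \<in> g ` ?S"
      then obtain x'' where "x'' \<in> ?S" "z = g x''" by blast
      then have "H z x''" using g by simp
      then show False using H_unique' x' inX(2)[OF \<open>x'' \<in> ?S\<close>] by blast
    qed
    moreover have "finite (g ` ?S)" using B.finite_row[OF ab(2)] by blast
    ultimately have "\<exists>n>0. \<forall>y\<in>g ` ?S. prefix n y \<noteq> prefix n z"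
      by (intro separating_prefix)
    then obtain n where n: "n > 0" "\<And>y. y \<in> g ` ?S \<Longrightarrow> prefix n y \<noteq> prefix n z"
      by metis
    let ?\<alpha> = "prefix n z"
    have \<alpha>: "A.pth ?\<alpha>" "?\<alpha> \<noteq> []" using A.X_prefix[OF z] n by auto
    obtain d where d: "P (mon (A.proj_word ?\<alpha>)) d" using P_ex A.FA_proj_word[OF \<alpha>] by blast
    have diag: "B.is_diag d" using P_diag \<alpha> d by blast
    have "B.row (fa_mult b d) (x, 0) q = 0" for q
    proof (cases "B.row b (x, 0) q = 0")
      case False
      then have q: "fst q \<in> ?S" by blast
      have "B.dval d (fst q) = A.dval (mon (A.proj_word ?\<alpha>)) (g (fst q))"
        using H_dval[OF g[OF q] d A.is_diag_proj_word diag] by simp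
      also have "\<dots> = 0" using n(2)[of "g (fst q)"] q H_X(1)[OF g[OF q]] by (auto simp: A.dval_proj_word)
      finally show ?thesis using diag P_B[OF d] ab yx by (simp add: B.row_mult_diag_right)
    qed (use diag P_B[OF d] ab yx in \<open>simp add: B.row_mult_diag_right\<close>)
    then have "A.row (fa_mult a (mon (A.proj_word ?\<alpha>))) (y, 0) (z, k) = 0"
      by (rule row_zero'[OF assms(1) P_mult[OF assms(2) d]])
    then show False
      using assms(3) ab A.FA_proj_word[OF \<alpha>] yx z A.is_diag_proj_word by (simp add: A.row_mult_diag_right A.dval_proj_word del: A.row_mon)
  qed
qed

end

context lpa_pair
begin

interpretation S: lpa_pair F E R "\<lambda>b a. P a b" by (rule swap)

lemma row_support':
  assumes "H y x" "P a b" "B.row b (x, 0) (z, k) \<noteq> 0"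
  shows "\<exists>y' k'. H y' z \<and> A.row a (y, 0) (y', k') \<noteq> 0"
  using S.row_support[unfolded S_H, OF assms(1) assms(2) assms(3)] .

text \<open>Some entry in the row of the preimage of a monomial joining \<open>x\<close> to
  \<open>x'\<close> joins \<open>y\<close> to \<open>y'\<close>. Nothing is claimed about
  \<open>l\<close>; the cocycle below records its value.\<close>

lemma tail_lag_transfer:
  assumes "H y x" "H y' x'" "tail_lag x x' k"
  shows "\<exists>l. tail_lag y y' l"
proof -
  have X: "x \<in> B.X" "x' \<in> B.X" using assms H_X by auto
  obtain w where w: "mon w \<in> FA R F" "\<And>q. B.row (mon w) (x, 0) q = (if q = (x', k) then 1 else 0)"
    using B.tail_lag_mon[OF X assms(3)] by blast
  obtain a where a: "P a (mon w)" using P_ex'[OF w(1)] by blast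
  have "B.row (mon w) (x, 0) (x', k) \<noteq> 0" unfolding w(2) by simp
  then obtain y'' l where "H y'' x'" "A.row a (y, 0) (y'', l) \<noteq> 0"
    using row_support'[OF assms(1) a] by blast
  then show ?thesis using H_unique[OF assms(2)] A.row_tail_lag by blast
qed

end


section \<open>The length cocycle\<close>

lemma suffix_mult_period: "suffix m x = x \<Longrightarrow> suffix (n * m) x = x"
proof (induction n)
  case (Suc n)
  have "suffix (Suc n * m) x = suffix (n * m) (suffix m x)" by (simp only: suffix_suffix mult_Suc)
  also have "\<dots> = x" using Suc.IH[OF Suc.prems] by (simp only: Suc.prems)
  finally show ?case .
qed simp

text \<open>Equality of two tails of a periodic path moves back to the path itself, and the shifts
  fixing the path reduce modulo \<open>m\<close>.\<close>

lemma periodic_lag: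
  assumes "suffix m x = x" "m > 0" and min: "\<And>k. 0 < k \<Longrightarrow> k < m \<Longrightarrow> suffix k x \<noteq> x"
    and "tail_lag x x k"
  shows "int m dvd k"
proof -
  have *: "int m dvd int j - int i" if ij: "i \<le> j" "suffix i x = suffix j x" for i j
  proof -
    \<comment> \<open>Shifting further, until \<open>i\<close> has become the multiple
      \<open>i * m\<close> of the period, turns the left tail into \<open>x\<close>.\<close>
    have "suffix (i * m - i) (suffix i x) = suffix (i * m - i) (suffix j x)" using ij by simp
    moreover have "i \<le> i * m" using assms(2) by simp
    ultimately have "suffix (i * m) x = suffix ((j - i) + i * m) x" using ij(1) by (simp add: add.commute)
    moreover have "suffix ((j - i) + i * m) x = suffix (j - i) (suffix (i * m) x)"
      by (simp add: add.commute)
    ultimately have x: "suffix (j - i) x = x" using suffix_mult_period[OF assms(1)] by simp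
    define r where "r = (j - i) mod m"
    have "suffix r x = suffix r (suffix ((j - i) div m * m) x)"
      using suffix_mult_period[OF assms(1)] by simp
    also have "\<dots> = suffix (j - i) x" by (simp add: r_def)
    finally have "suffix r x = x" using x by simp
    moreover have "r < m" using assms(2) by (simp add: r_def)
    ultimately have "r = 0" using min by blast
    then have "m dvd j - i" by (auto simp: r_def)
    then show ?thesis using ij(1) by (metis of_nat_diff of_nat_dvd_iff)
  qed
  obtain i j where ij: "suffix i x = suffix j x" "k = int j - int i"
    using assms(4) unfolding tail_lag_def by blast
  show ?thesis
  proof (cases "i \<le> j")
    case True then show ?thesis using * ij by simp
  next
    case False
    then have "int m dvd int i - int j" using *[of j i] ij by simp
    then show ?thesis using ij(2) by (metis dvd_minus_iff minus_diff_eq)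
  qed
qed

lemma tail_lag_mult:
  assumes "tail_lag y y s"
  shows "tail_lag y y (n * s)"
proof -
  have *: "tail_lag y y (int n * t)" if "tail_lag y y t" for n t
  proof (induction n)
    case (Suc n)
    then show ?case using tail_lag_trans[OF that Suc] by (simp add: algebra_simps)
  qed (simp add: tail_lag_refl)
  show ?thesis
  proof (cases "n \<ge> 0")
    case True then show ?thesis using *[OF assms, of "nat n"] by simp
  next
    case False
    then show ?thesis using *[OF tail_lag_sym[OF assms], of "nat (-n)"] by simp
  qed
qed

section \<open>The point map and the transported path length\<close>

context lpa_pair
begin

definition hh :: "(nat \<Rightarrow> 'e2) \<Rightarrow> (nat \<Rightarrow> 'e1)" where
  "hh x = (THE y. H y x)"

lemma hh_eq: "H y x \<Longrightarrow> hh x = y"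
  unfolding hh_def using H_unique by (intro the_equality)

lemma hh: "x \<in> B.X \<Longrightarrow> H (hh x) x"
  using ex_H hh_eq by metis

lemma hh_X: "x \<in> B.X \<Longrightarrow> hh x \<in> A.X"
  using hh H_X by blast

text \<open>A Laurent polynomial \<open>g\<close> with \<open>g g* = 1\<close> is a monomial: otherwise the product of its extreme
  coefficients survives.\<close>
lemma monomial_row:
  assumes "H y x" "P a b" "A.is_diag (fa_mult a (fa_star a))" "H z x1"
    and sb: "\<And>q. B.row b (x, 0) q \<noteq> 0 \<Longrightarrow> fst q = x1"
    and nz: "B.row b (x, 0) q0 \<noteq> 0"
  shows "\<exists>c l. c \<noteq> 0 \<and> (\<forall>q. A.row a (y, 0) q = (if q = (z, l) then c else 0))"
proof -
  have aF: "a \<in> FA R E" using P_A assms(2) by blast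
  have yz: "y \<in> A.X" "z \<in> A.X" using assms H_X by auto
  have sa: "fst q = z" if q: "A.row a (y, 0) q \<noteq> 0" for q
  proof -
    obtain x' k' where "H (fst q) x'" "B.row b (x, 0) (x', k') \<noteq> 0"
      using row_support[OF assms(1,2), of "fst q" "snd q"] q by auto
    then show ?thesis using sb[of "(x', k')"] H_unique assms(4) by auto
  qed
  define g where "g l = A.row a (y, 0) (z, l)" for l
  define L where "L = {l. g l \<noteq> 0}"
  have supp: "{q. A.row a (y, 0) q \<noteq> 0} = Pair z ` L"
    using sa by (fastforce simp: L_def g_def)
  have finL: "finite L"
  proof -
    have "finite (Pair z ` L)" using A.finite_row[OF aF, of "(y,0)"] supp by simp
    then show ?thesis by (rule finite_imageD) (auto intro: inj_onI)
  qed
  have "L \<noteq> {}"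
  proof
    assume "L = {}"
    then have "A.row a (y, 0) q = 0" for q using supp by (cases q) auto
    then have "B.row b (x, 0) q0 = 0" by (rule row_zero[OF assms(1,2)])
    then show False using nz by simp
  qed
  then have M: "Max L \<in> L" "Min L \<in> L" using finL by auto
  have "Max L = Min L"
  proof (rule ccontr)
    assume ne: "Max L \<noteq> Min L"
    \<comment> \<open>The entry of \<open>a a*\<close> at lag \<open>j\<close> pairs exponents that
      differ by \<open>j\<close>; the largest possible difference is attained by one pair
      only.\<close>
    define j where "j = Max L - Min L"
    have "0 = A.row (fa_mult a (fa_star a)) (y, 0) (y, j)"
      using assms(3) yz(1) ne unfolding A.is_diag_def j_def by force
    also have "\<dots> = (\<Sum>q\<in>Pair z ` L. A.row a (y, 0) q * A.row (fa_star a) q (y, j))"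
      by (rule A.row_mult) (use supp finL aF A.FA_star in auto)
    also have "\<dots> = (\<Sum>l\<in>L. g l * A.row (fa_star a) (z, l) (y, j))"
      by (subst sum.reindex) (auto intro: inj_onI simp: g_def)
    also have "\<dots> = (\<Sum>l\<in>L. g l * cnj (g (l - j)))"
    proof (rule sum.cong)
      fix l assume "l \<in> L"
      have "A.row (fa_star a) (z, l) (y, j) = cnj (A.row a (y, j) (z, l))"
        by (rule A.row_star) (use aF yz in auto)
      also have "A.row a (y, j) (z, l) = g (l - j)" unfolding g_def by (rule A.row_base)
      finally show "g l * A.row (fa_star a) (z, l) (y, j) = g l * cnj (g (l - j))" by simp
    qed simp
    also have "\<dots> = (\<Sum>l\<in>L. if l = Max L then g (Max L) * cnj (g (Min L)) else 0)"
    proof (rule sum.cong)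
      fix l assume l: "l \<in> L"
      show "g l * cnj (g (l - j)) = (if l = Max L then g (Max L) * cnj (g (Min L)) else 0)"
      proof (cases "l = Max L")
        case False
        then have "l < Max L" using Max_ge[OF finL l] by simp
        then have "l - j < Min L" by (simp add: j_def)
        then have "l - j \<notin> L" using Min_le[OF finL, of "l - j"] by auto
        then show ?thesis using False by (simp add: L_def)
      qed (simp add: j_def)
    qed simp
    also have "\<dots> = g (Max L) * cnj (g (Min L))" using finL M by (simp add: sum.delta)
    finally show False using M by (simp add: L_def)
  qed
  then have "l = Max L" if "l \<in> L" for l
    using Max_ge[OF finL that] Min_le[OF finL that] by simp
  then have L1: "L = {Max L}" using M(1) by blast
  show ?thesis
  proof (intro exI conjI allI)
    show "g (Max L) \<noteq> 0" using M by (simp add: L_def)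
    fix q
    have "q \<in> Pair z ` L \<longleftrightarrow> q = (z, Max L)"
      by (subst L1) auto
    then have "A.row a (y, 0) q \<noteq> 0 \<longleftrightarrow> q = (z, Max L)"
      using arg_cong[OF supp, of "\<lambda>S. q \<in> S"] by (simp only: mem_Collect_eq)
    then show "A.row a (y, 0) q = (if q = (z, Max L) then g (Max L) else 0)"
      by (auto simp: g_def)
  qed
qed

definition edge_lift :: "'e2 \<Rightarrow> ('v1,'e1) fa" where
  "edge_lift f = (SOME a. P a (mon [GE f]))"

lemma edge_lift: assumes "f \<in> arcs F" shows "P (edge_lift f) (mon [GE f])"
proof -
  have "mon [GE f] \<in> FA R F" using assms by (intro B.FA_mon) auto
  from P_ex'[OF this] show ?thesis unfolding edge_lift_def by (rule someI_ex)
qed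

text \<open>For the lift \<open>a\<close> of an edge, \<open>a a*\<close> is matched with the
  projection of that edge, so it is diagonal by \<open>P_diag'\<close>, and
  \<open>monomial_row\<close> applies.\<close>

lemma edge_row:
  assumes x: "x \<in> B.X"
  shows "\<exists>c l. c \<noteq> 0 \<and> (\<forall>q. A.row (edge_lift (x 0)) (hh x, 0) q = (if q = (hh (suffix 1 x), l) then c else 0))"
proof (rule monomial_row)
  have f: "x 0 \<in> arcs F" using x by (auto simp: B.X_def)
  note a = edge_lift[OF f]
  show "H (hh x) x" "H (hh (suffix 1 x)) (suffix 1 x)" using hh x B.X_suffix by auto
  show "P (edge_lift (x 0)) (mon [GE (x 0)])" by (rule a)
  have "P (fa_mult (edge_lift (x 0)) (fa_star (edge_lift (x 0)))) (mon (B.proj_word [x 0]))"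
    using P_mult[OF a P_star[OF a]] by (simp add: fa_star_mon fa_mult_mon_mon word_star_def B.proj_word_def)
  then show "A.is_diag (fa_mult (edge_lift (x 0)) (fa_star (edge_lift (x 0))))"
    using f by (intro P_diag'[of "[x 0]"]) (auto simp: B.pth_Cons)
  show "fst q = suffix 1 x" if "B.row (mon [GE (x 0)]) (x, 0) q \<noteq> 0" for q
    using that by (auto split: if_splits)
  show "B.row (mon [GE (x 0)]) (x, 0) (suffix 1 x, -1) \<noteq> 0" by simp
qed

text \<open>Removing an edge lowers the degree, hence the minus sign; for the identity isomorphism
  the value is 1.\<close>

definition cocycle :: "(nat \<Rightarrow> 'e2) \<Rightarrow> int" where
  "cocycle x = (THE k. A.row (edge_lift (x 0)) (hh x, 0) (hh (suffix 1 x), - k) \<noteq> 0)"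

lemma edge_row_cocycle:
  assumes x: "x \<in> B.X"
  obtains c where "c \<noteq> 0" "\<And>q. A.row (edge_lift (x 0)) (hh x, 0) q = (if q = (hh (suffix 1 x), - cocycle x) then c else 0)"
proof -
  obtain c l where cl: "c \<noteq> 0" "\<And>q. A.row (edge_lift (x 0)) (hh x, 0) q = (if q = (hh (suffix 1 x), l) then c else 0)"
    using edge_row[OF x] by blast
  have "cocycle x = - l"
    unfolding cocycle_def by (rule the_equality) (use cl in \<open>auto split: if_splits\<close>)
  then show thesis using that[of c] cl by simp
qed

definition cocycle_sum :: "nat \<Rightarrow> (nat \<Rightarrow> 'e2) \<Rightarrow> int" where
  "cocycle_sum m x = (\<Sum>i<m. cocycle (suffix i x))"

lemma cocycle_sum_add: "cocycle_sum (m + n) x = cocycle_sum m x + cocycle_sum n (suffix m x)"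
  by (induction n) (auto simp: cocycle_sum_def simp del: suffix_nth)

lemma cocycle_sum_mult: "suffix m x = x \<Longrightarrow> cocycle_sum (n * m) x = int n * cocycle_sum m x"
proof (induction n)
  case (Suc n)
  have "cocycle_sum (Suc n * m) x = cocycle_sum m x + cocycle_sum (n * m) x"
    using cocycle_sum_add[of m "n * m" x] by (simp only: Suc.prems mult_Suc)
  then show ?case using Suc.IH[OF Suc.prems] by (simp add: algebra_simps)
qed (simp add: cocycle_sum_def)

text \<open>Rows with a single entry compose: degrees add up to the cocycle sum, and the product of
  nonzero complex coefficients is nonzero.\<close>

lemma path_row:
  assumes x: "x \<in> B.X" and "m > 0"
  shows "\<exists>a c. P a (mon (B.ge (prefix m x))) \<and> c \<noteq> 0 \<and>
     (\<forall>q. A.row a (hh x, 0) q = (if q = (hh (suffix m x), - cocycle_sum m x) then c else 0))"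
  using assms(2)
proof (induction m rule: nat_induct_non_zero)
  case 1
  have f: "x 0 \<in> arcs F" using x by (auto simp: B.X_def)
  obtain c where "c \<noteq> 0" "\<And>q. A.row (edge_lift (x 0)) (hh x, 0) q = (if q = (hh (suffix 1 x), - cocycle x) then c else 0)"
    using edge_row_cocycle[OF x] by blast
  then show ?case using edge_lift[OF f]
    by (intro exI[of _ "edge_lift (x 0)"] exI[of _ c]) (simp add: cocycle_sum_def del: suffix_nth)
next
  case (Suc m)
  then obtain a c where a: "P a (mon (B.ge (prefix m x)))" "c \<noteq> 0"
     "\<And>q. A.row a (hh x, 0) q = (if q = (hh (suffix m x), - cocycle_sum m x) then c else 0)" by blast
  have xm: "suffix m x \<in> B.X" by (rule B.X_suffix[OF x])
  have f: "x m \<in> arcs F" using x by (auto simp: B.X_def)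
  obtain d where d: "d \<noteq> 0"
     "\<And>q. A.row (edge_lift (suffix m x 0)) (hh (suffix m x), 0) q = (if q = (hh (suffix 1 (suffix m x)), - cocycle (suffix m x)) then d else 0)"
    using edge_row_cocycle[OF xm] by blast
  have row: "A.row (fa_mult a (edge_lift (x m))) (hh x, 0) q = (if q = (hh (suffix (Suc m) x), - cocycle_sum (Suc m) x) then c * d else 0)" for q
  proof -
    obtain w l where q: "q = (w, l)" by (cases q)
    have "A.row (fa_mult a (edge_lift (x m))) (hh x, 0) q = c * A.row (edge_lift (x m)) (hh (suffix m x), - cocycle_sum m x) q"
      by (rule A.row_mult_single) (use P_A a edge_lift[OF f] in auto)
    also have "A.row (edge_lift (x m)) (hh (suffix m x), - cocycle_sum m x) q = A.row (edge_lift (suffix m x 0)) (hh (suffix m x), 0) (w, l + cocycle_sum m x)"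
      unfolding q by (subst A.row_base) simp
    also have "\<dots> = (if q = (hh (suffix (Suc m) x), - cocycle_sum (Suc m) x) then d else 0)"
      unfolding d(2) q by (auto simp: cocycle_sum_def)
    finally show ?thesis by simp
  qed
  have "P (fa_mult a (edge_lift (x m))) (mon (B.ge (prefix (Suc m) x)))"
    using P_mult[OF a(1) edge_lift[OF f]] by (simp add: fa_mult_mon_mon)
  moreover have "c * d \<noteq> 0" using a(2) d(1) by simp
  ultimately show ?case using row by blast
qed

text \<open>Test elements for each isotropy degree at \<open>x\<close>: a basis vector over
  \<open>F\<close>, supported in multiples of the cycle sum over \<open>E\<close>. Negative degrees
  come from powers of the cycle, degree 0 from an edge projection, positive degrees from
  stars.\<close>

lemma isotropy_words:
  assumes x: "x \<in> B.X" and m: "m > 0" "suffix m x = x"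
  shows "\<exists>a b. P a b \<and> (\<forall>r. B.row b (x, 0) r = (if r = (x, int m * j) then 1 else 0)) \<and>
     (\<forall>r. A.row a (hh x, 0) r \<noteq> 0 \<longrightarrow> fst r = hh x \<and> cocycle_sum m x dvd snd r)"
proof -
  have neg: "\<exists>a w. B.gens w \<and> w \<noteq> [] \<and> P a (mon w) \<and> B.ract w (x, 0) = Some (x, - int (m * n)) \<and>
     (\<forall>r. A.row a (hh x, 0) r \<noteq> 0 \<longrightarrow> r = (hh x, - (int n * cocycle_sum m x)))" if n: "n > 0" for n
  proof -
    have per: "suffix (n * m) x = x" by (rule suffix_mult_period[OF m(2)])
    obtain a c where "P a (mon (B.ge (prefix (n * m) x)))" "c \<noteq> 0"
      "\<And>q. A.row a (hh x, 0) q = (if q = (hh (suffix (n * m) x), - cocycle_sum (n * m) x) then c else 0)"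
      using path_row[OF x, of "n * m"] n m by auto
    moreover have "B.ract (B.ge (prefix (n * m) x)) (x, 0) = Some (x, - int (m * n))"
      using per by (simp add: B.ract_ge mult.commute)
    moreover have "B.gens (B.ge (prefix (n * m) x))" using B.gens_pth[OF B.X_prefix[OF x]] by blast
    moreover have "B.ge (prefix (n * m) x) \<noteq> []" using n m by simp
    ultimately show ?thesis using per cocycle_sum_mult[OF m(2)]
      by (intro exI[of _ a] exI[of _ "B.ge (prefix (n * m) x)"]) auto
  qed
  consider "j = 0" | n where "n > 0" "j = - int n" | n where "n > 0" "j = int n"
    by (metis int_cases3 of_nat_0_less_iff)
  then show ?thesis
  proof cases
    case 1
    have f: "B.pth [x 0]" using x by (auto simp: B.X_def B.pth_Cons)
    obtain a where a: "P a (mon (B.proj_word [x 0]))" using P_ex'[OF B.FA_proj_word[OF f]] by auto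
    have "A.is_diag a" using P_diag'[OF f _ a] by simp
    then have "\<forall>r. A.row a (hh x, 0) r \<noteq> 0 \<longrightarrow> fst r = hh x \<and> cocycle_sum m x dvd snd r"
      using hh_X[OF x] unfolding A.is_diag_def by fastforce
    moreover have "B.row (mon (B.proj_word [x 0])) (x, 0) r = (if r = (x, 0) then 1 else 0)" for r
      using x by (simp add: B.ract_proj_word)
    moreover have "(x, int m * j) = (x, 0)" using 1 by simp
    ultimately show ?thesis using a by metis
  next
    case 2
    obtain a w where aw: "P a (mon w)" "B.ract w (x, 0) = Some (x, - int (m * n))"
       "\<And>r. A.row a (hh x, 0) r \<noteq> 0 \<Longrightarrow> r = (hh x, - (int n * cocycle_sum m x))"
      using neg[OF 2(1)] by blast
    then have "(\<forall>r. B.row (mon w) (x, 0) r = (if r = (x, int m * j) then 1 else 0)) \<and>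
     (\<forall>r. A.row a (hh x, 0) r \<noteq> 0 \<longrightarrow> fst r = hh x \<and> cocycle_sum m x dvd snd r)"
      using 2(2) by fastforce
    then show ?thesis using aw(1) by blast
  next
    case 3
    obtain a w where aw: "B.gens w" "w \<noteq> []" "P a (mon w)" "B.ract w (x, 0) = Some (x, - int (m * n))"
       "\<And>r. A.row a (hh x, 0) r \<noteq> 0 \<Longrightarrow> r = (hh x, - (int n * cocycle_sum m x))"
      using neg[OF 3(1)] by blast
    have st: "P (fa_star a) (mon (word_star w))" using P_star[OF aw(3)] by (simp add: fa_star_mon)
    have "B.ract (word_star w) (x, - int (m * n)) = Some (x, 0)"
      using B.ract_star_imp[of "(x,0)" w] aw x by simp
    then have ract: "B.ract (word_star w) (x, 0) = Some (x, int m * j)"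
      using B.ract_shift[of "word_star w" x "- int (m * n)" "int (m * n)"] 3 by simp
    \<comment> \<open>\<open>row_support\<close> locates the target of the star; after that,
      \<open>row_star\<close> and translation turn its entry into the conjugate of an entry of
      \<open>a\<close>.\<close>
    have "fst r = hh x \<and> cocycle_sum m x dvd snd r" if r: "A.row (fa_star a) (hh x, 0) r \<noteq> 0" for r
    proof -
      obtain z l where zl: "r = (z, l)" by (cases r)
      obtain x' k' where "H z x'" "B.row (mon (word_star w)) (x, 0) (x', k') \<noteq> 0"
        using row_support[OF hh[OF x] st, of z l] r zl by blast
      then have z: "z = hh x" using ract hh_eq by (auto split: if_splits)
      have "A.row (fa_star a) (hh x, 0) r = cnj (A.row a (hh x, l) (hh x, 0))"
        using A.row_star[of a "(hh x, 0)" r] P_A[OF aw(3)] hh_X[OF x] zl z by simp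
      also have "A.row a (hh x, l) (hh x, 0) = A.row a (hh x, 0) (hh x, - l)"
        by (subst A.row_base) simp
      finally have "A.row a (hh x, 0) (hh x, - l) \<noteq> 0" using r by simp
      then have "- l = - (int n * cocycle_sum m x)" using aw(5) by blast
      then show ?thesis using z zl by simp
    qed
    moreover have "B.row (mon (word_star w)) (x, 0) r = (if r = (x, int m * j) then 1 else 0)" for r
      using ract by auto
    ultimately show ?thesis using st by blast
  qed
qed

text \<open>The partner of a monomial realising the lag \<open>k\<close> has a row at
  \<open>x\<close> supported in isotropy degrees. A combination of the elements of
  \<open>isotropy_words\<close> has the same row there, so by \<open>row_zero'\<close> its preimage
  has the same row at \<open>hh x\<close>, with entry 1 at lag \<open>k\<close>. Some summand is
  then nonzero at that lag.\<close>

lemma lag_dvd: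
  assumes x: "x \<in> B.X" and m: "m > 0" "suffix m x = x"
    and min: "\<And>k. 0 < k \<Longrightarrow> k < m \<Longrightarrow> suffix k x \<noteq> x"
    and lag: "tail_lag (hh x) (hh x) k"
  shows "cocycle_sum m x dvd k"
proof -
  let ?y = "hh x"
  note y = hh_X[OF x] and H = hh[OF x]
  obtain w where w: "mon w \<in> FA R E" "\<And>q. A.row (mon w) (?y, 0) q = (if q = (?y, k) then 1 else 0)"
    using A.tail_lag_mon[OF y y lag] by blast
  obtain b where b: "P (mon w) b" using P_ex[OF w(1)] by blast
  define J where "J = {q. B.row b (x, 0) q \<noteq> 0}"
  have finJ: "finite J" unfolding J_def by (rule B.finite_row[OF P_B[OF b]])
  have J: "\<exists>j. q = (x, int m * j)" if q: "q \<in> J" for q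
  proof -
    obtain x' l where ql: "q = (x', l)" by (cases q)
    have nz: "B.row b (x, 0) (x', l) \<noteq> 0" using q ql by (simp add: J_def)
    obtain y' k' where "H y' x'" "A.row (mon w) (?y, 0) (y', k') \<noteq> 0"
      using row_support'[OF H b nz] by blast
    then have "x' = x" using H H_unique' unfolding w(2) by (auto split: if_splits)
    moreover have "int m dvd l"
      using periodic_lag[OF m(2,1) min] B.row_tail_lag[OF nz] \<open>x' = x\<close> by blast
    ultimately show ?thesis using ql by (auto elim: dvdE)
  qed
  have "\<exists>a b. P a b \<and> (\<forall>r. B.row b (x, 0) r = (if r = q then 1 else 0)) \<and>
     (\<forall>r. A.row a (hh x, 0) r \<noteq> 0 \<longrightarrow> fst r = hh x \<and> cocycle_sum m x dvd snd r)" if "q \<in> J" for q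
    using J[OF that] isotropy_words[OF x m] by metis
  then obtain aq bq where aq: "\<And>q. q \<in> J \<Longrightarrow> P (aq q) (bq q)"
     "\<And>q r. q \<in> J \<Longrightarrow> B.row (bq q) (x, 0) r = (if r = q then 1 else 0)"
     "\<And>q r. q \<in> J \<Longrightarrow> A.row (aq q) (hh x, 0) r \<noteq> 0 \<Longrightarrow> cocycle_sum m x dvd snd r"
    by metis
  define c where "c q = B.row b (x, 0) q" for q
  have cR: "c q \<in> R" for q unfolding c_def by (rule B.row_R[OF P_B[OF b]])
  have smF: "fa_smult (c q) (aq q) \<in> FA R E" "fa_smult (c q) (bq q) \<in> FA R F" if "q \<in> J" for q
    using P_dom[OF P_smult[OF aq(1)[OF that] cR[of q]]] by auto
  define a' where "a' = (\<lambda>z. \<Sum>q\<in>J. fa_smult (c q) (aq q) z)"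
  define b' where "b' = (\<lambda>z. \<Sum>q\<in>J. fa_smult (c q) (bq q) z)"
  have P': "P a' b'" unfolding a'_def b'_def by (rule P_sum) (use aq cR P_smult in auto)
  have rb: "B.row b' (x, 0) r = c r" for r
  proof -
    have "B.row b' (x, 0) r = (\<Sum>q\<in>J. c q * B.row (bq q) (x, 0) r)"
      unfolding b'_def B.row_smult[symmetric]
      by (rule B.row_sum) (use finJ smF in auto)
    also have "\<dots> = (\<Sum>q\<in>J. if r = q then c r else 0)"
      by (rule sum.cong) (auto simp: aq(2))
    also have "\<dots> = c r" using finJ by (auto simp: sum.delta' J_def c_def)
    finally show ?thesis .
  qed
  have "B.row (fa_diff b b') (x, 0) r = 0" for r
    using rb by (simp add: B.row_diff P_B[OF b] P_B[OF P'] c_def)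
  then have "A.row (fa_diff (mon w) a') (?y, 0) (?y, k) = 0"
    by (rule row_zero'[OF H P_diff[OF b P']])
  then have "A.row a' (?y, 0) (?y, k) = 1"
    using A.row_diff[OF w(1) P_A[OF P']] w(2) by simp
  moreover have "A.row a' (?y, 0) (?y, k) = (\<Sum>q\<in>J. c q * A.row (aq q) (?y, 0) (?y, k))"
    unfolding a'_def A.row_smult[symmetric]
    by (rule A.row_sum) (use finJ smF in auto)
  ultimately obtain q where "q \<in> J" "A.row (aq q) (?y, 0) (?y, k) \<noteq> 0"
    by (metis (no_types, lifting) mult_zero_right sum.neutral zero_neq_one)
  then show ?thesis using aq(3)[of q "(?y, k)"] by simp
qed

text \<open>If the cycle were mapped to a germ that does not expand, a cylinder around \<open>hh x\<close> would be mapped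
  into itself by the shift by one period, and so all its points would be \<open>hh x\<close>.\<close>
lemma cocycle_sum_pos:
  assumes x: "x \<in> B.X" and m: "m > 0" "suffix m x = x"
  shows "cocycle_sum m x > 0"
proof (rule ccontr)
  assume "\<not> cocycle_sum m x > 0"
  then have S: "cocycle_sum m x \<le> 0" by simp
  let ?y = "hh x"
  note y = hh_X[OF x] and H = hh[OF x]
  obtain a c where a: "P a (mon (B.ge (prefix m x)))" "c \<noteq> 0"
     "\<And>q. A.row a (?y, 0) q = (if q = (?y, - cocycle_sum m x) then c else 0)"
    using path_row[OF x m(1)] unfolding m(2) by blast
  have aF: "a \<in> FA R E" by (rule P_A[OF a(1)])
  have cR: "c \<in> R" using A.row_R[OF aF, of "(?y, 0)" "(?y, - cocycle_sum m x)"] a(3) by simp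
  have "tail_lag ?y ?y (- cocycle_sum m x)"
    by (rule A.row_tail_lag[of a]) (use a in simp)
  then obtain i0 j0 where ij0: "suffix i0 ?y = suffix j0 ?y" "- cocycle_sum m x = int j0 - int i0"
    unfolding tail_lag_def by blast
  \<comment> \<open>\<open>Suc\<close> makes the word below nonempty. Since the cycle sum is at most
    0, \<open>i \<le> j\<close>: the word removes no more edges than it inserts.\<close>
  define i j where "i = Suc i0" and "j = Suc j0"
  have ij: "suffix i ?y = suffix j ?y" "- cocycle_sum m x = int j - int i" "i \<le> j" "i > 0"
    using arg_cong[OF ij0(1), of "suffix 1"] ij0(2) S by (auto simp: i_def j_def)
  define w where "w = A.ge (prefix i ?y) @ A.gs (prefix j ?y)"
  have w: "A.gens w" "w \<noteq> []" "A.ract w (?y, 0) = Some (?y, - cocycle_sum m x)"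
    using A.tail_lag_word[OF y y ij(1,4)] ij(2) by (auto simp: w_def)
  have wF: "mon w \<in> FA R E" by (rule A.FA_mon[OF w(1,2)])
  \<comment> \<open>\<open>a\<close> and the multiple \<open>c\<close> of the word \<open>w\<close>
    have equal rows at \<open>?y\<close>, so they agree on a whole cylinder; there \<open>a\<close>
    acts by the explicit word.\<close>
  define d where "d = fa_diff a (fa_smult c (mon w))"
  have dF: "d \<in> FA R E" unfolding d_def by (intro A.FA_diff aF A.FA_smult wF cR)
  have drow: "A.row d p q = A.row a p q - c * A.row (mon w) p q" for p q
    unfolding d_def by (simp add: A.row_diff aF A.FA_smult wF cR A.row_smult del: A.row_mon)
  define n where "n = max (A.word_bound d) (Suc j)"
  define \<alpha> where "\<alpha> = prefix n ?y"
  have n: "n > j" "A.word_bound d \<le> n" by (auto simp: n_def)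
  have \<alpha>: "A.pth \<alpha>" "\<alpha> \<noteq> []" "length \<alpha> = n" using A.X_prefix[OF y] n by (auto simp: \<alpha>_def)
  have I: "fa_mult (mon (A.proj_word \<alpha>)) d \<in> LPA_ideal R E"
    unfolding \<alpha>_def by (rule A.germ[OF y dF n(2)]) (use drow a(3) w(3) in auto)
  \<comment> \<open>The new path \<open>v1\<close> has the first \<open>j\<close> edges of
    \<open>?y\<close> in place of the first \<open>i\<close> edges of \<open>v\<close>. As
    \<open>i \<le> j\<close>, its first \<open>n\<close> edges use only the first \<open>n\<close>
    edges of \<open>v\<close>, so it lies in the cylinder again.\<close>
  have step: "\<exists>v1. A.row a (v, 0) (v1, - cocycle_sum m x) \<noteq> 0 \<and> prefix n v1 = \<alpha>"
    if v: "v \<in> A.X" "prefix n v = \<alpha>" for v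
  proof -
    have vy: "v k = ?y k" if "k < n" for k
      using arg_cong[OF v(2), of "\<lambda>l. l ! k"] that by (simp add: \<alpha>_def)
    have yy: "?y (i + k) = ?y (j + k)" for k using fun_cong[OF ij(1), of k] by simp
    define v1 where "v1 = prefix j ?y \<frown> suffix i v"
    have "head E (last (prefix j ?y)) = tail E (?y j)"
      using y by (auto simp: j_def A.X_def)
    also have "?y j = v i" using yy[of 0] vy[of i] ij n by simp
    finally have v1X: "v1 \<in> A.X"
      unfolding v1_def by (intro A.X_conc A.X_prefix y A.X_suffix v) simp
    have "prefix i v = prefix i ?y" by (rule prefix_mono_eq[where n=n]) (use v(2) n ij(3) in \<open>auto simp: \<alpha>_def\<close>)
    then have "A.ract w (v, 0) = Some (v1, int j - int i)"
      using A.ract_gs[of "prefix j ?y" "suffix i v"] v1X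
      by (simp add: w_def A.ract_append A.ract_ge v1_def)
    moreover have "A.row d (v, 0) q = 0" for q
    proof -
      have "0 = A.row (fa_mult (mon (A.proj_word \<alpha>)) d) (v, 0) q" using A.ideal_row[OF I] v by simp
      also have "\<dots> = A.row d (v, 0) q"
        using v \<alpha> dF by (simp add: A.row_mult_diag_left A.is_diag_proj_word A.FA_proj_word A.dval_proj_word)
      finally show ?thesis by simp
    qed
    ultimately have "A.row a (v, 0) (v1, - cocycle_sum m x) \<noteq> 0"
      using drow[of "(v, 0)" "(v1, - cocycle_sum m x)"] a(2) ij(2) by simp
    moreover have "prefix n v1 = \<alpha>"
    proof (rule nth_equalityI)
      fix k assume "k < length (prefix n v1)"
      then have k: "k < n" by simp
      show "prefix n v1 ! k = \<alpha> ! k"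
      proof (cases "k < j")
        case True
        then show ?thesis using k by (simp add: v1_def \<alpha>_def)
      next
        case False
        then have "v1 k = v (i + (k - j))" by (simp add: v1_def)
        also have "\<dots> = ?y (i + (k - j))" by (rule vy) (use False k ij(3) in linarith)
        also have "\<dots> = ?y k" using yy[of "k - j"] False by simp
        finally show ?thesis using k by (simp add: \<alpha>_def)
      qed
    qed (use \<alpha> in simp)
    ultimately show ?thesis by blast
  qed
  \<comment> \<open>Over \<open>F\<close> the same element is the path \<open>prefix m x\<close>,
    which acts only on paths starting with it and deletes it.\<close>
  have ret: "prefix m x' = prefix m x \<and> prefix n (hh (suffix m x')) = \<alpha>"
    if x': "x' \<in> B.X" "prefix n (hh x') = \<alpha>" for x'
  proof -
    obtain v1 where v1: "A.row a (hh x', 0) (v1, - cocycle_sum m x) \<noteq> 0" "prefix n v1 = \<alpha>"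
      using step[OF hh_X[OF x'(1)] x'(2)] by blast
    obtain x1 k' where x1: "H v1 x1" "B.row (mon (B.ge (prefix m x))) (x', 0) (x1, k') \<noteq> 0"
      using row_support[OF hh[OF x'(1)] a(1) v1(1)] by blast
    then have "prefix m x' = prefix m x" "x1 = suffix m x'"
      by (auto simp: B.ract_ge split: if_splits)
    then show ?thesis using v1(2) hh_eq[OF x1(1)] by simp
  qed
  \<comment> \<open>After the deletion the partner is still in the cylinder, so every further block
    of \<open>m\<close> edges of \<open>x'\<close> is again the cycle.\<close>
  have const: "x' k = x k" if "x' \<in> B.X" "prefix n (hh x') = \<alpha>" for x' k
    using that
  proof (induction k arbitrary: x' rule: less_induct)
    case (less k)
    have b: "prefix m x' = prefix m x" "prefix n (hh (suffix m x')) = \<alpha>" using ret[OF less.prems] by auto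
    show ?case
    proof (cases "k < m")
      case True
      then show ?thesis using arg_cong[OF b(1), of "\<lambda>l. l ! k"] by simp
    next
      case False
      have "x' k = suffix m x' (k - m)" using False by simp
      also have "\<dots> = x (k - m)"
        using False m(1) by (intro less.IH[of "k - m" "suffix m x'"] B.X_suffix less.prems(1) b(2)) simp
      also have "\<dots> = x k" using fun_cong[OF m(2), of "k - m"] False by simp
      finally show ?thesis .
    qed
  qed
  obtain z z' where z: "z \<noteq> z'" "\<alpha> \<frown> z \<in> A.X" "\<alpha> \<frown> z' \<in> A.X"
    using A.two_extensions[OF \<alpha>(1,2)] by blast
  have "\<alpha> \<frown> u = ?y" if u: "\<alpha> \<frown> u \<in> A.X" for u
  proof -
    obtain x' where x': "H (\<alpha> \<frown> u) x'" using ex_H'[OF u] by blast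
    have "x' = x" by (rule ext, rule const) (use x' H_X hh_eq[OF x'] \<alpha>(3) in auto)
    then show ?thesis using hh_eq[OF x'] by simp
  qed
  from this[OF z(2)] this[OF z(3)] have "\<alpha> \<frown> z = \<alpha> \<frown> z'" by (rule trans[OF _ sym])
  then show False using z(1) by simp
qed

lemma lag_iff:
  assumes x: "x \<in> B.X" and m: "m > 0" "suffix m x = x"
    and min: "\<And>k. 0 < k \<Longrightarrow> k < m \<Longrightarrow> suffix k x \<noteq> x"
  shows "tail_lag (hh x) (hh x) k \<longleftrightarrow> cocycle_sum m x dvd k"
proof
  assume "cocycle_sum m x dvd k"
  then obtain n where k: "k = cocycle_sum m x * n" by (elim dvdE)
  obtain a c where "c \<noteq> 0" "\<And>q. A.row a (hh x, 0) q = (if q = (hh x, - cocycle_sum m x) then c else 0)"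
    using path_row[OF x m(1)] unfolding m(2) by blast
  then have "tail_lag (hh x) (hh x) (- cocycle_sum m x)" by (intro A.row_tail_lag[of a]) simp
  from tail_lag_mult[OF this, of "- n"] show "tail_lag (hh x) (hh x) k" using k by (simp add: mult.commute)
qed (rule lag_dvd[OF x m min])

text \<open>The first \<open>N\<close> edges of \<open>hh x\<close> are locally constant in
  \<open>x\<close>: a cylinder projection of \<open>E\<close> is matched with a diagonal element,
  whose values are germ coefficients. On the cylinder so determined the lift of \<open>x 0\<close>
  has constant germ coefficients, hence constant lag.\<close>

lemma cocycle_local: "\<exists>M. \<forall>x\<in>B.X. \<forall>x'\<in>B.X. prefix M x = prefix M x' \<longrightarrow> cocycle x = cocycle x'"
proof -
  \<comment> \<open>The sum merely dominates all the word bounds; \<open>Suc\<close> makes the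
    prefixes nonempty. The same holds for \<open>M\<close> below.\<close>
  define N where "N = Suc (\<Sum>f\<in>arcs F. A.word_bound (edge_lift f))"
  have N: "A.word_bound (edge_lift f) \<le> N" if "f \<in> arcs F" for f
    using member_le_sum[of f "arcs F" "\<lambda>f. A.word_bound (edge_lift f)"] that by (simp add: N_def)
  define bb where "bb \<alpha> = (SOME b. P (mon (A.proj_word \<alpha>)) b)" for \<alpha>
  have bb: "P (mon (A.proj_word \<alpha>)) (bb \<alpha>)" "B.is_diag (bb \<alpha>)" if "\<alpha> \<in> A.paths N" for \<alpha>
  proof -
    have \<alpha>: "A.pth \<alpha>" "\<alpha> \<noteq> []" using that by (auto simp: A.paths_def N_def)
    show "P (mon (A.proj_word \<alpha>)) (bb \<alpha>)" unfolding bb_def using P_ex[OF A.FA_proj_word[OF \<alpha>]] by (rule someI_ex)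
    then show "B.is_diag (bb \<alpha>)" by (rule P_diag[OF \<alpha>])
  qed
  define M where "M = Suc (\<Sum>\<alpha>\<in>A.paths N. B.word_bound (bb \<alpha>))"
  have M: "B.word_bound (bb \<alpha>) \<le> M" if "\<alpha> \<in> A.paths N" for \<alpha>
    using member_le_sum[of \<alpha> "A.paths N" "\<lambda>\<alpha>. B.word_bound (bb \<alpha>)"] that by (simp add: M_def)
  have "cocycle x = cocycle x'" if x: "x \<in> B.X" and x': "x' \<in> B.X" and eq: "prefix M x = prefix M x'" for x x'
  proof -
    define \<alpha> where "\<alpha> = prefix N (hh x)"
    have \<alpha>: "\<alpha> \<in> A.paths N" "length \<alpha> = N" using A.X_prefix[OF hh_X[OF x]] by (auto simp: \<alpha>_def A.paths_def)
    have dv: "B.dval (bb \<alpha>) z = (if prefix N (hh z) = \<alpha> then 1 else 0)" if "z \<in> B.X" for z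
      using H_dval[OF hh[OF that] bb(1)[OF \<alpha>(1)] A.is_diag_proj_word bb(2)[OF \<alpha>(1)]] hh_X[OF that] \<alpha>(2)
      by (simp add: A.dval_proj_word)
    have germ_coeff: "B.dval (bb \<alpha>) z = B.germ_coeff (bb \<alpha>) (prefix M z) (prefix M z)" for z
      using B.row_germ_coeff[OF P_B[OF bb(1)[OF \<alpha>(1)]], of "prefix M z" "suffix M z" 0 "prefix M z"] M[OF \<alpha>(1)]
      by (simp add: B.dval_def)
    have "B.dval (bb \<alpha>) x' = B.dval (bb \<alpha>) x" unfolding germ_coeff eq ..
    also have "\<dots> = 1" using dv[OF x] by (simp add: \<alpha>_def)
    finally have px': "prefix N (hh x') = \<alpha>" using dv[OF x'] by (auto split: if_splits)
    have x0: "x 0 = x' 0" using prefix_mono_eq[OF eq, of 1] by (simp add: M_def)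
    have f: "x 0 \<in> arcs F" using x by (auto simp: B.X_def)
    have aF: "edge_lift (x 0) \<in> FA R E" by (rule P_A[OF edge_lift[OF f]])
    have wl: "A.word_bound (edge_lift (x 0)) \<le> length \<alpha>" using N[OF f] \<alpha>(2) by simp
    obtain c where c: "c \<noteq> 0" "\<And>q. A.row (edge_lift (x 0)) (hh x, 0) q = (if q = (hh (suffix 1 x), - cocycle x) then c else 0)"
      using edge_row_cocycle[OF x] by blast
    obtain c' where c': "c' \<noteq> 0" "\<And>q. A.row (edge_lift (x 0)) (hh x', 0) q = (if q = (hh (suffix 1 x'), - cocycle x') then c' else 0)"
      using edge_row_cocycle[OF x'] unfolding x0[symmetric] by blast
    have hx: "hh x = \<alpha> \<frown> suffix N (hh x)" by (simp add: \<alpha>_def)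
    have hx': "hh x' = \<alpha> \<frown> suffix N (hh x')" unfolding px'[symmetric] by simp
    have "A.row (edge_lift (x 0)) (\<alpha> \<frown> suffix N (hh x), 0) (hh (suffix 1 x), - cocycle x) \<noteq> 0"
      using c hx by simp
    then obtain \<beta> where \<beta>: "- cocycle x = int (length \<beta>) - int (length \<alpha>)" "A.germ_coeff (edge_lift (x 0)) \<alpha> \<beta> \<noteq> 0"
      by (rule A.row_germ_coeff_supp[OF aF wl]) auto
    \<comment> \<open>The germ seen at \<open>hh x\<close> also gives an entry in the row at
      \<open>hh x'\<close>, and that row has only one entry.\<close>
    have "A.row (edge_lift (x 0)) (hh x', 0) (\<beta> \<frown> suffix N (hh x'), - cocycle x) \<noteq> 0"
      using A.row_germ_coeff[OF aF wl, of "suffix N (hh x')" 0 \<beta>] \<beta> hx' by simp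
    then show ?thesis unfolding c'(2) by (auto split: if_splits)
  qed
  then show ?thesis by blast
qed

end


section \<open>Zeta functions\<close>

definition min_period :: "(nat \<Rightarrow> 'e) \<Rightarrow> nat" where
  "min_period x = (LEAST m. m > 0 \<and> suffix m x = x)"

lemma min_period:
  assumes "m > 0" "suffix m x = x"
  shows "min_period x > 0" "suffix (min_period x) x = x" "\<And>k. 0 < k \<Longrightarrow> k < min_period x \<Longrightarrow> suffix k x \<noteq> x"
  using LeastI[of "\<lambda>m. m > 0 \<and> suffix m x = x" m] not_less_Least[of _ "\<lambda>m. m > 0 \<and> suffix m x = x"] assms
  unfolding min_period_def by blast+

lemma min_period_dvd:
  assumes "m > 0" "suffix m x = x"
  shows "suffix k x = x \<longleftrightarrow> min_period x dvd k"
proof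
  note mp = min_period[OF assms]
  {
    assume "suffix k x = x"
    then have "tail_lag x x (int k)"
      unfolding tail_lag_def by (intro exI[of _ 0] exI[of _ k]) simp
    from periodic_lag[OF mp(2,1,3) this] show "min_period x dvd k" by simp
  next
    assume "min_period x dvd k"
    then obtain n where "k = n * min_period x" by (metis dvd_def mult.commute)
    then show "suffix k x = x" using suffix_mult_period[OF mp(2)] by simp
  }
qed

lemma suffix_mod_period:
  assumes "suffix q y = y"
  shows "suffix n y = suffix (n mod q) y"
proof -
  have "suffix n y = suffix (n mod q) (suffix (n div q * q) y)" by simp
  then show ?thesis by (simp only: suffix_mult_period[OF assms])
qed

lemma lag_conj:
  assumes "tail_lag z y l"
  shows "tail_lag y y k \<longleftrightarrow> tail_lag z z k"
proof
  assume "tail_lag y y k"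
  from tail_lag_trans[OF tail_lag_trans[OF assms this] tail_lag_sym[OF assms]] show "tail_lag z z k" by simp
next
  assume "tail_lag z z k"
  from tail_lag_trans[OF tail_lag_trans[OF tail_lag_sym[OF assms] this] assms] show "tail_lag y y k" by simp
qed

text \<open>The series of \<open>- ln (1 - w)\<close> for \<open>0 \<le> w < 1\<close>, taken in
  \<open>ennreal\<close> so that it can be rearranged without regard to convergence.\<close>

definition log_series :: "real \<Rightarrow> ennreal" where
  "log_series w = (\<Sum>n. ennreal (w ^ Suc n / real (Suc n)))"

section \<open>Periodic points of one graph\<close>

context lpa
begin

definition Per :: "(nat \<Rightarrow> 'e) set" where
  "Per = {x\<in>X. \<exists>m>0. suffix m x = x}"

lemma Per_X: "x \<in> Per \<Longrightarrow> x \<in> X"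
  and Per_min_period: "x \<in> Per \<Longrightarrow> min_period x > 0" "x \<in> Per \<Longrightarrow> suffix (min_period x) x = x"
    "x \<in> Per \<Longrightarrow> 0 < k \<Longrightarrow> k < min_period x \<Longrightarrow> suffix k x \<noteq> x"
  using min_period unfolding Per_def by blast+

text \<open>\<open>z\<close> need not be periodic. Its isotropy makes it eventually periodic, and
  the periodic points tail equivalent to it are the \<open>q\<close> shifts of its periodic part
  \<open>y0\<close>.\<close>

lemma tail_class:
  assumes z: "z \<in> X" and q: "q > 0" and lag: "\<And>k. tail_lag z z k \<longleftrightarrow> int q dvd k"
  defines "K \<equiv> {y\<in>Per. \<exists>k. tail_lag z y k}"
  shows "finite K" "card K = q" "\<And>y. y \<in> K \<Longrightarrow> min_period y = q"
proof -
  have minq: "min_period y = q" if yK: "y \<in> K" for y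
  proof -
    obtain l where y: "y \<in> Per" "tail_lag z y l" using yK unfolding K_def by blast
    note lagy = lag_conj[OF y(2), unfolded lag]
    have "int (min_period y) dvd int q"
      by (rule periodic_lag[OF Per_min_period(2)[OF y(1)] Per_min_period(1)[OF y(1)] Per_min_period(3)[OF y(1)]]) (simp_all add: lagy)
    moreover have "tail_lag y y (int (min_period y))"
      unfolding tail_lag_def by (intro exI[of _ 0] exI[of _ "min_period y"]) (simp add: Per_min_period(2)[OF y(1)])
    then have "int q dvd int (min_period y)" unfolding lagy .
    ultimately show ?thesis by (simp add: dvd_antisym)
  qed
  have "tail_lag z z (int q)" by (simp add: lag)
  then obtain i j where ij: "suffix i z = suffix j z" "int q = int j - int i"
    unfolding tail_lag_def by blast
  define y0 where "y0 = suffix i z"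
  have "j = i + q" using ij(2) by linarith
  have "suffix q y0 = suffix (i + q) z" unfolding y0_def by simp
  also have "\<dots> = suffix j z" by (simp only: \<open>j = i + q\<close>)
  also have "\<dots> = y0" unfolding y0_def by (rule ij(1)[symmetric])
  finally have per: "suffix q y0 = y0" .
  have y0: "y0 \<in> X" "tail_lag z y0 (- int i)" unfolding y0_def using z by (auto intro: X_suffix tail_lag_suffix)
  have K: "K = (\<lambda>k. suffix k y0) ` {..<q}"
  proof (intro equalityI subsetI)
    fix y assume "y \<in> (\<lambda>k. suffix k y0) ` {..<q}"
    then obtain k where k: "y = suffix k y0" by blast
    have "suffix q y = suffix k (suffix q y0)" unfolding k by (simp add: add.commute)
    then have "suffix q y = y" unfolding per k .
    then have "y \<in> Per" using q X_suffix[OF y0(1)] k unfolding Per_def by blast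
    moreover have "tail_lag z y (- int (i + k))"
      using tail_lag_suffix[of z "i + k"] unfolding k y0_def by (simp add: add.commute)
    ultimately show "y \<in> K" by (auto simp: K_def)
  next
    fix y assume y: "y \<in> K"
    then obtain l where l: "y \<in> Per" "tail_lag z y l" unfolding K_def by blast
    obtain a b where ab: "suffix a y0 = suffix b y"
      using tail_lag_trans[OF tail_lag_sym[OF y0(2)] l(2)] unfolding tail_lag_def by blast
    have pery: "suffix q y = y" using Per_min_period(2)[OF l(1)] minq[OF y] by simp
    \<comment> \<open>Raising \<open>b\<close> to the multiple \<open>b * q\<close> of the period
      turns the tail of \<open>y\<close> back into \<open>y\<close>.\<close>
    have "b \<le> b * q" using q by simp
    have "y = suffix (b * q) y" using suffix_mult_period[OF pery] by simp
    also have "\<dots> = suffix (b * q - b) (suffix b y)" using \<open>b \<le> b * q\<close> by simp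
    also have "\<dots> = suffix (a + (b * q - b)) y0" unfolding ab[symmetric] by simp
    also have "\<dots> = suffix ((a + (b * q - b)) mod q) y0" by (rule suffix_mod_period[OF per])
    finally show "y \<in> (\<lambda>k. suffix k y0) ` {..<q}" using q by auto
  qed
  have inj: "inj_on (\<lambda>k. suffix k y0) {..<q}"
  proof (rule inj_onI)
    fix k k' assume kk: "k \<in> {..<q}" "k' \<in> {..<q}" "suffix k y0 = suffix k' y0"
    then have "tail_lag y0 y0 (int k' - int k)" unfolding tail_lag_def by blast
    then have "int q dvd int k' - int k" unfolding lag_conj[OF y0(2)] lag .
    moreover have "\<bar>int k' - int k\<bar> < int q" using kk by auto
    ultimately show "k = k'" using zdvd_not_zless[of "\<bar>int k' - int k\<bar>" "int q"] by fastforce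
  qed
  show "finite K" "card K = q" using K card_image[OF inj] by auto
  show "\<And>y. y \<in> K \<Longrightarrow> min_period y = q" by (rule minq)
qed

text \<open>Exchanging the sums gives each periodic point its own series: a point of least period
  \<open>p\<close> occurs exactly at the multiples \<open>n * p\<close>, where it contributes
  \<open>W p x ^ n / (n * p)\<close>.\<close>

lemma zeta_sum:
  fixes W :: "nat \<Rightarrow> (nat \<Rightarrow> 'e) \<Rightarrow> real"
  assumes nn: "\<And>m x. W m x \<ge> 0"
    and mult: "\<And>j x. x \<in> Per \<Longrightarrow> W (j * min_period x) x = (W (min_period x) x) ^ j"
  shows "(\<Sum>m. ennreal ((\<Sum>x\<in>closed_seq (Suc m). W (Suc m) x) / real (Suc m)))
     = (\<integral>\<^sup>+x. log_series (W (min_period x) x) * ennreal (1 / real (min_period x)) \<partial>count_space Per)"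
proof -
  define f where "f m x = (if suffix m x = x \<and> m > 0 then ennreal (W m x / real m) else 0)" for m x
  have 1: "ennreal ((\<Sum>x\<in>closed_seq (Suc m). W (Suc m) x) / real (Suc m)) = (\<integral>\<^sup>+x. f (Suc m) x \<partial>count_space Per)" for m
  proof -
    have "(\<integral>\<^sup>+x. f (Suc m) x \<partial>count_space Per) = (\<Sum>x\<in>closed_seq (Suc m). f (Suc m) x)"
      by (rule nn_integral_count_space') (use finite_closed in \<open>auto simp: f_def closed_seq_def Per_def\<close>)
    also have "\<dots> = (\<Sum>x\<in>closed_seq (Suc m). ennreal (W (Suc m) x / real (Suc m)))"
      by (rule sum.cong) (auto simp: f_def closed_seq_def)
    also have "\<dots> = ennreal (\<Sum>x\<in>closed_seq (Suc m). W (Suc m) x / real (Suc m))"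
      by (rule sum_ennreal) (use nn in auto)
    finally show ?thesis by (simp add: sum_divide_distrib)
  qed
  have "(\<Sum>m. ennreal ((\<Sum>x\<in>closed_seq (Suc m). W (Suc m) x) / real (Suc m))) = (\<Sum>m. \<integral>\<^sup>+x. f (Suc m) x \<partial>count_space Per)"
    unfolding 1 ..
  also have "\<dots> = (\<integral>\<^sup>+x. (\<Sum>m. f (Suc m) x) \<partial>count_space Per)"
    by (rule nn_integral_suminf[symmetric]) simp
  also have "\<dots> = (\<integral>\<^sup>+x. log_series (W (min_period x) x) * ennreal (1 / real (min_period x)) \<partial>count_space Per)"
  proof (rule nn_integral_cong)
    fix x assume "x \<in> space (count_space Per)"
    then have x: "x \<in> Per" by simp
    note mp = Per_min_period[OF x]
    \<comment> \<open>The series is indexed by \<open>Suc m\<close>, so \<open>g n\<close> is one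
      less than a multiple of the period.\<close>
    define g where "g n = Suc n * min_period x - 1" for n
    have g: "Suc (g n) = Suc n * min_period x" for n using mp(1) by (simp add: g_def)
    have "(\<Sum>m. f (Suc m) x) = (\<Sum>n. f (Suc (g n)) x)"
    proof (rule suminf_mono_reindex[symmetric])
      show "strict_mono g"
        using mp(1) unfolding strict_mono_Suc_iff g_def by (simp, arith)
      fix n assume n: "n \<notin> range g"
      show "f (Suc n) x = 0"
      proof (rule ccontr)
        assume "f (Suc n) x \<noteq> 0"
        then have "min_period x dvd Suc n" using min_period_dvd[OF mp(1,2)] by (auto simp: f_def split: if_splits)
        then obtain k where k: "Suc n = k * min_period x" by (metis dvd_def mult.commute)
        then obtain k' where "k = Suc k'" by (cases k) auto
        then have "Suc n = Suc (g k')" using k g by simp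
        then show False using n by auto
      qed
    qed
    also have "\<dots> = (\<Sum>n. ennreal ((W (min_period x) x) ^ Suc n / real (Suc n)) * ennreal (1 / real (min_period x)))"
    proof (rule suminf_cong)
      fix n
      have "suffix (Suc n * min_period x) x = x" by (rule suffix_mult_period[OF mp(2)])
      then have "f (Suc (g n)) x = ennreal (W (Suc n * min_period x) x / real (Suc n * min_period x))"
        unfolding g using mp(1) by (simp add: f_def)
      also have "\<dots> = ennreal ((W (min_period x) x) ^ Suc n / real (Suc n) * (1 / real (min_period x)))"
        unfolding mult[OF x] by (simp add: field_simps)
      also have "\<dots> = ennreal ((W (min_period x) x) ^ Suc n / real (Suc n)) * ennreal (1 / real (min_period x))"
        by (rule ennreal_mult) (use nn in auto)
      finally show "f (Suc (g n)) x = ennreal ((W (min_period x) x) ^ Suc n / real (Suc n)) * ennreal (1 / real (min_period x))" .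
    qed
    also have "\<dots> = log_series (W (min_period x) x) * ennreal (1 / real (min_period x))"
      unfolding log_series_def by simp
    finally show "(\<Sum>m. f (Suc m) x) = log_series (W (min_period x) x) * ennreal (1 / real (min_period x))" .
  qed
  finally show ?thesis .
qed

end

text \<open>Extension by zero moves both integrals to \<open>UNIV\<close>, where counting measures
  can be exchanged without countability.\<close>

lemma nn_integral_count_space_swap:
  "(\<integral>\<^sup>+x. \<integral>\<^sup>+y. f x y \<partial>count_space B \<partial>count_space A) = (\<integral>\<^sup>+y. \<integral>\<^sup>+x. f x y \<partial>count_space A \<partial>count_space B)"
proof -
  define g where "g = (\<lambda>(x,y). if x \<in> A \<and> y \<in> B then f x y else 0)"
  have "(\<integral>\<^sup>+x. \<integral>\<^sup>+y. f x y \<partial>count_space B \<partial>count_space A) = (\<integral>\<^sup>+x. \<integral>\<^sup>+y. g (x, y) \<partial>count_space B \<partial>count_space A)"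
    by (intro nn_integral_cong) (auto simp: g_def)
  also have "\<dots> = (\<integral>\<^sup>+x. \<integral>\<^sup>+y. g (x, y) \<partial>count_space UNIV \<partial>count_space A)"
    by (intro nn_integral_cong nn_integral_count_space_eq) (auto simp: g_def)
  also have "\<dots> = (\<integral>\<^sup>+x. \<integral>\<^sup>+y. g (x, y) \<partial>count_space UNIV \<partial>count_space UNIV)"
    by (intro nn_integral_count_space_eq) (auto simp: g_def)
  also have "\<dots> = (\<integral>\<^sup>+y. \<integral>\<^sup>+x. g (x, y) \<partial>count_space UNIV \<partial>count_space UNIV)"
    unfolding nn_integral_fst_count_space nn_integral_snd_count_space ..
  also have "\<dots> = (\<integral>\<^sup>+y. \<integral>\<^sup>+x. g (x, y) \<partial>count_space UNIV \<partial>count_space B)"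
    by (intro nn_integral_count_space_eq) (auto simp: g_def)
  also have "\<dots> = (\<integral>\<^sup>+y. \<integral>\<^sup>+x. g (x, y) \<partial>count_space A \<partial>count_space B)"
    by (intro nn_integral_cong nn_integral_count_space_eq) (auto simp: g_def)
  also have "\<dots> = (\<integral>\<^sup>+y. \<integral>\<^sup>+x. f x y \<partial>count_space A \<partial>count_space B)"
    by (intro nn_integral_cong) (auto simp: g_def)
  finally show ?thesis .
qed

section \<open>Transfer of periodic points between the two graphs\<close>

context lpa_pair
begin

interpretation S: lpa_pair F E R "\<lambda>b a. P a b" by (rule swap)

lemma S_hh: "H y x \<Longrightarrow> S.hh y = x"
  by (rule S.hh_eq) (simp add: S_H)

lemma tail_lag_hh_iff:
  assumes "x \<in> B.X" "x' \<in> B.X"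
  shows "(\<exists>k. tail_lag (hh x) (hh x') k) \<longleftrightarrow> (\<exists>k. tail_lag x x' k)"
proof
  assume "\<exists>k. tail_lag x x' k"
  then show "\<exists>k. tail_lag (hh x) (hh x') k" using tail_lag_transfer[OF hh[OF assms(1)] hh[OF assms(2)]] by blast
next
  assume "\<exists>k. tail_lag (hh x) (hh x') k"
  moreover have "S.H x (hh x)" "S.H x' (hh x')" using hh assms by (auto simp: S_H)
  ultimately show "\<exists>k. tail_lag x x' k" using S.tail_lag_transfer by blast
qed

definition tail_rel :: "(nat \<Rightarrow> 'e2) \<Rightarrow> (nat \<Rightarrow> 'e1) \<Rightarrow> bool" where
  "tail_rel x y \<longleftrightarrow> (\<exists>k. tail_lag (hh x) y k)"

text \<open>The cycle sum generates the isotropy of \<open>hh x\<close>, so the periodic points of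
  \<open>E\<close> tail equivalent to it form one cycle of that length.\<close>

lemma class_A:
  assumes x: "x \<in> B.Per"
  defines "K \<equiv> {y\<in>A.Per. tail_rel x y}"
  shows "cocycle_sum (min_period x) x > 0" "finite K" "card K = nat (cocycle_sum (min_period x) x)"
    "\<And>y. y \<in> K \<Longrightarrow> min_period y = nat (cocycle_sum (min_period x) x)"
proof -
  note xX = B.Per_X[OF x] and mp = B.Per_min_period[OF x]
  show pos: "cocycle_sum (min_period x) x > 0" by (rule cocycle_sum_pos[OF xX mp(1,2)])
  have lag: "tail_lag (hh x) (hh x) k \<longleftrightarrow> int (nat (cocycle_sum (min_period x) x)) dvd k" for k
    using lag_iff[OF xX mp] pos by simp
  show "finite K" "card K = nat (cocycle_sum (min_period x) x)" "\<And>y. y \<in> K \<Longrightarrow> min_period y = nat (cocycle_sum (min_period x) x)"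
    using A.tail_class[OF hh_X[OF xX] _ lag] pos unfolding K_def tail_rel_def by auto
qed

text \<open>The same argument for the exchanged pair. The reverse cocycle only provides a positive
  generator; writing the period as \<open>card L\<close> removes it from the result.\<close>

lemma class_B:
  assumes y: "y \<in> A.Per"
  defines "L \<equiv> {x\<in>B.Per. tail_rel x y}"
  shows "finite L" "L \<noteq> {}" "\<And>x. x \<in> L \<Longrightarrow> min_period x = card L"
proof -
  note yX = A.Per_X[OF y] and mp = A.Per_min_period[OF y]
  obtain x1 where x1: "H y x1" using ex_H'[OF yX] by blast
  have x1X: "x1 \<in> B.X" and hx1: "hh x1 = y" using H_X[OF x1] hh_eq[OF x1] by auto
  have pos: "S.cocycle_sum (min_period y) y > 0" by (rule S.cocycle_sum_pos[OF yX mp(1,2)])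
  have lag: "tail_lag x1 x1 k \<longleftrightarrow> int (nat (S.cocycle_sum (min_period y) y)) dvd k" for k
    using S.lag_iff[OF yX mp] pos unfolding S_hh[OF x1] by simp
  have L: "L = {x\<in>B.Per. \<exists>k. tail_lag x1 x k}"
  proof -
    have "tail_rel x y \<longleftrightarrow> (\<exists>k. tail_lag x1 x k)" if "x \<in> B.Per" for x
      using tail_lag_hh_iff[OF B.Per_X[OF that] x1X] tail_lag_sym unfolding hx1 tail_rel_def by blast
    then show ?thesis unfolding L_def by blast
  qed
  note tc = B.tail_class[OF x1X _ lag, folded L]
  have q: "nat (S.cocycle_sum (min_period y) y) > 0" using pos by simp
  show "finite L" "\<And>x. x \<in> L \<Longrightarrow> min_period x = card L" using tc[OF q] by auto
  show "L \<noteq> {}" using tc(2)[OF q] q by auto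
qed

text \<open>Double counting of the pairs of tail equivalent periodic points \<open>x\<close>, \<open>y\<close> with weight
  \<open>1 / (min_period x * min_period y)\<close>: the partners \<open>x\<close> of a given \<open>y\<close> all
  have the same period, which is also their number, and conversely.\<close>
lemma zeta_transfer:
  fixes g :: "nat \<Rightarrow> ennreal"
  shows "(\<integral>\<^sup>+x. g (nat (cocycle_sum (min_period x) x)) * ennreal (1 / real (min_period x)) \<partial>count_space B.Per)
    = (\<integral>\<^sup>+y. g (min_period y) * ennreal (1 / real (min_period y)) \<partial>count_space A.Per)"
proof -
  define f where "f x y = (if tail_rel x y then g (min_period y) * (ennreal (1 / real (min_period x)) * ennreal (1 / real (min_period y))) else 0)" for x y
  have inv: "of_nat n * ennreal (1 / real n) = 1" if "n > 0" for n
  proof -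
    have "of_nat n * ennreal (1 / real n) = ennreal (real n * (1 / real n))"
      by (subst ennreal_mult) (auto simp: ennreal_of_nat_eq_real_of_nat)
    then show ?thesis using that by simp
  qed
  have "(\<integral>\<^sup>+x. g (nat (cocycle_sum (min_period x) x)) * ennreal (1 / real (min_period x)) \<partial>count_space B.Per)
     = (\<integral>\<^sup>+x. \<integral>\<^sup>+y. f x y \<partial>count_space A.Per \<partial>count_space B.Per)"
  proof (rule nn_integral_cong)
    fix x assume "x \<in> space (count_space B.Per)"
    then have x: "x \<in> B.Per" by simp
    let ?K = "{y\<in>A.Per. tail_rel x y}" and ?S = "nat (cocycle_sum (min_period x) x)"
    note c = class_A[OF x]
    have "(\<integral>\<^sup>+y. f x y \<partial>count_space A.Per) = (\<Sum>y\<in>?K. f x y)"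
      by (rule nn_integral_count_space') (use c in \<open>auto simp: f_def\<close>)
    also have "\<dots> = (\<Sum>y\<in>?K. g ?S * ennreal (1 / real (min_period x)) * ennreal (1 / real ?S))"
      by (rule sum.cong) (auto simp: f_def c(4) mult.assoc)
    also have "\<dots> = g ?S * ennreal (1 / real (min_period x)) * (of_nat ?S * ennreal (1 / real ?S))"
      using c(3) by (simp add: mult.left_commute mult.assoc)
    also have "\<dots> = g ?S * ennreal (1 / real (min_period x))"
      using inv[of ?S] c(1) by simp
    finally show "g ?S * ennreal (1 / real (min_period x)) = (\<integral>\<^sup>+y. f x y \<partial>count_space A.Per)" by simp
  qed
  also have "\<dots> = (\<integral>\<^sup>+y. \<integral>\<^sup>+x. f x y \<partial>count_space B.Per \<partial>count_space A.Per)"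
    by (rule nn_integral_count_space_swap)
  also have "\<dots> = (\<integral>\<^sup>+y. g (min_period y) * ennreal (1 / real (min_period y)) \<partial>count_space A.Per)"
  proof (rule nn_integral_cong)
    fix y assume "y \<in> space (count_space A.Per)"
    then have y: "y \<in> A.Per" by simp
    let ?L = "{x\<in>B.Per. tail_rel x y}"
    note c = class_B[OF y]
    have "(\<integral>\<^sup>+x. f x y \<partial>count_space B.Per) = (\<Sum>x\<in>?L. f x y)"
      by (rule nn_integral_count_space') (use c in \<open>auto simp: f_def\<close>)
    also have "\<dots> = (\<Sum>x\<in>?L. g (min_period y) * ennreal (1 / real (min_period y)) * ennreal (1 / real (card ?L)))"
      by (rule sum.cong) (use c(3) in \<open>auto simp: f_def mult.assoc mult.commute\<close>)
    also have "\<dots> = g (min_period y) * ennreal (1 / real (min_period y)) * (of_nat (card ?L) * ennreal (1 / real (card ?L)))"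
      by (simp add: mult.left_commute mult.assoc)
    also have "\<dots> = g (min_period y) * ennreal (1 / real (min_period y))"
      using inv[of "card ?L"] c(1,2) by (simp add: card_gt_0_iff)
    finally show "(\<integral>\<^sup>+x. f x y \<partial>count_space B.Per) = g (min_period y) * ennreal (1 / real (min_period y))" .
  qed
  finally show ?thesis .
qed

text \<open>In \<open>ennreal\<close> the equality is free of convergence conditions. Over a
  primitive cycle of \<open>F\<close> the weight is \<open>t\<close> to the length of the matched
  cycle of \<open>E\<close>.\<close>

theorem zeta_eq:
  fixes t :: real
  assumes t: "t > 0"
  shows "(\<Sum>m. ennreal ((\<Sum>x\<in>B.closed_seq (Suc m). t powi (cocycle_sum (Suc m) x)) / real (Suc m)))
    = (\<Sum>m. ennreal ((\<Sum>y\<in>A.closed_seq (Suc m). t ^ Suc m) / real (Suc m)))"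
proof -
  have "(\<Sum>m. ennreal ((\<Sum>x\<in>B.closed_seq (Suc m). t powi (cocycle_sum (Suc m) x)) / real (Suc m)))
     = (\<integral>\<^sup>+x. log_series (t powi (cocycle_sum (min_period x) x)) * ennreal (1 / real (min_period x)) \<partial>count_space B.Per)"
  proof (rule B.zeta_sum[of "\<lambda>m x. t powi (cocycle_sum m x)"])
    fix j x assume x: "x \<in> B.Per"
    show "t powi cocycle_sum (j * min_period x) x = (t powi cocycle_sum (min_period x) x) ^ j"
      using cocycle_sum_mult[OF B.Per_min_period(2)[OF x], of j] by (simp add: power_int_power' mult.commute)
  qed (use t in auto)
  also have "\<dots> = (\<integral>\<^sup>+x. (\<lambda>n. log_series (t ^ n)) (nat (cocycle_sum (min_period x) x)) * ennreal (1 / real (min_period x)) \<partial>count_space B.Per)"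
    by (rule nn_integral_cong) (use class_A(1) in \<open>auto simp: power_int_nonneg_exp less_imp_le\<close>)
  also have "\<dots> = (\<integral>\<^sup>+y. log_series (t ^ min_period y) * ennreal (1 / real (min_period y)) \<partial>count_space A.Per)"
    by (rule zeta_transfer)
  also have "\<dots> = (\<Sum>m. ennreal ((\<Sum>y\<in>A.closed_seq (Suc m). t ^ Suc m) / real (Suc m)))"
    by (rule A.zeta_sum[of "\<lambda>m x. t ^ m", symmetric]) (use t in \<open>auto simp: power_mult[symmetric] mult.commute\<close>)
  finally show ?thesis .
qed

end


section \<open>Determinants and traces of powers\<close>

text \<open>The Leibniz formula over an arbitrary index set, since the vertices of a block graph are
  lists; numbered rows enter only within proofs.\<close>

definition det_fun :: "'v set \<Rightarrow> ('v \<Rightarrow> 'v \<Rightarrow> complex) \<Rightarrow> complex" where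
  "det_fun V M = (\<Sum>p | p permutes V. of_int (sign p) * (\<Prod>v\<in>V. M v (p v)))"

primrec pow_fun :: "'v set \<Rightarrow> ('v \<Rightarrow> 'v \<Rightarrow> complex) \<Rightarrow> nat \<Rightarrow> 'v \<Rightarrow> 'v \<Rightarrow> complex" where
  "pow_fun V M 0 v w = (if v = w then 1 else 0)"
| "pow_fun V M (Suc m) v w = (\<Sum>u\<in>V. pow_fun V M m v u * M u w)"

definition trace_pow :: "'v set \<Rightarrow> ('v \<Rightarrow> 'v \<Rightarrow> complex) \<Rightarrow> nat \<Rightarrow> complex" where
  "trace_pow V M m = (\<Sum>v\<in>V. pow_fun V M m v v)"

lemma det_fun_reindex:
  assumes "bij_betw f A B" "finite A"
  shows "det_fun B M = det_fun A (\<lambda>i j. M (f i) (f j))"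
proof -
  have inj: "inj_on f A" and B: "B = f ` A" using assms(1) by (auto simp: bij_betw_def)
  let ?g = "\<lambda>\<pi> x. if x \<in> B then f (\<pi> (inv_into A f x)) else x"
  have g: "?g \<pi> = map_permutation A f \<pi>" for \<pi>
    by (auto simp: map_permutation_def restrict_id_def B fun_eq_iff)
  have "det_fun B M = (\<Sum>\<pi> | \<pi> permutes A. of_int (sign (?g \<pi>)) * (\<Prod>v\<in>B. M v (?g \<pi> v)))"
    unfolding det_fun_def
    by (rule sum.reindex_bij_betw[symmetric, OF bij_betw_permutations[OF assms(1)]])
  also have "\<dots> = det_fun A (\<lambda>i j. M (f i) (f j))"
    unfolding det_fun_def
  proof (rule sum.cong)
    fix \<pi> assume "\<pi> \<in> {\<pi>. \<pi> permutes A}"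
    then have \<pi>: "\<pi> permutes A" by simp
    have "sign (?g \<pi>) = sign \<pi>" unfolding g by (rule sign_map_permutation) (use inj \<pi> assms in auto)
    moreover have "(\<Prod>v\<in>B. M v (?g \<pi> v)) = (\<Prod>i\<in>A. M (f i) (f (\<pi> i)))"
      unfolding B by (subst prod.reindex[OF inj]) (auto intro!: prod.cong simp: inv_into_f_f[OF inj])
    ultimately show "of_int (sign (?g \<pi>)) * (\<Prod>v\<in>B. M v (?g \<pi> v)) = of_int (sign \<pi>) * (\<Prod>i\<in>A. M (f i) (f (\<pi> i)))"
      by simp
  qed simp
  finally show ?thesis .
qed

lemma pow_fun_reindex:
  assumes "bij_betw f A B" "i \<in> A" "j \<in> A"
  shows "pow_fun B M m (f i) (f j) = pow_fun A (\<lambda>i j. M (f i) (f j)) m i j"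
  using assms(2,3)
proof (induction m arbitrary: j)
  case 0
  then show ?case using assms(1) by (auto simp: bij_betw_def inj_on_def)
next
  case (Suc m)
  have "pow_fun B M (Suc m) (f i) (f j) = (\<Sum>u\<in>A. pow_fun B M m (f i) (f u) * M (f u) (f j))"
    by (simp add: sum.reindex_bij_betw[OF assms(1), of "\<lambda>u. pow_fun B M m (f i) u * M u (f j)"])
  then show ?case using Suc by simp
qed

lemma det_fun_det: "det_fun {0..<n} M = det (mat n n (\<lambda>(i,j). M i j))"
proof -
  have "p i < n" if "p permutes {0..<n}" "i < n" for p i
    using permutes_in_image[OF that(1), of i] that(2) by simp
  then show ?thesis
    unfolding det_fun_def by (subst det_def'[of _ n]) (auto intro!: sum.cong prod.cong)
qed

lemma pow_fun_pow:
  assumes "i < n" "j < n"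
  shows "pow_fun {0..<n} M m i j = (mat n n (\<lambda>(i,j). M i j) ^\<^sub>m m) $$ (i, j)"
  using assms
proof (induction m arbitrary: j)
  case (Suc m)
  let ?B = "mat n n (\<lambda>(i,j). M i j)"
  have d: "?B ^\<^sub>m m \<in> carrier_mat n n" by (intro pow_carrier_mat) simp
  have "(?B ^\<^sub>m m * ?B) $$ (i, j) = (\<Sum>u\<in>{0..<n}. (?B ^\<^sub>m m) $$ (i, u) * M u j)"
    using d Suc.prems by (simp add: scalar_prod_def)
  then show ?case using Suc by simp
qed simp

lemma trace_mult_commute:
  fixes A B :: "complex mat"
  assumes "A \<in> carrier_mat n n" "B \<in> carrier_mat n n"
  shows "(\<Sum>i<n. (A * B) $$ (i,i)) = (\<Sum>i<n. (B * A) $$ (i,i))"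
proof -
  have *: "(\<Sum>i<n. (X * Y) $$ (i,i)) = (\<Sum>i<n. \<Sum>j<n. X $$ (i,j) * Y $$ (j,i))"
    if "X \<in> carrier_mat n n" "Y \<in> carrier_mat n n" for X Y :: "complex mat"
    using that by (auto intro!: sum.cong simp: scalar_prod_def atLeast0LessThan)
  show ?thesis
    unfolding *[OF assms] *[OF assms(2,1)] by (subst sum.swap) (simp add: mult.commute)
qed

lemma upper_triangular_pow:
  fixes U :: "complex mat"
  assumes U: "U \<in> carrier_mat n n" "upper_triangular U"
  shows "upper_triangular (U ^\<^sub>m m) \<and> (\<forall>i<n. (U ^\<^sub>m m) $$ (i,i) = (U $$ (i,i)) ^ m)"
proof (induction m)
  case 0
  then show ?case using U by auto
next
  case (Suc m)
  have d: "U ^\<^sub>m m \<in> carrier_mat n n" using U by (intro pow_carrier_mat) simp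
  have e: "(U ^\<^sub>m m * U) $$ (i, j) = (\<Sum>k<n. (U ^\<^sub>m m) $$ (i, k) * U $$ (k, j))" if "i < n" "j < n" for i j
    using d U that by (auto simp: scalar_prod_def atLeast0LessThan)
  have lo: "(U ^\<^sub>m m) $$ (i, k) = 0" if "k < i" "i < n" for i k
    using Suc.IH d that by (auto elim: upper_triangularD)
  have lo': "U $$ (i, k) = 0" if "k < i" "i < n" for i k
    using U that by (auto elim: upper_triangularD)
  have "upper_triangular (U ^\<^sub>m m * U)"
  proof (rule upper_triangularI)
    fix i j assume ij: "j < i" "i < dim_row (U ^\<^sub>m m * U)"
    then have i: "i < n" "j < n" using d by auto
    have "(U ^\<^sub>m m) $$ (i, k) * U $$ (k, j) = 0" if "k < n" for k
      using lo[of k i] lo'[of j k] i ij that by (cases "k < i") auto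
    then show "(U ^\<^sub>m m * U) $$ (i, j) = 0" unfolding e[OF i] by (intro sum.neutral) auto
  qed
  moreover have "(U ^\<^sub>m m * U) $$ (i, i) = (U $$ (i,i)) ^ Suc m" if i: "i < n" for i
  proof -
    have "(U ^\<^sub>m m * U) $$ (i, i) = (\<Sum>k<n. if k = i then (U ^\<^sub>m m) $$ (i, i) * U $$ (i, i) else 0)"
      unfolding e[OF i i]
    proof (rule sum.cong)
      fix k assume "k \<in> {..<n}"
      then show "(U ^\<^sub>m m) $$ (i, k) * U $$ (k, i) = (if k = i then (U ^\<^sub>m m) $$ (i, i) * U $$ (i, i) else 0)"
        using lo[of k i] lo'[of i k] i by (cases k i rule: linorder_cases) auto
    qed simp
    then show ?thesis using Suc.IH i by (simp add: sum.delta mult.commute)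
  qed
  ultimately show ?case by simp
qed

text \<open>A Schur form has the roots of the characteristic polynomial on its diagonal, its powers
  stay triangular, and traces are invariant under conjugation. One list thus controls the
  determinant and all the traces.\<close>

lemma eigenvalue_list_mat:
  fixes B :: "complex mat"
  assumes B: "B \<in> carrier_mat n n"
  shows "\<exists>es. (\<forall>s. det (mat n n (\<lambda>(i,j). (if i = j then 1 else 0) - s * B $$ (i,j))) = (\<Prod>e\<leftarrow>es. 1 - s * e)) \<and>
    (\<forall>m. (\<Sum>i<n. (B ^\<^sub>m m) $$ (i,i)) = (\<Sum>e\<leftarrow>es. e ^ m))"
proof -
  obtain es where es: "char_poly B = (\<Prod>a\<leftarrow>es. [:- a, 1:])" "length es = n"
    using char_poly_factorized[OF B] by blast
  obtain U P Q where "schur_decomposition B es = (U, P, Q)" by (cases "schur_decomposition B es") auto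
  from schur_decomposition[OF B es(1) this]
  have sim: "similar_mat_wit B U P Q" and ut: "upper_triangular U" and dg: "diag_mat U = es" by auto
  have c: "U \<in> carrier_mat n n" "P \<in> carrier_mat n n" "Q \<in> carrier_mat n n" "Q * P = 1\<^sub>m n"
    using sim B unfolding similar_mat_wit_def Let_def by auto
  have "det (mat n n (\<lambda>(i,j). (if i = j then 1 else 0) - s * B $$ (i,j))) = (\<Prod>e\<leftarrow>es. 1 - s * e)" for s
  \<comment> \<open>For \<open>s \<noteq> 0\<close> the determinant is \<open>s ^ n\<close> times
    the characteristic polynomial at \<open>1 / s\<close>, so \<open>s = 0\<close> stands
    apart.\<close>
  proof (cases "s = 0")
    case True
    have "mat n n (\<lambda>(i,j). (if i = j then 1 else 0) - s * B $$ (i,j)) = 1\<^sub>m n"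
      using True by (intro eq_matI) auto
    moreover have "(\<Prod>e\<leftarrow>es. 1 - s * e) = 1" using True by (induction es) auto
    ultimately show ?thesis by simp
  next
    case False
    have "mat n n (\<lambda>(i,j). (if i = j then 1 else 0) - s * B $$ (i,j)) = s \<cdot>\<^sub>m (- char_matrix B (1 / s))"
      using False B by (intro eq_matI) (auto simp: char_matrix_def field_simps)
    then have "det (mat n n (\<lambda>(i,j). (if i = j then 1 else 0) - s * B $$ (i,j))) = s ^ n * poly (char_poly B) (1 / s)"
      using B by (simp add: char_poly_matrix[OF B] char_matrix_def)
    also have "\<dots> = (\<Prod>e\<leftarrow>es. 1 - s * e)"
      unfolding es(1) es(2)[symmetric] using False
      by (induction es) (auto simp: field_simps)
    finally show ?thesis .
  qed
  moreover have "(\<Sum>i<n. (B ^\<^sub>m m) $$ (i,i)) = (\<Sum>e\<leftarrow>es. e ^ m)" for m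
  proof -
    have Um: "U ^\<^sub>m m \<in> carrier_mat n n" using c by (intro pow_carrier_mat) simp
    have B_pow: "B ^\<^sub>m m = P * U ^\<^sub>m m * Q" by (rule similar_mat_wit_pow_id[OF sim])
    have "(\<Sum>i<n. (B ^\<^sub>m m) $$ (i,i)) = (\<Sum>i<n. (Q * (P * U ^\<^sub>m m)) $$ (i,i))"
      unfolding B_pow by (rule trace_mult_commute) (use c Um in auto)
    also have "Q * (P * U ^\<^sub>m m) = (Q * P) * U ^\<^sub>m m"
      by (rule assoc_mult_mat[symmetric]) (use c Um in auto)
    also have "\<dots> = U ^\<^sub>m m" using c Um by simp
    also have "(\<Sum>i<n. (U ^\<^sub>m m) $$ (i,i)) = (\<Sum>i<n. (U $$ (i,i)) ^ m)"
      using upper_triangular_pow[OF c(1) ut] by simp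
    also have "\<dots> = (\<Sum>e\<leftarrow>es. e ^ m)"
      using c(1) unfolding dg[symmetric] diag_mat_def
      by (simp add: sum_list_sum_nth atLeast0LessThan comp_def)
    finally show ?thesis .
  qed
  ultimately show ?thesis by blast
qed

lemma eigenvalue_list:
  assumes "finite V"
  shows "\<exists>es. (\<forall>s. det_fun V (\<lambda>v w. (if v = w then 1 else 0) - s * M v w) = (\<Prod>e\<leftarrow>es. 1 - s * e)) \<and>
    (\<forall>m. trace_pow V M m = (\<Sum>e\<leftarrow>es. e ^ m))"
proof -
  obtain f where f: "bij_betw f {0..<card V} V" using ex_bij_betw_nat_finite[OF assms] by blast
  let ?n = "card V"
  let ?B = "mat ?n ?n (\<lambda>(i,j). M (f i) (f j))"
  obtain es where es: "\<And>s. det (mat ?n ?n (\<lambda>(i,j). (if i = j then 1 else 0) - s * ?B $$ (i,j))) = (\<Prod>e\<leftarrow>es. 1 - s * e)"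
    "\<And>m. (\<Sum>i<?n. (?B ^\<^sub>m m) $$ (i,i)) = (\<Sum>e\<leftarrow>es. e ^ m)"
    using eigenvalue_list_mat[of ?B ?n] by auto
  have "det_fun V (\<lambda>v w. (if v = w then 1 else 0) - s * M v w) = (\<Prod>e\<leftarrow>es. 1 - s * e)" for s
  proof -
    have "det_fun V (\<lambda>v w. (if v = w then 1 else 0) - s * M v w) =
      det (mat ?n ?n (\<lambda>(i,j). (if f i = f j then 1 else 0) - s * M (f i) (f j)))"
      by (subst det_fun_reindex[OF f]) (simp_all add: det_fun_det)
    also have "mat ?n ?n (\<lambda>(i,j). (if f i = f j then 1 else 0) - s * M (f i) (f j)) =
      mat ?n ?n (\<lambda>(i,j). (if i = j then 1 else 0) - s * ?B $$ (i,j))"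
      using f by (intro eq_matI) (auto simp: bij_betw_def inj_on_def)
    finally show ?thesis using es(1) by simp
  qed
  moreover have "trace_pow V M m = (\<Sum>e\<leftarrow>es. e ^ m)" for m
  proof -
    have "trace_pow V M m = (\<Sum>i\<in>{0..<?n}. pow_fun V M m (f i) (f i))"
      unfolding trace_pow_def by (rule sum.reindex_bij_betw[OF f, symmetric])
    also have "\<dots> = (\<Sum>i<?n. (?B ^\<^sub>m m) $$ (i,i))"
      unfolding atLeast0LessThan[symmetric] by (rule sum.cong) (auto simp: pow_fun_reindex[OF f] pow_fun_pow)
    finally show ?thesis using es(2) by simp
  qed
  ultimately show ?thesis by blast
qed

text \<open>For one factor this is the logarithm series of \<open>1 - s * e\<close>, and the series
  of the factors are added. Division by zero makes the term for \<open>n = 0\<close> vanish.\<close>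

lemma prod_list_exp_small:
  fixes es :: "complex list"
  assumes "\<And>e. e \<in> set es \<Longrightarrow> cmod (s * e) < 1"
  shows "\<exists>S. (\<lambda>n. (\<Sum>e\<leftarrow>es. e ^ n) / of_nat n * s ^ n) sums S \<and> (\<Prod>e\<leftarrow>es. 1 - s * e) = exp (- S)"
  using assms
proof (induction es)
  case Nil
  show ?case by (intro exI[of _ 0]) (simp add: sums_zero)
next
  case (Cons e es)
  then obtain S where S: "(\<lambda>n. (\<Sum>e\<leftarrow>es. e ^ n) / of_nat n * s ^ n) sums S" "(\<Prod>e\<leftarrow>es. 1 - s * e) = exp (- S)"
    by auto
  have e: "cmod (s * e) < 1" using Cons.prems by simp
  have "(\<lambda>n. - ((- (- (s * e))) ^ n) / of_nat n) sums ln (1 + (- (s * e)))"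
    by (rule Ln_series') (use e in simp)
  then have "(\<lambda>n. (s * e) ^ n / of_nat n) sums (- ln (1 - s * e))"
    using sums_minus by fastforce
  then have "(\<lambda>n. (s * e) ^ n / of_nat n + (\<Sum>e\<leftarrow>es. e ^ n) / of_nat n * s ^ n) sums (- ln (1 - s * e) + S)"
    by (rule sums_add[OF _ S(1)])
  then have "(\<lambda>n. (\<Sum>e\<leftarrow>e # es. e ^ n) / of_nat n * s ^ n) sums (- ln (1 - s * e) + S)"
    by (rule back_subst[of "\<lambda>f. f sums _"]) (auto simp: fun_eq_iff power_mult_distrib add_divide_distrib distrib_right)
  moreover have "1 - s * e \<noteq> 0" using e by auto
  then have "(\<Prod>e\<leftarrow>e # es. 1 - s * e) = exp (- (- ln (1 - s * e) + S))"
    using S(2) by (simp add: exp_diff exp_minus field_simps)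
  ultimately show ?case by blast
qed

lemma small_radius:
  fixes es :: "complex list"
  obtains r where "0 < r" "r \<le> 1" "\<And>s e. cmod s < r \<Longrightarrow> e \<in> set es \<Longrightarrow> cmod (s * e) < 1"
proof
  define C where "C = (\<Sum>e\<leftarrow>es. cmod e)"
  have C0: "C \<ge> 0" unfolding C_def by (intro sum_list_nonneg) auto
  show "0 < 1 / (1 + C)" "1 / (1 + C) \<le> 1" using C0 by auto
  fix s e assume s: "cmod s < 1 / (1 + C)" and e: "e \<in> set es"
  have "cmod e \<le> C" unfolding C_def using e by (intro member_le_sum_list) auto
  then have "cmod s * cmod e \<le> cmod s * (1 + C)" by (intro mult_left_mono) auto
  also have "\<dots> < 1" using s C0 by (simp add: field_simps)
  finally show "cmod (s * e) < 1" by (simp add: norm_mult)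
qed

lemma holomorphic_prod_list: "(\<lambda>s. \<Prod>e\<leftarrow>es. 1 - s * e) holomorphic_on A"
  by (induction es) (auto intro!: holomorphic_intros)

text \<open>It is not assumed that the \<open>e\<close> lie in the unit disc: analytic continuation carries the identity
  from a small disc to the unit disc, and continuity to its boundary. The term for \<open>n = 0\<close> is
  a division by zero, with value \<open>0\<close>.\<close>
lemma prod_list_exp:
  fixes es :: "complex list"
  assumes "summable (\<lambda>n. cmod ((\<Sum>e\<leftarrow>es. e ^ n) / of_nat n))"
  shows "(\<Prod>e\<leftarrow>es. 1 - e) = exp (- (\<Sum>n. (\<Sum>e\<leftarrow>es. e ^ n) / of_nat n))"
proof -
  define a where "a n = (\<Sum>e\<leftarrow>es. e ^ n) / of_nat n" for n
  define P where "P s = (\<Sum>n. a n * s ^ n)" for s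
  define q where "q s = (\<Prod>e\<leftarrow>es. 1 - s * e)" for s
  have bd: "cmod (a n * s ^ n) \<le> cmod (a n)" if "s \<in> cball 0 1" for n s
  proof -
    have "cmod s ^ n \<le> 1" using that by (intro power_le_one) auto
    then show ?thesis by (simp add: norm_mult norm_power mult_left_le)
  qed
  have sm: "summable (\<lambda>n. cmod (a n))" using assms by (simp add: a_def)
  have sums: "(\<lambda>n. a n * s ^ n) sums P s" if "s \<in> cball 0 1" for s
    unfolding P_def
    by (rule summable_sums, rule summable_norm_cancel, rule summable_comparison_test'[OF sm, of 0])
       (use bd[OF that] in auto)
  have "P holomorphic_on ball 0 1"
    by (rule power_series_holomorphic[of 0 1 a]) (use sums in auto)
  then have hP: "(\<lambda>s. exp (- P s)) holomorphic_on ball 0 1" by (intro holomorphic_intros)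
  obtain r where r: "0 < r" "r \<le> 1" "\<And>s e. cmod s < r \<Longrightarrow> e \<in> set es \<Longrightarrow> cmod (s * e) < 1"
    using small_radius by blast
  have small: "q s = exp (- P s)" if "s \<in> ball 0 r" for s
  proof -
    have "cmod s < r" using that by simp
    then have "\<exists>S. (\<lambda>n. a n * s ^ n) sums S \<and> q s = exp (- S)"
      unfolding a_def q_def by (intro prod_list_exp_small r(3))
    then obtain S where S: "(\<lambda>n. a n * s ^ n) sums S" "q s = exp (- S)" by blast
    then show ?thesis using sums_unique[OF S(1)] by (simp add: P_def)
  qed
  have hq: "q holomorphic_on A" for A
    using holomorphic_prod_list[of es A] by (simp add: q_def[abs_def])
  have ball: "q s = exp (- P s)" if "s \<in> ball 0 1" for s
    by (rule analytic_continuation_open[of "ball 0 r" "ball 0 1" q "\<lambda>s. exp (- P s)"])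
       (use r small that hP hq in auto)
  have "uniform_limit (cball 0 1) (\<lambda>N s. \<Sum>n<N. a n * s ^ n) P sequentially"
    unfolding P_def by (rule Weierstrass_m_test[OF _ sm]) (use bd in auto)
  then have "continuous_on (cball 0 1) P"
    by (rule uniform_limit_theorem[rotated]) (auto intro!: always_eventually continuous_intros)
  moreover have "continuous_on (cball 0 1) q"
    by (intro holomorphic_on_imp_continuous_on hq)
  ultimately have "continuous_on (closure (ball 0 1)) (\<lambda>s. q s - exp (- P s))"
    by (auto intro!: continuous_intros)
  then have "q 1 - exp (- P 1) = 0"
    by (rule continuous_constant_on_closure) (use ball in auto)
  then show ?thesis by (simp add: q_def P_def a_def)
qed

text \<open>The lists may differ in length, so \<open>m = 0\<close> is excluded. Near 0 both
  products are exponentials of the same series; being entire in \<open>s\<close>, they also agree at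
  \<open>s = 1\<close>, whether or not the series converges there.\<close>

lemma prod_list_eq_of_power_sums:
  fixes es es' :: "complex list"
  assumes "\<And>m. m > 0 \<Longrightarrow> (\<Sum>e\<leftarrow>es. e ^ m) = (\<Sum>e\<leftarrow>es'. e ^ m)"
  shows "(\<Prod>e\<leftarrow>es. 1 - e) = (\<Prod>e\<leftarrow>es'. 1 - e)"
proof -
  obtain r where r: "0 < r" "\<And>s e. cmod s < r \<Longrightarrow> e \<in> set es \<Longrightarrow> cmod (s * e) < 1"
    using small_radius by blast
  obtain r' where r': "0 < r'" "\<And>s e. cmod s < r' \<Longrightarrow> e \<in> set es' \<Longrightarrow> cmod (s * e) < 1"
    using small_radius by blast
  have small: "(\<Prod>e\<leftarrow>es. 1 - s * e) = (\<Prod>e\<leftarrow>es'. 1 - s * e)" if "s \<in> ball 0 (min r r')" for s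
  proof -
    have s: "cmod s < r" "cmod s < r'" using that by auto
    obtain S where S: "(\<lambda>n. (\<Sum>e\<leftarrow>es. e ^ n) / of_nat n * s ^ n) sums S" "(\<Prod>e\<leftarrow>es. 1 - s * e) = exp (- S)"
      using prod_list_exp_small[OF r(2)[OF s(1)]] by blast
    obtain S' where S': "(\<lambda>n. (\<Sum>e\<leftarrow>es'. e ^ n) / of_nat n * s ^ n) sums S'" "(\<Prod>e\<leftarrow>es'. 1 - s * e) = exp (- S')"
      using prod_list_exp_small[OF r'(2)[OF s(2)]] by blast
    have "(\<lambda>n. (\<Sum>e\<leftarrow>es. e ^ n) / of_nat n * s ^ n) = (\<lambda>n. (\<Sum>e\<leftarrow>es'. e ^ n) / of_nat n * s ^ n)"
    proof
      fix n show "(\<Sum>e\<leftarrow>es. e ^ n) / of_nat n * s ^ n = (\<Sum>e\<leftarrow>es'. e ^ n) / of_nat n * s ^ n"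
        using assms[of n] by (cases "n = 0") auto
    qed
    then have "S = S'" using sums_unique2[OF S(1)] S'(1) by simp
    then show ?thesis using S S' by simp
  qed
  have "(\<lambda>s. \<Prod>e\<leftarrow>es. 1 - s * e) 1 = (\<lambda>s. \<Prod>e\<leftarrow>es'. 1 - s * e) 1"
    by (rule analytic_continuation_open[of "ball 0 (min r r')" UNIV])
       (use r r' small holomorphic_prod_list in auto)
  then show ?thesis by simp
qed

text \<open>The index sets may have different sizes, as for a graph and its block graph.\<close>

lemma det_fun_eq_of_traces:
  assumes "finite V" "finite W" "\<And>m. m > 0 \<Longrightarrow> trace_pow V M m = trace_pow W N m"
  shows "det_fun V (\<lambda>v w. (if v = w then 1 else 0) - M v w) = det_fun W (\<lambda>v w. (if v = w then 1 else 0) - N v w)"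
proof -
  obtain es where es: "\<And>s. det_fun V (\<lambda>v w. (if v = w then 1 else 0) - s * M v w) = (\<Prod>e\<leftarrow>es. 1 - s * e)"
    "\<And>m. trace_pow V M m = (\<Sum>e\<leftarrow>es. e ^ m)" using eigenvalue_list[OF assms(1)] by blast
  obtain es' where es': "\<And>s. det_fun W (\<lambda>v w. (if v = w then 1 else 0) - s * N v w) = (\<Prod>e\<leftarrow>es'. 1 - s * e)"
    "\<And>m. trace_pow W N m = (\<Sum>e\<leftarrow>es'. e ^ m)" using eigenvalue_list[OF assms(2)] by blast
  have "(\<Prod>e\<leftarrow>es. 1 - e) = (\<Prod>e\<leftarrow>es'. 1 - e)"
    by (rule prod_list_eq_of_power_sums) (use assms(3) es(2) es'(2) in simp)
  then show ?thesis using es(1)[of 1] es'(1)[of 1] by simp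
qed

lemma det_fun_exp_traces:
  assumes "finite V" "summable (\<lambda>n. cmod (trace_pow V M n / of_nat n))"
  shows "det_fun V (\<lambda>v w. (if v = w then 1 else 0) - M v w) = exp (- (\<Sum>n. trace_pow V M n / of_nat n))"
proof -
  obtain es where es: "\<And>s. det_fun V (\<lambda>v w. (if v = w then 1 else 0) - s * M v w) = (\<Prod>e\<leftarrow>es. 1 - s * e)"
    "\<And>m. trace_pow V M m = (\<Sum>e\<leftarrow>es. e ^ m)" using eigenvalue_list[OF assms(1)] by blast
  show ?thesis using prod_list_exp[of es] assms(2) es(1)[of 1] unfolding es(2) by simp
qed



section \<open>Weighted adjacency matrices\<close>

context fin_digraph
begin

definition wmat :: "('b \<Rightarrow> complex) \<Rightarrow> 'a \<Rightarrow> 'a \<Rightarrow> complex" where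
  "wmat \<omega> v w = (\<Sum>e | e \<in> arcs G \<and> tail G e = v \<and> head G e = w. \<omega> e)"

definition walks :: "'a \<Rightarrow> nat \<Rightarrow> 'a \<Rightarrow> 'b list set" where
  "walks v m w = {\<alpha>. length \<alpha> = m \<and> awalk v \<alpha> w}"

lemma finite_walks: "finite (walks v m w)"
proof (rule finite_subset)
  show "walks v m w \<subseteq> {\<alpha>. set \<alpha> \<subseteq> arcs G \<and> length \<alpha> = m}" by (auto simp: walks_def awalk_def)
qed (simp add: finite_lists_length_eq)

lemma pow_fun_walks:
  assumes "v \<in> verts G" "w \<in> verts G"
  shows "pow_fun (verts G) (wmat \<omega>) m v w = (\<Sum>\<alpha>\<in>walks v m w. \<Prod>e\<leftarrow>\<alpha>. \<omega> e)"
  using assms(2)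
proof (induction m arbitrary: w)
  case 0
  have "walks v 0 w = (if v = w then {[]} else {})"
    using assms(1) by (auto simp: walks_def awalk_def)
  then show ?case by simp
next
  case (Suc m)
  let ?E = "\<lambda>u w. {e. e \<in> arcs G \<and> tail G e = u \<and> head G e = w}"
  let ?S = "SIGMA u:verts G. walks v m u \<times> ?E u w"
  have bij: "bij_betw (\<lambda>(u,\<alpha>,e). \<alpha> @ [e]) ?S (walks v (Suc m) w)"
  proof (rule bij_betwI')
    fix x y assume "x \<in> ?S" "y \<in> ?S"
    then show "((\<lambda>(u,\<alpha>,e). \<alpha> @ [e]) x = (\<lambda>(u,\<alpha>,e). \<alpha> @ [e]) y) = (x = y)" by auto
  next
    fix x assume "x \<in> ?S"
    then show "(\<lambda>(u,\<alpha>,e). \<alpha> @ [e]) x \<in> walks v (Suc m) w"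
      by (auto simp: walks_def awalk_append_iff awalk_Cons_iff awalk_Nil_iff)
  next
    fix \<beta> assume "\<beta> \<in> walks v (Suc m) w"
    then have b: "length \<beta> = Suc m" "awalk v \<beta> w" by (auto simp: walks_def)
    then have eq: "\<beta> = butlast \<beta> @ [last \<beta>]" by (cases \<beta>) auto
    then have "awalk v (butlast \<beta> @ [last \<beta>]) w" using b by simp
    then have "(tail G (last \<beta>), butlast \<beta>, last \<beta>) \<in> ?S"
      using b(1) by (auto simp: walks_def awalk_append_iff awalk_Cons_iff awalk_Nil_iff)
    then show "\<exists>x\<in>?S. \<beta> = (\<lambda>(u,\<alpha>,e). \<alpha> @ [e]) x"
      using eq by (intro bexI[of _ "(tail G (last \<beta>), butlast \<beta>, last \<beta>)"]) auto
  qed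
  have "pow_fun (verts G) (wmat \<omega>) (Suc m) v w = (\<Sum>u\<in>verts G. (\<Sum>\<alpha>\<in>walks v m u. \<Prod>e\<leftarrow>\<alpha>. \<omega> e) * (\<Sum>e\<in>?E u w. \<omega> e))"
    using Suc.IH by (simp add: wmat_def[of \<omega> _ w])
  also have "\<dots> = (\<Sum>u\<in>verts G. \<Sum>(\<alpha>,e)\<in>walks v m u \<times> ?E u w. (\<Prod>e\<leftarrow>\<alpha>. \<omega> e) * \<omega> e)"
    by (simp add: sum_product sum.cartesian_product)
  also have "\<dots> = (\<Sum>(u,\<alpha>,e)\<in>?S. (\<Prod>e\<leftarrow>\<alpha>. \<omega> e) * \<omega> e)"
    by (rule sum.Sigma) (auto simp: finite_walks)
  also have "\<dots> = (\<Sum>x\<in>?S. \<Prod>e\<leftarrow>(\<lambda>(u,\<alpha>,e). \<alpha> @ [e]) x. \<omega> e)"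
    by (rule sum.cong) auto
  also have "\<dots> = (\<Sum>\<alpha>\<in>walks v (Suc m) w. \<Prod>e\<leftarrow>\<alpha>. \<omega> e)"
    by (rule sum.reindex_bij_betw[OF bij])
  finally show ?case .
qed

lemma cas_nth:
  "cas v \<alpha> w \<Longrightarrow> \<alpha> \<noteq> [] \<Longrightarrow> tail G (hd \<alpha>) = v \<and> head G (last \<alpha>) = w \<and>
    (\<forall>i. Suc i < length \<alpha> \<longrightarrow> head G (\<alpha> ! i) = tail G (\<alpha> ! Suc i))"
proof (induction \<alpha> arbitrary: v)
  case (Cons e \<alpha>)
  show ?case
  proof (cases "\<alpha> = []")
    case False
    then have IH: "tail G (hd \<alpha>) = head G e \<and> head G (last \<alpha>) = w \<and>
      (\<forall>i. Suc i < length \<alpha> \<longrightarrow> head G (\<alpha> ! i) = tail G (\<alpha> ! Suc i))" using Cons by auto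
    have "head G ((e # \<alpha>) ! i) = tail G ((e # \<alpha>) ! Suc i)" if "Suc i < length (e # \<alpha>)" for i
      using IH that False by (cases i) (auto simp: hd_conv_nth)
    then show ?thesis using IH Cons.prems False by auto
  qed (use Cons in auto)
qed simp

text \<open>A closed walk of length \<open>m\<close> is the first period of a sequence fixed by the
  shift by \<open>m\<close>; the inverse map is \<open>\<alpha>\<^sup>\<omega>\<close>.\<close>

lemma trace_pow_closed:
  assumes m: "m > 0"
  shows "trace_pow (verts G) (wmat \<omega>) m = (\<Sum>x\<in>closed_seq m. \<Prod>i<m. \<omega> (x i))"
proof -
  let ?S = "SIGMA v:verts G. walks v m v"
  have bij: "bij_betw (\<lambda>x. (tail G (x 0), prefix m x)) (closed_seq m) ?S"
  proof (rule bij_betwI')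
    fix x y assume "x \<in> closed_seq m" "y \<in> closed_seq m"
    then show "((tail G (x 0), prefix m x) = (tail G (y 0), prefix m y)) = (x = y)"
      using inj_onD[OF inj_on_prefix_closed[OF m]] by auto
  next
    fix x assume x: "x \<in> closed_seq m"
    then have xm: "suffix m x = x" by (simp add: closed_seq_def)
    have "x m = x 0" using fun_cong[OF xm, of 0] by simp
    then have "awalk (tail G (x 0)) (prefix m x) (tail G (x 0))"
      using awalk_prefix[of x m] x by (simp add: closed_seq_def)
    moreover have "tail G (x 0) \<in> verts G" using x by (auto simp: closed_seq_def X_def)
    ultimately show "(tail G (x 0), prefix m x) \<in> ?S" by (simp add: walks_def)
  next
    fix p assume "p \<in> ?S"
    then obtain v \<alpha> where p: "p = (v, \<alpha>)" "length \<alpha> = m" "awalk v \<alpha> v" by (auto simp: walks_def)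
    have ne: "\<alpha> \<noteq> []" using m p by auto
    have arcs: "set \<alpha> \<subseteq> arcs G" and c: "cas v \<alpha> v" using p(3) by (auto simp: awalk_def)
    note cn = cas_nth[OF c ne]
    define x where "x = \<alpha>\<^sup>\<omega>"
    have x: "x n = \<alpha> ! (n mod m)" for n using ne p(2) by (simp add: x_def iter_def)
    have "x n \<in> arcs G \<and> head G (x n) = tail G (x (Suc n))" for n
    proof
      have lt: "n mod m < length \<alpha>" using m p by simp
      then show "x n \<in> arcs G" using arcs by (auto simp: x)
      show "head G (x n) = tail G (x (Suc n))"
      proof (cases "Suc (n mod m) < m")
        case True
        then have "Suc n mod m = Suc (n mod m)" by (simp add: mod_Suc)
        then show ?thesis using cn True p(2) by (simp add: x)
      next
        case False
        \<comment> \<open>At the end of a period the incidence required is the closing condition of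
          the walk.\<close>
        then have e: "Suc (n mod m) = m" using lt p(2) by simp
        then have "Suc n mod m = 0" by (simp add: mod_Suc)
        moreover have "n mod m = length \<alpha> - 1" using e p(2) by simp
        ultimately show ?thesis using cn ne by (simp add: x last_conv_nth hd_conv_nth)
      qed
    qed
    moreover have "suffix m x = x" by (rule ext) (simp add: x)
    ultimately have "x \<in> closed_seq m" by (auto simp: closed_seq_def X_def)
    moreover have "prefix m x = \<alpha>" using p(2) by (intro nth_equalityI) (auto simp: x)
    moreover have "tail G (x 0) = v" using cn ne by (simp add: x hd_conv_nth)
    ultimately show "\<exists>x\<in>closed_seq m. p = (tail G (x 0), prefix m x)" using p(1) by blast
  qed
  have "trace_pow (verts G) (wmat \<omega>) m = (\<Sum>v\<in>verts G. \<Sum>\<alpha>\<in>walks v m v. \<Prod>e\<leftarrow>\<alpha>. \<omega> e)"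
    unfolding trace_pow_def by (rule sum.cong) (auto simp: pow_fun_walks)
  also have "\<dots> = (\<Sum>(v,\<alpha>)\<in>?S. \<Prod>e\<leftarrow>\<alpha>. \<omega> e)"
    by (rule sum.Sigma) (auto simp: finite_walks)
  also have "\<dots> = (\<Sum>x\<in>closed_seq m. (\<lambda>(v,\<alpha>). \<Prod>e\<leftarrow>\<alpha>. \<omega> e) (tail G (x 0), prefix m x))"
    by (rule sum.reindex_bij_betw[OF bij, symmetric])
  also have "\<dots> = (\<Sum>x\<in>closed_seq m. \<Prod>i<m. \<omega> (x i))"
    by (rule sum.cong) (auto simp: subsequence_def comp_def prod.distinct_set_conv_list[symmetric] atLeast0LessThan)
  finally show ?thesis .
qed

lemma wmat_const: "wmat (\<lambda>_. c) v w = c * of_int (adj G v w)"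
  by (simp add: wmat_def adj_def mult.commute)

lemma det_wmat: "det_fun (verts G) (\<lambda>v w. (if v = w then 1 else 0) - wmat (\<lambda>_. 1) v w) = of_int (det_I_minus_A G)"
  unfolding det_fun_def det_I_minus_A_def det_on_def wmat_const
  by (simp add: if_distrib[of of_int] of_int_diff cong: if_cong)

end

text \<open>Laurent polynomials as functions of \<open>t > 0\<close>. The power \<open>t ^ N\<close>
  clears negative exponents, which may occur since only the cycle sums of the cocycle are known to
  be positive.\<close>

definition laurent :: "(real \<Rightarrow> complex) \<Rightarrow> bool" where
  "laurent f \<longleftrightarrow> (\<exists>N q. \<forall>t>0. f t * of_real t ^ N = poly q (of_real t))"

lemma laurent_const: "laurent (\<lambda>t. c)"
  unfolding laurent_def by (intro exI[of _ 0] exI[of _ "[:c:]"]) simp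

lemma laurent_powi: "laurent (\<lambda>t. of_real (t powi k))"
proof -
  have "complex_of_real (t powi k) * of_real t ^ nat (- k) = poly (monom 1 (nat k)) (of_real t)" if "t > 0" for t :: real
  proof (cases "k \<ge> 0")
    case True
    then show ?thesis by (simp add: power_int_def poly_monom)
  next
    case False
    then show ?thesis using that by (simp add: power_int_def poly_monom field_simps)
  qed
  then show ?thesis unfolding laurent_def by blast
qed

lemma laurent_add: assumes "laurent f" "laurent g" shows "laurent (\<lambda>t. f t + g t)"
proof -
  obtain N q M r where "\<And>t. t > 0 \<Longrightarrow> f t * of_real t ^ N = poly q (of_real t)"
    "\<And>t. t > 0 \<Longrightarrow> g t * of_real t ^ M = poly r (of_real t)"
    using assms unfolding laurent_def by metis
  then have "(f t + g t) * of_real t ^ (N + M) = poly (q * monom 1 M + r * monom 1 N) (of_real t)" if "t > 0" for t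
    using that by (simp add: poly_monom power_add algebra_simps)
  then show ?thesis unfolding laurent_def by blast
qed

lemma laurent_mult: assumes "laurent f" "laurent g" shows "laurent (\<lambda>t. f t * g t)"
proof -
  obtain N q M r where *: "\<And>t. t > 0 \<Longrightarrow> f t * of_real t ^ N = poly q (of_real t)"
    "\<And>t. t > 0 \<Longrightarrow> g t * of_real t ^ M = poly r (of_real t)"
    using assms unfolding laurent_def by metis
  have "(f t * g t) * of_real t ^ (N + M) = poly (q * r) (of_real t)" if "t > 0" for t
    using *[OF that, symmetric] by (simp add: power_add algebra_simps)
  then show ?thesis unfolding laurent_def by blast
qed

lemma laurent_sum: "(\<And>i. i \<in> S \<Longrightarrow> laurent (f i)) \<Longrightarrow> laurent (\<lambda>t. \<Sum>i\<in>S. f i t)"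
  by (induction S rule: infinite_finite_induct) (auto intro: laurent_const laurent_add)

lemma laurent_prod: "(\<And>i. i \<in> S \<Longrightarrow> laurent (f i)) \<Longrightarrow> laurent (\<lambda>t. \<Prod>i\<in>S. f i t)"
  by (induction S rule: infinite_finite_induct) (auto intro: laurent_const laurent_mult)

lemma laurent_diff: "laurent f \<Longrightarrow> laurent g \<Longrightarrow> laurent (\<lambda>t. f t - g t)"
  using laurent_add[of f "\<lambda>t. (-1) * g t"] laurent_mult[OF laurent_const[of "-1"], of g] by simp

lemma laurent_det_fun: "(\<And>v w. laurent (\<lambda>t. M t v w)) \<Longrightarrow> laurent (\<lambda>t. det_fun V (M t))"
  unfolding det_fun_def by (intro laurent_sum laurent_mult laurent_const laurent_prod)

text \<open>Once negative powers are cleared, the difference is a polynomial with infinitely many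
  roots.\<close>

lemma laurent_eq:
  assumes "laurent f" "laurent g" "\<delta> > 0" "\<And>t. 0 < t \<Longrightarrow> t < \<delta> \<Longrightarrow> f t = g t" "t > 0"
  shows "f t = g t"
proof -
  obtain N q where q: "\<And>t. t > 0 \<Longrightarrow> (f t - g t) * of_real t ^ N = poly q (of_real t)"
    using laurent_diff[OF assms(1,2)] unfolding laurent_def by metis
  have "of_real ` {0<..<\<delta>} \<subseteq> {z. poly q z = 0}"
  proof safe
    fix s assume "s \<in> {0<..<\<delta>}"
    then show "poly q (of_real s) = 0" using q[of s] assms(4)[of s] by simp
  qed
  moreover have "infinite (complex_of_real ` {0<..<\<delta>})"
    using infinite_Ioo[OF assms(3)] by (simp add: finite_image_iff inj_on_def)
  ultimately have "q = 0" using poly_roots_finite finite_subset by blast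
  then show ?thesis using q[OF assms(5)] assms(5) by simp
qed

section \<open>Higher block graphs\<close>

context lpa
begin

text \<open>The higher block graph, on which a function of the first \<open>k + 1\<close> edges of a path becomes a weight on
  arcs.\<close>
definition blocks :: "nat \<Rightarrow> ('e list, 'e list) pre_digraph" where
  "blocks k = \<lparr>verts = paths k, arcs = paths (Suc k), tail = butlast, head = tl\<rparr>"

lemma fin_blocks: "fin_digraph (blocks k)"
proof
  fix \<alpha> assume "\<alpha> \<in> arcs (blocks k)"
  then have \<alpha>: "pth \<alpha>" "length \<alpha> = Suc k" by (auto simp: blocks_def paths_def)
  then obtain e \<beta> where e: "\<alpha> = e # \<beta>" by (cases \<alpha>) auto
  have "\<alpha> = butlast \<alpha> @ [last \<alpha>]" using e by simp
  then have "pth (butlast \<alpha> @ [last \<alpha>])" using \<alpha> by simp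
  then show "tail (blocks k) \<alpha> \<in> verts (blocks k)"
    using \<alpha>(2) by (auto simp: blocks_def paths_def pth_append)
  show "head (blocks k) \<alpha> \<in> verts (blocks k)"
    using \<alpha> e by (auto simp: blocks_def paths_def pth_Cons)
qed (auto simp: blocks_def)

text \<open>\<open>k > 0\<close> makes each arc of the block graph contain two consecutive edges, so
  that a decoded sequence is seen to be a path.\<close>

lemma bij_blocks:
  assumes k: "k > 0"
  shows "bij_betw (\<lambda>x n. prefix (Suc k) (suffix n x)) (closed_seq m) (fin_digraph.closed_seq (blocks k) m)"
proof -
  interpret H: fin_digraph "blocks k" by (rule fin_blocks)
  have sh: "tl (prefix (Suc k) y) = butlast (prefix (Suc k) (suffix 1 y))" for y :: "nat \<Rightarrow> 'e"
    by (rule nth_equalityI) (auto simp: nth_tl nth_butlast simp del: subseq_to_Suc subsequence_shift)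
  show ?thesis
  proof (rule bij_betwI')
    fix x y assume "x \<in> closed_seq m" "y \<in> closed_seq m"
    have "x = y" if "(\<lambda>n. prefix (Suc k) (suffix n x)) = (\<lambda>n. prefix (Suc k) (suffix n y))"
    proof
      fix n
      have "prefix (Suc k) (suffix n x) ! 0 = prefix (Suc k) (suffix n y) ! 0" using fun_cong[OF that, of n] by simp
      then show "x n = y n" by (simp del: subseq_to_Suc subsequence_shift)
    qed
    then show "((\<lambda>n. prefix (Suc k) (suffix n x)) = (\<lambda>n. prefix (Suc k) (suffix n y))) = (x = y)" by blast
  next
    fix x assume x: "x \<in> closed_seq m"
    have xm: "suffix m x = x" and xX: "x \<in> X" using x by (auto simp: closed_seq_def)
    let ?\<xi> = "\<lambda>n. prefix (Suc k) (suffix n x)"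
    have "?\<xi> n \<in> arcs (blocks k) \<and> head (blocks k) (?\<xi> n) = tail (blocks k) (?\<xi> (Suc n))" for n
    proof
      show "?\<xi> n \<in> arcs (blocks k)"
        using X_prefix[OF X_suffix[OF xX]] by (simp add: blocks_def paths_def del: subseq_to_Suc subsequence_shift)
      show "head (blocks k) (?\<xi> n) = tail (blocks k) (?\<xi> (Suc n))"
        using sh[of "suffix n x"] by (simp add: blocks_def del: subseq_to_Suc subsequence_shift)
    qed
    moreover have "suffix m ?\<xi> = ?\<xi>"
    proof
      fix n
      have "suffix (m + n) x = suffix n (suffix m x)" by simp
      then have "suffix (m + n) x = suffix n x" unfolding xm .
      then show "suffix m ?\<xi> n = ?\<xi> n" by (simp only: suffix_nth)
    qed
    ultimately show "?\<xi> \<in> H.closed_seq m" unfolding H.closed_seq_def H.X_def by blast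
  next
    fix \<xi> assume "\<xi> \<in> H.closed_seq m"
    then have \<xi>: "\<And>n. \<xi> n \<in> paths (Suc k)" "\<And>n. tl (\<xi> n) = butlast (\<xi> (Suc n))" and per: "suffix m \<xi> = \<xi>"
      unfolding H.closed_seq_def H.X_def by (auto simp: blocks_def)
    have len: "length (\<xi> n) = Suc k" for n using \<xi>(1) by (simp add: paths_def)
    define x where "x n = \<xi> n ! 0" for n
    \<comment> \<open>By the overlap condition a letter moves one place to the left from each block
      to the next, so every letter is the first letter of a later block.\<close>
    have nth: "\<xi> n ! j = x (n + j)" if "j \<le> k" for n j
      using that
    proof (induction j arbitrary: n)
      case (Suc j)
      have "\<xi> n ! Suc j = tl (\<xi> n) ! j" using Suc.prems len by (simp add: nth_tl)
      also have "\<dots> = \<xi> (Suc n) ! j" unfolding \<xi>(2) using Suc.prems len by (simp add: nth_butlast)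
      finally show ?case using Suc by simp
    qed (simp add: x_def)
    have eq: "\<xi> n = prefix (Suc k) (suffix n x)" for n
      by (rule nth_equalityI) (use len nth in \<open>auto simp del: subseq_to_Suc subsequence_shift\<close>)
    have "x \<in> X" unfolding X_def
    proof (intro CollectI allI)
      fix n
      obtain k' where k': "k = Suc k'" using k by (cases k) auto
      obtain e f \<beta> where ef: "\<xi> n = e # f # \<beta>" using len[of n] k' by (metis length_Suc_conv)
      have "e = x n" "f = x (Suc n)" using nth[of 0 n] nth[of 1 n] k' by (auto simp: ef)
      moreover have "pth (e # f # \<beta>)" using \<xi>(1)[of n] ef by (simp add: paths_def)
      ultimately show "x n \<in> arcs G \<and> head G (x n) = tail G (x (Suc n))" by (simp add: pth_Cons)
    qed
    moreover have "suffix m x = x"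
    proof
      fix n show "suffix m x n = x n" using fun_cong[OF per, of n] by (simp add: x_def)
    qed
    ultimately have "x \<in> closed_seq m" by (simp add: closed_seq_def)
    moreover have "\<xi> = (\<lambda>n. prefix (Suc k) (suffix n x))" using eq by (rule ext)
    ultimately show "\<exists>x\<in>closed_seq m. \<xi> = (\<lambda>n. prefix (Suc k) (suffix n x))" by blast
  qed
qed

end

section \<open>Comparison of the determinants\<close>

context lpa_pair
begin

theorem det_eq: "det_I_minus_A E = det_I_minus_A F"
proof -
  obtain M where M: "\<And>x x'. x \<in> B.X \<Longrightarrow> x' \<in> B.X \<Longrightarrow> prefix M x = prefix M x' \<Longrightarrow> cocycle x = cocycle x'"
    using cocycle_local by blast
  \<comment> \<open>\<open>Suc\<close> gives \<open>k > 0\<close>, which \<open>bij_blocks\<close>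
    requires. The weight \<open>\<kappa>\<close> of a block is the cocycle of any path starting with
    it, well defined because \<open>Suc k\<close> exceeds \<open>M\<close>.\<close>
  define k where "k = Suc M"
  define \<kappa> where "\<kappa> \<alpha> = cocycle (SOME x. x \<in> B.X \<and> prefix (Suc k) x = \<alpha>)" for \<alpha>
  have \<kappa>: "\<kappa> (prefix (Suc k) x) = cocycle x" if x: "x \<in> B.X" for x
  proof -
    let ?y = "SOME y. y \<in> B.X \<and> prefix (Suc k) y = prefix (Suc k) x"
    have y: "?y \<in> B.X \<and> prefix (Suc k) ?y = prefix (Suc k) x"
      by (rule someI[of _ x]) (use x in simp)
    then have "prefix M ?y = prefix M x" using prefix_mono_eq[where n="Suc k" and m=M and x="?y" and y=x] by (simp add: k_def)
    then show ?thesis using M[of ?y x] x y unfolding \<kappa>_def by simp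
  qed
  interpret H: fin_digraph "B.blocks k" by (rule B.fin_blocks)
  have trH: "trace_pow (verts (B.blocks k)) (H.wmat (\<lambda>\<alpha>. of_real (t powi \<kappa> \<alpha>))) m
      = of_real (\<Sum>x\<in>B.closed_seq m. t powi cocycle_sum m x)" if "m > 0" "t > 0" for m and t :: real
  proof -
    have "trace_pow (verts (B.blocks k)) (H.wmat (\<lambda>\<alpha>. of_real (t powi \<kappa> \<alpha>))) m
      = (\<Sum>x\<in>B.closed_seq m. \<Prod>i<m. of_real (t powi \<kappa> (prefix (Suc k) (suffix i x))))"
      unfolding H.trace_pow_closed[OF that(1)]
      by (rule sum.reindex_bij_betw[OF B.bij_blocks, symmetric]) (simp add: k_def)
    also have "\<dots> = (\<Sum>x\<in>B.closed_seq m. of_real (t powi cocycle_sum m x))"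
    proof (rule sum.cong)
      fix x assume "x \<in> B.closed_seq m"
      then have x: "suffix i x \<in> B.X" for i using B.X_suffix by (auto simp: B.closed_seq_def)
      have "(\<Prod>i<m. complex_of_real (t powi \<kappa> (prefix (Suc k) (suffix i x)))) = (\<Prod>i<m. of_real (t powi cocycle (suffix i x)))"
        using \<kappa>[OF x] by (simp del: subseq_to_Suc subsequence_shift)
      also have "\<dots> = of_real (t powi cocycle_sum m x)"
        unfolding cocycle_sum_def using that(2) by (induction m) (auto simp: power_int_add)
      finally show "(\<Prod>i<m. complex_of_real (t powi \<kappa> (prefix (Suc k) (suffix i x)))) = of_real (t powi cocycle_sum m x)" .
    qed simp
    finally show ?thesis by simp
  qed
  have trE: "trace_pow (verts E) (A.wmat (\<lambda>_. of_real t)) m = of_real (\<Sum>y\<in>A.closed_seq m. t ^ m)" if "m > 0" for m and t :: real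
    unfolding A.trace_pow_closed[OF that] by simp
  have trF: "trace_pow (verts F) (B.wmat (\<lambda>_. 1)) m = of_nat (card (B.closed_seq m))" if "m > 0" for m
    unfolding B.trace_pow_closed[OF that] by simp
  \<comment> \<open>At most \<open>card (arcs E) ^ m\<close> points have period \<open>m\<close>, so
    for \<open>t < \<delta>\<close> a geometric series dominates the series of \<open>E\<close>. The
    added 1 avoids division by zero.\<close>
  define \<delta> where "\<delta> = 1 / (1 + real (card (arcs E)))"
  have small: "det_fun (verts (B.blocks k)) (\<lambda>v w. (if v = w then 1 else 0) - H.wmat (\<lambda>\<alpha>. of_real (t powi \<kappa> \<alpha>)) v w)
     = det_fun (verts E) (\<lambda>v w. (if v = w then 1 else 0) - A.wmat (\<lambda>_. of_real t) v w)"
    if t: "0 < t" "t < \<delta>" for t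
  proof -
    define a where "a n = (\<Sum>x\<in>B.closed_seq n. t powi cocycle_sum n x) / real n" for n
    define b where "b n = (\<Sum>y\<in>A.closed_seq n. t ^ n) / real n" for n
    have nn: "a n \<ge> 0" "b n \<ge> 0" for n using t by (auto simp: a_def b_def intro!: divide_nonneg_nonneg sum_nonneg)
    have zeta: "(\<Sum>n. ennreal (a (Suc n))) = (\<Sum>n. ennreal (b (Suc n)))"
      using zeta_eq[OF t(1)] by (simp only: a_def b_def)
    define r where "r = real (card (arcs E)) * t"
    have r: "0 \<le> r" "r < 1"
    proof -
      have "real (card (arcs E)) * t \<le> (1 + real (card (arcs E))) * t" using t by simp
      also have "\<dots> < 1" using t(2) unfolding \<delta>_def by (simp add: field_simps)
      finally show "r < 1" by (simp add: r_def)
    qed (use t in \<open>simp add: r_def\<close>)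
    have bb: "b (Suc n) \<le> r ^ Suc n" for n
    proof -
      have "b (Suc n) \<le> real (card (A.closed_seq (Suc n))) * t ^ Suc n"
        using t divide_left_mono[of 1 "real (Suc n)" "real (card (A.closed_seq (Suc n))) * t ^ Suc n"]
        by (simp add: b_def)
      also have "\<dots> \<le> real (card (arcs E) ^ Suc n) * t ^ Suc n"
      proof (rule mult_right_mono)
        show "real (card (A.closed_seq (Suc n))) \<le> real (card (arcs E) ^ Suc n)"
          using A.card_closed[of "Suc n"] by (simp only: of_nat_le_iff zero_less_Suc)
      qed (use t in simp)
      also have "\<dots> = r ^ Suc n" by (simp add: r_def power_mult_distrib)
      finally show ?thesis .
    qed
    have sb: "summable (\<lambda>n. b (Suc n))"
    proof (rule summable_comparison_test')
      show "summable (\<lambda>n. r ^ Suc n)" using r by (simp add: summable_Suc_iff summable_geometric)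
      show "norm (b (Suc n)) \<le> r ^ Suc n" if "n \<ge> 0" for n using bb nn by simp
    qed
    have "(\<Sum>n. ennreal (b (Suc n))) = ennreal (\<Sum>n. b (Suc n))"
      by (rule suminf_ennreal2) (use nn sb in auto)
    \<comment> \<open>Convergence over \<open>F\<close> is not estimated but inherited: its series
      has the same finite sum.\<close>
    then have top: "(\<Sum>n. ennreal (a (Suc n))) \<noteq> Orderings.top" unfolding zeta by simp
    have sa: "summable (\<lambda>n. a (Suc n))" by (rule summable_suminf_not_top) (use nn top in auto)
    have "ennreal (\<Sum>n. a (Suc n)) = (\<Sum>n. ennreal (a (Suc n)))"
      by (rule suminf_ennreal2[symmetric]) (use nn sa in auto)
    also have "\<dots> = ennreal (\<Sum>n. b (Suc n))"
      unfolding zeta by (rule suminf_ennreal2) (use nn sb in auto)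
    finally have eq: "(\<Sum>n. a (Suc n)) = (\<Sum>n. b (Suc n))"
      using ennreal_inj[OF suminf_nonneg[OF sa nn(1)] suminf_nonneg[OF sb nn(2)]] by simp
    have sab: "summable a" "summable b"
      using summable_Suc_iff[of a] summable_Suc_iff[of b] sa sb by simp_all
    have "a 0 = 0" "b 0 = 0" by (simp_all add: a_def b_def)
    then have "suminf a = suminf b"
      using suminf_split_head[OF sab(1)] suminf_split_head[OF sab(2)] eq by linarith
    note ab = this sab
    \<comment> \<open>For \<open>n = 0\<close> the trace is the number of vertices, but the division
      by zero makes both sides 0.\<close>
    have ta: "trace_pow (verts (B.blocks k)) (H.wmat (\<lambda>\<alpha>. of_real (t powi \<kappa> \<alpha>))) n / of_nat n = of_real (a n)" for n
      using trH[of n t] t by (cases "n = 0") (auto simp: a_def)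
    have tb: "trace_pow (verts E) (A.wmat (\<lambda>_. of_real t)) n / of_nat n = of_real (b n)" for n
      using trE[of n t] by (cases "n = 0") (auto simp: b_def)
    have "det_fun (verts (B.blocks k)) (\<lambda>v w. (if v = w then 1 else 0) - H.wmat (\<lambda>\<alpha>. of_real (t powi \<kappa> \<alpha>)) v w)
      = exp (- (\<Sum>n. of_real (a n)))"
      using det_fun_exp_traces[OF H.finite_verts, of "H.wmat (\<lambda>\<alpha>. of_real (t powi \<kappa> \<alpha>))"] nn ab unfolding ta by simp
    also have "(\<Sum>n. complex_of_real (a n)) = (\<Sum>n. of_real (b n))"
      using suminf_of_real[OF ab(2), where 'a=complex] suminf_of_real[OF ab(3), where 'a=complex] ab(1) by simp
    also have "exp (- (\<Sum>n. complex_of_real (b n))) =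
      det_fun (verts E) (\<lambda>v w. (if v = w then 1 else 0) - A.wmat (\<lambda>_. of_real t) v w)"
      using det_fun_exp_traces[OF A.finite_verts, of "A.wmat (\<lambda>_. of_real t)"] nn ab unfolding tb by simp
    finally show ?thesis .
  qed
  have "det_fun (verts (B.blocks k)) (\<lambda>v w. (if v = w then 1 else 0) - H.wmat (\<lambda>\<alpha>. of_real (1 powi \<kappa> \<alpha>)) v w)
     = det_fun (verts E) (\<lambda>v w. (if v = w then 1 else 0) - A.wmat (\<lambda>_. of_real 1) v w)"
  proof (rule laurent_eq[where \<delta> = \<delta> and t = 1])
    show "laurent (\<lambda>t. det_fun (verts (B.blocks k)) (\<lambda>v w. (if v = w then 1 else 0) - H.wmat (\<lambda>\<alpha>. of_real (t powi \<kappa> \<alpha>)) v w))"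
      unfolding H.wmat_def by (intro laurent_det_fun laurent_diff laurent_const laurent_sum laurent_powi)
    have "laurent (\<lambda>t. complex_of_real t)" using laurent_powi[of 1] by simp
    then show "laurent (\<lambda>t. det_fun (verts E) (\<lambda>v w. (if v = w then 1 else 0) - A.wmat (\<lambda>_. of_real t) v w))"
      unfolding A.wmat_def by (intro laurent_det_fun laurent_diff laurent_const laurent_sum)
  qed (use small in \<open>auto simp: \<delta>_def\<close>)
  then have "det_fun (verts (B.blocks k)) (\<lambda>v w. (if v = w then 1 else 0) - H.wmat (\<lambda>_. 1) v w) = of_int (det_I_minus_A E)"
    by (simp add: A.det_wmat)
  \<comment> \<open>With all weights 1 the traces count periodic points, and the block graph has as
    many of each period as \<open>F\<close>.\<close>
  moreover have "det_fun (verts (B.blocks k)) (\<lambda>v w. (if v = w then 1 else 0) - H.wmat (\<lambda>_. 1) v w) =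
     det_fun (verts F) (\<lambda>v w. (if v = w then 1 else 0) - B.wmat (\<lambda>_. 1) v w)"
    by (rule det_fun_eq_of_traces) (use trH[of _ 1] trF in auto)
  ultimately have "(of_int (det_I_minus_A E) :: complex) = of_int (det_I_minus_A F)"
    by (simp add: B.det_wmat)
  then show ?thesis by simp
qed

end

section \<open>The star, projections and the diagonal modulo the ideal\<close>

context lpa
begin

text \<open>The matrix of \<open>fa_star x\<close> is the conjugate transpose of a zero matrix, and
  faithfulness returns this to the ideal. Hence the star respects congruence of
  representatives.\<close>

lemma ideal_star: assumes "x \<in> I" shows "fa_star x \<in> I"
proof (rule faithful)
  have x: "x \<in> LFA" using assms by (rule ideal_FA)
  then show "fa_star x \<in> LFA" by (rule FA_star)
  fix y q assume y: "y \<in> X"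
  show "row (fa_star x) (y, 0) q = 0"
  proof (cases "fst q \<in> X")
    case True
    then show ?thesis using row_star[OF x, of "(y,0)" q] y ideal_row[OF assms, of q] by simp
  next
    case False
    then show ?thesis using row_in_X[OF FA_star[OF x], of "(y,0)" q] y by auto
  qed
qed

lemma diag_span_is_diag: "d \<in> diag_span R G \<Longrightarrow> d \<in> LFA \<and> is_diag d"
proof (induction rule: diag_span.induct)
  case zero
  show ?case by (simp add: is_diag_def row_def)
next
  case (step x c g)
  have "g \<in> LFA \<and> is_diag g"
    using step.hyps(3) unfolding diag_gens_def
  proof (elim UnE CollectE exE conjE)
    fix v assume "g = mon [GV v]" "v \<in> verts G"
    then show ?thesis by (auto simp: is_diag_def intro!: FA_mon split: if_splits)
  next
    fix \<alpha> u v assume g: "g = mon (map GE \<alpha> @ rev (map GS \<alpha>))" "\<alpha> \<noteq> []" "awalk u \<alpha> v"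
    then have "set \<alpha> \<subseteq> arcs G" by (simp add: awalk_def)
    then have "g \<in> LFA" unfolding g(1) using g(2) by (intro FA_mon) auto
    then show ?thesis using is_diag_proj_word[of \<alpha>] g(1) by (simp add: proj_word_def)
  qed
  then show ?case
    using step by (auto simp: is_diag_def row_add row_smult FA_add FA_smult) (metis add.right_neutral mult_zero_right)+
qed

lemma is_diag_eqv: "a \<approx>\<^sub>L d \<Longrightarrow> a \<in> LFA \<Longrightarrow> d \<in> LFA \<Longrightarrow> is_diag d \<Longrightarrow> is_diag a"
  unfolding is_diag_def using eqv_row[of a d] by simp

lemma proj_word_idem: assumes "pth \<alpha>" "\<alpha> \<noteq> []" shows "fa_mult (mon (proj_word \<alpha>)) (mon (proj_word \<alpha>)) \<approx>\<^sub>L mon (proj_word \<alpha>)"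
  unfolding eqv_def
proof (rule faithful)
  note F = FA_proj_word[OF assms]
  show "fa_diff (fa_mult (mon (proj_word \<alpha>)) (mon (proj_word \<alpha>))) (mon (proj_word \<alpha>)) \<in> LFA" by (intro FA_diff FA_mult F)
  fix x q assume x: "x \<in> X"
  show "row (fa_diff (fa_mult (mon (proj_word \<alpha>)) (mon (proj_word \<alpha>))) (mon (proj_word \<alpha>))) (x, 0) q = 0"
    using x F by (simp add: row_diff FA_mult row_mult_diag_left is_diag_proj_word dval_proj_word ract_proj_word)
qed

lemma star_proj_word: "fa_star (mon (proj_word \<alpha>)) = mon (proj_word \<alpha>)"
  unfolding fa_star_mon by (simp add: proj_word_def word_star_def rev_map comp_def)

end

section \<open>From the isomorphism to the determinants\<close>

lemma star_iso_lpa_pair: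
  fixes E :: "('v1,'e1) pre_digraph" and F :: "('v2,'e2) pre_digraph"
  assumes "lpa E R" "lpa F R" and iso: "star_iso_on R E F \<phi>"
    and proj: "\<forall>p. is_projection R F p \<longrightarrow> in_diagonal R F p"
  shows "lpa_pair E F R (\<lambda>a b. a \<in> FA R E \<and> b \<in> FA R F \<and> lpa_eq R F (\<phi> a) b)"
proof -
  interpret A: lpa E R by fact
  interpret B: lpa F R by fact
  have eA: "lpa_eq R E a b \<longleftrightarrow> A.eqv a b" for a b by (simp add: lpa_eq_def A.eqv_def)
  have eB: "lpa_eq R F a b \<longleftrightarrow> B.eqv a b" for a b by (simp add: lpa_eq_def B.eqv_def)
  let ?P = "\<lambda>a b. a \<in> FA R E \<and> b \<in> FA R F \<and> B.eqv (\<phi> a) b"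
  have \<phi>F: "\<phi> a \<in> FA R F" if "a \<in> FA R E" for a using iso that by (auto simp: star_iso_on_def)
  have \<phi>iff: "A.eqv a b \<longleftrightarrow> B.eqv (\<phi> a) (\<phi> b)" if "a \<in> FA R E" "b \<in> FA R E" for a b
    using iso that unfolding star_iso_on_def eA eB by blast
  have \<phi>surj: "\<exists>a\<in>FA R E. B.eqv (\<phi> a) y" if "y \<in> FA R F" for y
    using iso that unfolding star_iso_on_def eB by blast
  have \<phi>add: "B.eqv (\<phi> (fa_add a b)) (fa_add (\<phi> a) (\<phi> b))"
    and \<phi>mult: "B.eqv (\<phi> (fa_mult a b)) (fa_mult (\<phi> a) (\<phi> b))" if "a \<in> FA R E" "b \<in> FA R E" for a b
    using iso that unfolding star_iso_on_def eB by blast+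
  have \<phi>smult: "B.eqv (\<phi> (fa_smult c a)) (fa_smult c (\<phi> a))" if "c \<in> R" "a \<in> FA R E" for a c
    using iso that unfolding star_iso_on_def eB by blast
  have \<phi>star: "B.eqv (\<phi> (fa_star a)) (fa_star (\<phi> a))" if "a \<in> FA R E" for a
    using iso that unfolding star_iso_on_def eB by blast
  \<comment> \<open>\<open>\<phi>\<close> is additive only up to congruence, but
    \<open>z + z\<close> being congruent to \<open>z\<close> already puts \<open>z\<close> into the
    ideal.\<close>
  have \<phi>0: "\<phi> (\<lambda>w. 0) \<in> LPA_ideal R F"
  proof -
    let ?z = "\<phi> (\<lambda>w. 0)"
    have "fa_add (\<lambda>w. 0) (\<lambda>w. 0) = (\<lambda>w::('v1,'e1) gen list. 0::complex)" by (simp add: fa_add_def)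
    then have "B.eqv ?z (fa_add ?z ?z)" using \<phi>add[of "\<lambda>w. 0" "\<lambda>w. 0"] by simp
    then have "B.eqv (fa_add ?z ?z) ?z" by (rule B.eqv_sym)
    moreover have "fa_diff (fa_add ?z ?z) ?z = ?z" by (simp add: fa_diff_def fa_add_def)
    ultimately show ?thesis by (simp add: B.eqv_def)
  qed
  have add: "?P (fa_add a a') (fa_add b b')" if "?P a b" "?P a' b'" for a b a' b'
    using that \<phi>add[of a a'] B.eqv_add[of "\<phi> a" b "\<phi> a'" b'] B.eqv_trans A.FA_add B.FA_add by blast
  have mult: "?P (fa_mult a a') (fa_mult b b')" if "?P a b" "?P a' b'" for a b a' b'
    using that \<phi>mult[of a a'] B.eqv_mult[of "\<phi> a" b "\<phi> a'" b'] B.eqv_trans A.FA_mult B.FA_mult \<phi>F by blast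
  have smult: "?P (fa_smult c a) (fa_smult c b)" if "?P a b" "c \<in> R" for a b c
    using that \<phi>smult[of c a] B.eqv_smult[of "\<phi> a" b c] B.eqv_trans A.FA_smult B.FA_smult by blast
  have star: "?P (fa_star a) (fa_star b)" if "?P a b" for a b
  proof -
    have "fa_star (fa_diff (\<phi> a) b) = fa_diff (fa_star (\<phi> a)) (fa_star b)"
      by (simp add: fa_star_def fa_diff_def)
    then have "B.eqv (fa_star (\<phi> a)) (fa_star b)" using B.ideal_star[of "fa_diff (\<phi> a) b"] that by (simp add: B.eqv_def)
    then show ?thesis using that \<phi>star[of a] B.eqv_trans A.FA_star B.FA_star by blast
  qed
  have ideal: "a \<in> LPA_ideal R E \<longleftrightarrow> b \<in> LPA_ideal R F" if "?P a b" for a b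
  proof -
    have "a \<in> LPA_ideal R E \<longleftrightarrow> A.eqv a (\<lambda>w. 0)" by (simp add: A.eqv_zero)
    also have "\<dots> \<longleftrightarrow> B.eqv (\<phi> a) (\<phi> (\<lambda>w. 0))" by (rule \<phi>iff) (use that in auto)
    also have "\<dots> \<longleftrightarrow> \<phi> a \<in> LPA_ideal R F"
      using \<phi>0 B.eqv_zero B.eqv_trans B.eqv_sym B.eqv_ideal by metis
    also have "\<dots> \<longleftrightarrow> b \<in> LPA_ideal R F" using that B.eqv_ideal by blast
    finally show ?thesis .
  qed
  have diag: "B.is_diag b" if \<alpha>: "A.pth \<alpha>" "\<alpha> \<noteq> []" and P: "?P (mon (A.proj_word \<alpha>)) b" for \<alpha> b
  proof -
    note p = A.FA_proj_word[OF \<alpha>]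
    have "B.eqv (fa_mult (\<phi> (mon (A.proj_word \<alpha>))) (\<phi> (mon (A.proj_word \<alpha>)))) (\<phi> (mon (A.proj_word \<alpha>)))"
      using \<phi>mult[OF p p] \<phi>iff[OF A.FA_mult[OF p p] p] A.proj_word_idem[OF \<alpha>] B.eqv_trans B.eqv_sym by blast
    moreover have "B.eqv (fa_star (\<phi> (mon (A.proj_word \<alpha>)))) (\<phi> (mon (A.proj_word \<alpha>)))"
      using \<phi>star[OF p] B.eqv_sym by (simp add: A.star_proj_word)
    ultimately have "is_projection R F (\<phi> (mon (A.proj_word \<alpha>)))"
      using \<phi>F[OF p] by (simp add: is_projection_def eB)
    then obtain d where d: "d \<in> diag_span R F" "B.eqv (\<phi> (mon (A.proj_word \<alpha>))) d"
      using proj unfolding in_diagonal_def eB by blast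
    have "B.eqv b d" using P d(2) B.eqv_sym B.eqv_trans by blast
    then show ?thesis using B.is_diag_eqv B.diag_span_is_diag[OF d(1)] P by blast
  qed
  text \<open>The image of the diagonal of \<open>E\<close> is a maximal commutative subalgebra inside the commutative
    diagonal of \<open>F\<close>, so the two agree.\<close>
  have diag': "A.is_diag a" if \<mu>: "B.pth \<mu>" "\<mu> \<noteq> []" and P: "?P a (mon (B.proj_word \<mu>))" for \<mu> a
  proof (rule A.is_diagI)
    show a: "a \<in> FA R E" using P by blast
    fix y q assume y: "y \<in> A.X" and q: "A.row a (y, 0) q \<noteq> 0"
    have qX: "fst q \<in> A.X" using A.row_in_X[OF a _ q] y by simp
    show "fst q = y"
    proof (rule ccontr)
      assume "fst q \<noteq> y"
      then obtain n where n: "n > 0" "prefix n y \<noteq> prefix n (fst q)"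
        using word_eq_iff_prefix[of y "fst q"] by metis
      define \<alpha> where "\<alpha> = prefix n y"
      have \<alpha>: "A.pth \<alpha>" "\<alpha> \<noteq> []" using A.X_prefix[OF y] n by (auto simp: \<alpha>_def)
      note p = A.FA_proj_word[OF \<alpha>] and m = B.FA_proj_word[OF \<mu>]
      let ?b = "\<phi> (mon (A.proj_word \<alpha>))"
      have Pp: "?P (mon (A.proj_word \<alpha>)) ?b" using p \<phi>F by simp
      have bd: "B.is_diag ?b" by (rule diag[OF \<alpha> Pp])
      have eqB: "B.eqv (fa_mult (mon (B.proj_word \<mu>)) ?b) (fa_mult ?b (mon (B.proj_word \<mu>)))"
        unfolding B.eqv_def
      proof (rule B.faithful)
        show "fa_diff (fa_mult (mon (B.proj_word \<mu>)) ?b) (fa_mult ?b (mon (B.proj_word \<mu>))) \<in> FA R F"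
          by (intro B.FA_diff B.FA_mult m \<phi>F p)
        fix x r assume x: "x \<in> B.X"
        show "B.row (fa_diff (fa_mult (mon (B.proj_word \<mu>)) ?b) (fa_mult ?b (mon (B.proj_word \<mu>)))) (x, 0) r = 0"
          using x m \<phi>F[OF p] bd
          by (simp add: B.row_diff B.FA_mult B.row_mult_diag_left B.is_diag_proj_word B.row_diag B.dval_proj_word B.ract_proj_word)
      qed
      have c1: "?P (fa_mult a (mon (A.proj_word \<alpha>))) (fa_mult (mon (B.proj_word \<mu>)) ?b)"
        and c2: "?P (fa_mult (mon (A.proj_word \<alpha>)) a) (fa_mult ?b (mon (B.proj_word \<mu>)))"
        using mult P Pp by blast+
      have "B.eqv (\<phi> (fa_mult a (mon (A.proj_word \<alpha>)))) (\<phi> (fa_mult (mon (A.proj_word \<alpha>)) a))"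
        using c1 c2 eqB B.eqv_trans B.eqv_sym by blast
      then have "A.eqv (fa_mult a (mon (A.proj_word \<alpha>))) (fa_mult (mon (A.proj_word \<alpha>)) a)"
        using \<phi>iff c1 c2 by blast
      \<comment> \<open>At \<open>q\<close> the left product has entry 0 and the right one
        \<open>A.row a (y, 0) q\<close>, because the cylinder contains \<open>y\<close> but not
        \<open>fst q\<close>.\<close>
      then have "A.row (fa_mult a (mon (A.proj_word \<alpha>))) (y, 0) q = A.row (fa_mult (mon (A.proj_word \<alpha>)) a) (y, 0) q"
        by (rule A.eqv_row) (use a p y in \<open>auto intro: A.FA_mult\<close>)
      moreover have "A.dval (mon (A.proj_word \<alpha>)) y = 1" using y by (simp add: A.dval_proj_word \<alpha>_def)
      moreover have "A.dval (mon (A.proj_word \<alpha>)) (fst q) = 0"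
        using qX n(2) by (auto simp: A.dval_proj_word \<alpha>_def)
      ultimately show False
        using q a p y by (simp add: A.row_mult_diag_left A.row_mult_diag_right A.is_diag_proj_word)
    qed
  qed
  show ?thesis unfolding eB
  proof unfold_locales
    show "a \<in> FA R E \<and> b \<in> FA R F" if "?P a b" for a b using that by blast
    show "\<exists>b. ?P a b" if "a \<in> FA R E" for a using that \<phi>F B.eqv_refl by blast
    show "\<exists>a. ?P a b" if "b \<in> FA R F" for b using \<phi>surj[OF that] that by blast
    show "?P (\<lambda>w. 0) (\<lambda>w. 0)" using \<phi>0 by (simp add: B.eqv_zero)
  qed (fact add mult smult star ideal diag diag')+
qed

lemma lpaI:
  assumes "finite_graph G" "essential_graph G" "condition_L G" "conj_closed_unital_subring R"
  shows "lpa G R"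
  using assms unfolding finite_graph_def essential_graph_def
  by (auto simp: lpa_def lpa_axioms_def)

theorem theorem6p3:
  fixes R :: "complex set"
    and E :: "('v1,'e1) pre_digraph" and F :: "('v2,'e2) pre_digraph"
  assumes "finite_graph E" "essential_graph E" "strongly_connected E" "condition_L E"
    and "finite_graph F" "essential_graph F" "strongly_connected F" "condition_L F"
    and "conj_closed_unital_subring R"
    and "\<forall>p. is_projection R F p \<longrightarrow> in_diagonal R F p"
    and "star_isomorphic R E F"
  shows "sgn (det_I_minus_A E) = sgn (det_I_minus_A F)"
proof -
  obtain \<phi> where "star_iso_on R E F \<phi>"
    using assms(11) unfolding star_isomorphic_def by blast
  then interpret lpa_pair E F R "\<lambda>a b. a \<in> FA R E \<and> b \<in> FA R F \<and> lpa_eq R F (\<phi> a) b"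
    using assms by (intro star_iso_lpa_pair lpaI)
  show ?thesis using det_eq by simp
qed

end
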